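(* Let $G$ be a second countable locally compact group. The following are equivalent: (i) $G$ has Property $(T_{\ell_p})$ for some $1<p<\infty$, $p\neq 2$; (ii) $G$ has Property $(T;\mathcal R_{\rm mon})$, where $\mathcal R_{\rm mon}$ is the set of monomial unitary representations $\mathrm{Ind}_H^G\chi$ with $H$ an open subgroup of $G$ and $\chi:H\to\mathbf S^1$ a continuous unitary character of $H$.
   Context: All Banach spaces are complex. For $1<p<\infty$, $\ell_p=\ell_p(\mathbf N)$ and $q$ is the conjugate exponent. $\mathbf O(\ell_p)$ is the group of linear bijective isometries of $\ell_p$. An orthogonal representation of $G$ on $\ell_p$ is a homomorphism $\pi:G\to\mathbf O(\ell_p)$ such that $g\mapsto\pi(g)f$ is continuous for all $f\in\ell_p$. A sequence $(f_n)$ in an invariant subspace is a sequence of almost invariant vectors if $\|f_n\|=1$ and $\|\pi(g)f_n-f_n\|\to0$ uniformly on compact subsets of $G$. Let $\pi^*$ be the dual (contragredient) representation on $\ell_q$, $\ell_q^{\pi^*(G)}$ its subspace of invariant vectors, and $\ell_p'(\pi)$ the annihilator of $\ell_q^{\pi^*(G)}$ in $\ell_p$ (a $G$-invariant complement of the invariant vectors $\ell_p^{\pi(G)}$). $G$ has Property $(T_{\ell_p})$ if for no orthogonal representation $\pi$ of $G$ on $\ell_p$ does $\ell'_p(\pi)$ contain a sequence of almost invariant vectors. For a set $\mathcal R$ of unitary representations of $G$ on Hilbert spaces, $G$ has Property $(T;\mathcal R)$ if the trivial representation $1_G$ is not weakly contained in $\bigoplus_{\pi\in\mathcal R}\pi'$,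 where $\pi'$ is the restriction of $\pi$ to the orthogonal complement of its $\pi(G)$-invariant vectors (equivalently, $\bigoplus_{\pi\in\mathcal R}\pi'$ has no sequence of almost invariant unit vectors). $\mathrm{Ind}_H^G\chi$ denotes the induced unitary representation. *)

theory Defs
  imports "HOL-Analysis.Analysis" "HOL-Algebra.Group" "HOL-Algebra.Coset"
begin

definition topological_group :: "('a, 'b) monoid_scheme \<Rightarrow> 'a topology \<Rightarrow> bool" where
  "topological_group G T \<longleftrightarrow> group G \<and> topspace T = carrier G \<and>
     continuous_map (prod_topology T T) T (\<lambda>(x, y). x \<otimes>\<^bsub>G\<^esub> y) \<and>
     continuous_map T T (\<lambda>x. inv\<^bsub>G\<^esub> x)"

definition lcsc_group :: "('a, 'b) monoid_scheme \<Rightarrow> 'a topology \<Rightarrow> bool" where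
  "lcsc_group G T \<longleftrightarrow> topological_group G T \<and> Hausdorff_space T \<and>
     locally_compact_space T \<and> second_countable T"

definition lp_space :: "real \<Rightarrow> (nat \<Rightarrow> complex) set" where
  "lp_space p = {f. summable (\<lambda>n. cmod (f n) powr p)}"

definition lp_norm :: "real \<Rightarrow> (nat \<Rightarrow> complex) \<Rightarrow> real" where
  "lp_norm p f = (\<Sum>n. cmod (f n) powr p) powr (1 / p)"

definition conj_exp :: "real \<Rightarrow> real" where
  "conj_exp p = p / (p - 1)"

definition lp_pair :: "(nat \<Rightarrow> complex) \<Rightarrow> (nat \<Rightarrow> complex) \<Rightarrow> complex" where
  "lp_pair f h = (\<Sum>n. f n * h n)"

definition lp_isometry :: "real \<Rightarrow> ((nat \<Rightarrow> complex) \<Rightarrow> (nat \<Rightarrow> complex)) \<Rightarrow> bool" where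
  "lp_isometry p U \<longleftrightarrow> bij_betw U (lp_space p) (lp_space p) \<and>
     (\<forall>f\<in>lp_space p. \<forall>g\<in>lp_space p. \<forall>a b::complex.
         U (\<lambda>n. a * f n + b * g n) = (\<lambda>n. a * U f n + b * U g n)) \<and>
     (\<forall>f\<in>lp_space p. lp_norm p (U f) = lp_norm p f)"

definition orth_rep :: "('a, 'b) monoid_scheme \<Rightarrow> 'a topology \<Rightarrow> real \<Rightarrow>
    ('a \<Rightarrow> (nat \<Rightarrow> complex) \<Rightarrow> (nat \<Rightarrow> complex)) \<Rightarrow> bool" where
  "orth_rep G T p \<pi> \<longleftrightarrow>
     (\<forall>g\<in>carrier G. lp_isometry p (\<pi> g)) \<and>
     (\<forall>g\<in>carrier G. \<forall>h\<in>carrier G. \<forall>f\<in>lp_space p.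
         \<pi> (g \<otimes>\<^bsub>G\<^esub> h) f = \<pi> g (\<pi> h f)) \<and>
     (\<forall>f\<in>lp_space p. \<pi> \<one>\<^bsub>G\<^esub> f = f) \<and>
     (\<forall>f\<in>lp_space p. \<forall>g0\<in>carrier G. \<forall>e>0. \<exists>U. openin T U \<and> g0 \<in> U \<and>
         (\<forall>g\<in>U. lp_norm p (\<lambda>n. \<pi> g f n - \<pi> g0 f n) < e))"

text \<open>Invariant vectors of the contragredient representation on l_q.\<close>
definition dual_invariants :: "('a, 'b) monoid_scheme \<Rightarrow> real \<Rightarrow>
    ('a \<Rightarrow> (nat \<Rightarrow> complex) \<Rightarrow> (nat \<Rightarrow> complex)) \<Rightarrow> (nat \<Rightarrow> complex) set" where
  "dual_invariants G p \<pi> = {h \<in> lp_space (conj_exp p).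
      \<forall>g\<in>carrier G. \<forall>f\<in>lp_space p. lp_pair (\<pi> g f) h = lp_pair f h}"

definition lp_prime :: "('a, 'b) monoid_scheme \<Rightarrow> real \<Rightarrow>
    ('a \<Rightarrow> (nat \<Rightarrow> complex) \<Rightarrow> (nat \<Rightarrow> complex)) \<Rightarrow> (nat \<Rightarrow> complex) set" where
  "lp_prime G p \<pi> = {f \<in> lp_space p. \<forall>h\<in>dual_invariants G p \<pi>. lp_pair f h = 0}"

definition has_almost_inv_lp :: "('a, 'b) monoid_scheme \<Rightarrow> 'a topology \<Rightarrow> real \<Rightarrow>
    ('a \<Rightarrow> (nat \<Rightarrow> complex) \<Rightarrow> (nat \<Rightarrow> complex)) \<Rightarrow> bool" where
  "has_almost_inv_lp G T p \<pi> \<longleftrightarrow>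
     (\<exists>F :: nat \<Rightarrow> nat \<Rightarrow> complex.
        (\<forall>k. F k \<in> lp_prime G p \<pi> \<and> lp_norm p (F k) = 1) \<and>
        (\<forall>K. compactin T K \<longrightarrow> (\<forall>e>0. \<forall>\<^sub>F k in sequentially.
            \<forall>g\<in>K. lp_norm p (\<lambda>n. \<pi> g (F k) n - F k n) < e)))"

definition property_T_lp :: "('a, 'b) monoid_scheme \<Rightarrow> 'a topology \<Rightarrow> real \<Rightarrow> bool" where
  "property_T_lp G T p \<longleftrightarrow>
     (\<forall>\<pi>. orth_rep G T p \<pi> \<longrightarrow> \<not> has_almost_inv_lp G T p \<pi>)"

section \<open>Monomial representations Ind_H^G chi (H open, so G/H is discrete)\<close>

definition lcoset_space :: "('a, 'b) monoid_scheme \<Rightarrow> 'a set \<Rightarrow> 'a set set" where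
  "lcoset_space G H = (\<Union>a\<in>carrier G. {a <#\<^bsub>G\<^esub> H})"

definition unitary_char :: "('a, 'b) monoid_scheme \<Rightarrow> 'a topology \<Rightarrow> 'a set \<Rightarrow> ('a \<Rightarrow> complex) \<Rightarrow> bool" where
  "unitary_char G T H chi \<longleftrightarrow>
     (\<forall>h\<in>H. cmod (chi h) = 1) \<and>
     (\<forall>h\<in>H. \<forall>k\<in>H. chi (h \<otimes>\<^bsub>G\<^esub> k) = chi h * chi k) \<and>
     continuous_map (subtopology T H) euclidean chi \<and>
     (\<forall>x. x \<notin> H \<longrightarrow> chi x = 0)"

definition R_mon :: "('a, 'b) monoid_scheme \<Rightarrow> 'a topology \<Rightarrow> ('a set \<times> ('a \<Rightarrow> complex)) set" where
  "R_mon G T = {(H, chi). subgroup H G \<and> openin T H \<and> unitary_char G T H chi}"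

text \<open>Squared norm in Ind_H^G chi: sum over G/H (counting measure) of |phi(x)|^2,
  where x is any representative of the coset (|phi| is constant on cosets).\<close>
definition ind_norm2 :: "('a, 'b) monoid_scheme \<Rightarrow> 'a set \<Rightarrow> ('a \<Rightarrow> complex) \<Rightarrow> real" where
  "ind_norm2 G H \<phi> = infsum (\<lambda>C. (cmod (\<phi> (SOME x. x \<in> C)))\<^sup>2) (lcoset_space G H)"

definition ind_inner :: "('a, 'b) monoid_scheme \<Rightarrow> 'a set \<Rightarrow> ('a \<Rightarrow> complex) \<Rightarrow> ('a \<Rightarrow> complex) \<Rightarrow> complex" where
  "ind_inner G H \<phi> \<psi> = infsum (\<lambda>C. \<phi> (SOME x. x \<in> C) * cnj (\<psi> (SOME x. x \<in> C))) (lcoset_space G H)"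

definition ind_space :: "('a, 'b) monoid_scheme \<Rightarrow> 'a set \<Rightarrow> ('a \<Rightarrow> complex) \<Rightarrow> ('a \<Rightarrow> complex) set" where
  "ind_space G H chi = {\<phi>.
      (\<forall>x\<in>carrier G. \<forall>h\<in>H. \<phi> (x \<otimes>\<^bsub>G\<^esub> h) = cnj (chi h) * \<phi> x) \<and>
      (\<forall>x. x \<notin> carrier G \<longrightarrow> \<phi> x = 0) \<and>
      (\<lambda>C. (cmod (\<phi> (SOME x. x \<in> C)))\<^sup>2) summable_on (lcoset_space G H)}"

definition ind_act :: "('a, 'b) monoid_scheme \<Rightarrow> 'a \<Rightarrow> ('a \<Rightarrow> complex) \<Rightarrow> ('a \<Rightarrow> complex)" where
  "ind_act G g \<phi> = (\<lambda>x. \<phi> (inv\<^bsub>G\<^esub> g \<otimes>\<^bsub>G\<^esub> x))"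

definition ind_invariants :: "('a, 'b) monoid_scheme \<Rightarrow> 'a set \<Rightarrow> ('a \<Rightarrow> complex) \<Rightarrow> ('a \<Rightarrow> complex) set" where
  "ind_invariants G H chi = {\<phi> \<in> ind_space G H chi. \<forall>g\<in>carrier G. \<forall>x\<in>carrier G. ind_act G g \<phi> x = \<phi> x}"

definition ind_compl :: "('a, 'b) monoid_scheme \<Rightarrow> 'a set \<Rightarrow> ('a \<Rightarrow> complex) \<Rightarrow> ('a \<Rightarrow> complex) set" where
  "ind_compl G H chi = {\<phi> \<in> ind_space G H chi. \<forall>\<psi>\<in>ind_invariants G H chi. ind_inner G H \<phi> \<psi> = 0}"

text \<open>Almost invariant unit vectors in the Hilbert direct sum of the pi', pi in R_mon.
  A vector of the direct sum is a family Phi indexed by R_mon.\<close>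
definition has_almost_inv_Rmon :: "('a, 'b) monoid_scheme \<Rightarrow> 'a topology \<Rightarrow> bool" where
  "has_almost_inv_Rmon G T \<longleftrightarrow>
     (\<exists>\<Phi> :: nat \<Rightarrow> ('a set \<times> ('a \<Rightarrow> complex)) \<Rightarrow> 'a \<Rightarrow> complex.
        (\<forall>k. (\<forall>(H, chi)\<in>R_mon G T. \<Phi> k (H, chi) \<in> ind_compl G H chi) \<and>
             (\<lambda>(H, chi). ind_norm2 G H (\<Phi> k (H, chi))) summable_on R_mon G T \<and>
             infsum (\<lambda>(H, chi). ind_norm2 G H (\<Phi> k (H, chi))) (R_mon G T) = 1) \<and>
        (\<forall>K. compactin T K \<longrightarrow> (\<forall>e>0. \<forall>\<^sub>F k in sequentially. \<forall>g\<in>K.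
            infsum (\<lambda>(H, chi). ind_norm2 G H
               (\<lambda>x. ind_act G g (\<Phi> k (H, chi)) x - \<Phi> k (H, chi) x)) (R_mon G T) < e)))"

definition property_T_Rmon :: "('a, 'b) monoid_scheme \<Rightarrow> 'a topology \<Rightarrow> bool" where
  "property_T_Rmon G T \<longleftrightarrow> \<not> has_almost_inv_Rmon G T"

end

theory Submission
  imports Defs
begin

text \<open>
  The representations \<open>Ind\<^sub>H\<^sup>G \<chi>\<close> make sense on p-summable functions for every exponent p, and the Mazur
  map \<open>a \<mapsto> |a|\<^bsup>r-1\<^esup> a\<close> commutes with all of them; being multiplicative and continuous at 1 it preserves
  almost invariant vectors, so their existence in the complement of the invariant ones does not
  depend on p. Almost invariant vectors \<open>\<phi>\<^sub>n\<close> in \<open>Ind \<chi>\<^sub>n\<close> for the exponent p give an isometric monomial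
  representation on the functions on the countable disjoint union of the coset spaces. Conversely,
  isometries for an exponent other than 2 are monomial; the exponent 4 suffices, where this follows
  from an explicit identity. Such a representation splits over the orbits into representations
  \<open>Ind \<chi>\<close>. Both in this splitting, where a representation can occur repeatedly, and in the direct
  sum over all monomial representations, one has to find a single summand with almost invariant
  vectors, uniformly on compact sets; this is an averaging argument.
\<close>

section \<open>Power sums and the Mazur map\<close>

text \<open>The step that carries the weight is the choice of one summand. If the total displacement
  is small at each g, pigeonhole gives a good summand for that g, but the summand may change with g,
  and a compact set is usually infinite. The choice is therefore made once, against an average over
  an auxiliary compact set: the chosen summand is displaced little at most points of that set, every
  k in K is a quotient of two such points, and the triangle inequality covers all of K. The obstacle
  in changing the exponent is that the Mazur map does not respect the complement of the invariant
  vectors. In an induced representation that complement is proper only when the constants over a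
  finite coset space are invariant, and there it consists of the mean-zero functions. The image is
  recentred; since a mean-zero function is far from every constant, a fixed proportion of the norm
  remains. Norms are kept as p-th powers: these add over blocks and orbits, and every inequality is
  needed only up to constants depending on the exponents.\<close>

definition psummable :: "real \<Rightarrow> 'x set \<Rightarrow> ('x \<Rightarrow> complex) \<Rightarrow> bool" where
  "psummable p X v \<longleftrightarrow> (\<lambda>x. cmod (v x) powr p) summable_on X"

definition psum :: "real \<Rightarrow> 'x set \<Rightarrow> ('x \<Rightarrow> complex) \<Rightarrow> real" where
  "psum p X v = (\<Sum>\<^sub>\<infinity>x\<in>X. cmod (v x) powr p)"

lemma psum_nonneg: "0 \<le> psum p X v"
  by (simp add: psum_def infsum_nonneg)

lemma psummable_cong:
  assumes "\<And>x. x \<in> X \<Longrightarrow> cmod (v x) = cmod (w x)"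
  shows "psummable p X v \<longleftrightarrow> psummable p X w"
  unfolding psummable_def by (intro summable_on_cong) (simp add: assms)

lemma psum_cong:
  assumes "\<And>x. x \<in> X \<Longrightarrow> cmod (v x) = cmod (w x)"
  shows "psum p X v = psum p X w"
  unfolding psum_def by (intro infsum_cong) (simp add: assms)

lemma psummable_finite [simp]: "finite X \<Longrightarrow> psummable p X v"
  by (simp add: psummable_def)

lemma psum_finite [simp]: "finite X \<Longrightarrow> psum p X v = (\<Sum>x\<in>X. cmod (v x) powr p)"
  by (simp add: psum_def)

lemma psum_reindex:
  assumes "bij_betw \<sigma> X Y"
  shows "psum p X (\<lambda>x. v (\<sigma> x)) = psum p Y v"
    and "psummable p X (\<lambda>x. v (\<sigma> x)) \<longleftrightarrow> psummable p Y v"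
  unfolding psum_def psummable_def
  using infsum_reindex_bij_betw[OF assms, of "\<lambda>y. cmod (v y) powr p"]
    summable_on_reindex_bij_betw[OF assms, of "\<lambda>y. cmod (v y) powr p"] by auto

text \<open>Compares with twice the larger of the two moduli. The constant \<open>2 powr p\<close>
  reappears as the factor \<open>Q\<close> of \<open>select_component\<close>.\<close>

lemma cmod_add_powr:
  assumes "0 < p"
  shows "cmod (a + b) powr p \<le> 2 powr p * (cmod a powr p + cmod b powr p)"
proof -
  let ?m = "max (cmod a) (cmod b)"
  have "cmod (a + b) \<le> 2 * ?m"
    using norm_triangle_ineq[of a b] by linarith
  then have "cmod (a + b) powr p \<le> (2 * ?m) powr p"
    using assms by (intro powr_mono2) auto
  also have "\<dots> = 2 powr p * ?m powr p"
    by (simp add: powr_mult)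
  also have "?m powr p \<le> cmod a powr p + cmod b powr p"
    by (simp add: max_def)
  finally show ?thesis
    by simp
qed

lemma psum_add:
  assumes "0 < p" "psummable p X v" "psummable p X w"
  shows "psummable p X (\<lambda>x. v x + w x)"
    and "psum p X (\<lambda>x. v x + w x) \<le> 2 powr p * (psum p X v + psum p X w)"
proof -
  have s: "(\<lambda>x. 2 powr p * (cmod (v x) powr p + cmod (w x) powr p)) summable_on X"
    using assms by (intro summable_on_cmult_right summable_on_add) (auto simp: psummable_def)
  show 1: "psummable p X (\<lambda>x. v x + w x)"
    unfolding psummable_def
    by (rule summable_on_comparison_test[OF s]) (use assms in \<open>auto intro: cmod_add_powr\<close>)
  have "psum p X (\<lambda>x. v x + w x) \<le> (\<Sum>\<^sub>\<infinity>x\<in>X. 2 powr p * (cmod (v x) powr p + cmod (w x) powr p))"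
    unfolding psum_def
    by (rule infsum_mono[OF _ s]) (use assms 1 in \<open>auto intro: cmod_add_powr simp: psummable_def\<close>)
  also have "\<dots> = 2 powr p * (psum p X v + psum p X w)"
    using assms unfolding psum_def
    by (simp add: infsum_cmult_right' infsum_add psummable_def)
  finally show "psum p X (\<lambda>x. v x + w x) \<le> 2 powr p * (psum p X v + psum p X w)" .
qed

lemma psum_diff:
  assumes "0 < p" "psummable p X v" "psummable p X w"
  shows "psummable p X (\<lambda>x. v x - w x)"
    and "psum p X (\<lambda>x. v x - w x) \<le> 2 powr p * (psum p X v + psum p X w)"
proof -
  have w: "psummable p X (\<lambda>x. - w x)" "psum p X (\<lambda>x. - w x) = psum p X w"
    using assms(3) by (simp_all add: psummable_def psum_def)
  show "psummable p X (\<lambda>x. v x - w x)"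
    and "psum p X (\<lambda>x. v x - w x) \<le> 2 powr p * (psum p X v + psum p X w)"
    using psum_add[OF assms(1,2) w(1)] by (simp_all add: w(2))
qed

lemma psum_cmult:
  assumes "psummable p X v"
  shows "psummable p X (\<lambda>x. c * v x)" "psum p X (\<lambda>x. c * v x) = cmod c powr p * psum p X v"
  using assms unfolding psummable_def psum_def
  by (auto simp: norm_mult powr_mult infsum_cmult_right' intro: summable_on_cmult_right)

section \<open>The Mazur map and its continuity estimates\<close>

definition mazur :: "real \<Rightarrow> complex \<Rightarrow> complex" where
  "mazur r a = of_real (cmod a powr (r - 1)) * a"

lemma mazur_0 [simp]: "mazur r 0 = 0"
  by (simp add: mazur_def)

lemma cmod_mazur: "cmod (mazur r a) = cmod a powr r"
proof (cases "a = 0")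
  case False
  then have "cmod a powr (r - 1) * cmod a powr 1 = cmod a powr r"
    by (subst powr_add[symmetric]) simp
  then show ?thesis
    using False by (simp add: mazur_def norm_mult)
qed (simp add: mazur_def)

lemma mazur_mult: "mazur r (a * b) = mazur r a * mazur r b"
  by (simp add: mazur_def norm_mult powr_mult)

lemma mazur_unimodular: "cmod u = 1 \<Longrightarrow> mazur r u = u"
  by (simp add: mazur_def)

lemma mazur_mazur: "r \<noteq> 0 \<Longrightarrow> mazur (1 / r) (mazur r a) = a"
proof (cases "a = 0")
  case False
  assume "r \<noteq> 0"
  have "mazur (1 / r) (mazur r a) = of_real ((cmod a powr r) powr (1 / r - 1) * cmod a powr (r - 1)) * a"
    by (simp add: mazur_def[of "1 / r"] cmod_mazur) (simp add: mazur_def)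
  also have "(cmod a powr r) powr (1 / r - 1) * cmod a powr (r - 1) = 1"
    using False \<open>r \<noteq> 0\<close> by (simp add: powr_powr powr_add[symmetric] algebra_simps)
  finally show ?thesis
    by simp
qed simp

text \<open>Multiplicativity of the Mazur map reduces the estimate to continuity at 1.\<close>
lemma mazur_estimate:
  fixes p s \<eta> :: real
  assumes "0 < p" "0 < s" "0 < \<eta>"
  obtains C where "0 < C"
    "\<And>a b. cmod (mazur (p / s) a - mazur (p / s) b) powr s
            \<le> \<eta> * cmod a powr p + C * cmod (a - b) powr p"
proof -
  define r where "r = p / s"
  have r: "0 < r" "r * s = p"
    using assms by (auto simp: r_def)
  have "isCont (mazur r) 1"
    unfolding mazur_def by (intro continuous_intros) auto
  moreover have "0 < \<eta> powr (1 / s)"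
    using assms by simp
  ultimately obtain t where t: "0 < t" "\<And>z. dist z 1 < t \<Longrightarrow> dist (mazur r z) (mazur r 1) < \<eta> powr (1 / s)"
    unfolding continuous_at_eps_delta by meson
  \<comment> \<open>\<open>D\<close> bounds both moduli in the far case below: \<open>cmod a\<close>
    is at most \<open>cmod (a - b) / t\<close>, and \<open>cmod b\<close> exceeds it by at most
    \<open>cmod (a - b)\<close>.\<close>
  define D where "D = 1 + 1 / t"
  define C where "C = 2 powr s * D powr p"
  have D: "1 \<le> D"
    using t by (simp add: D_def)
  have "1 \<le> D powr p" "1 \<le> (2::real) powr s"
    using D assms by (auto simp: ge_one_powr_ge_zero)
  then have C1: "1 \<le> C"
    unfolding C_def by (metis mult_mono mult_1 zero_le_one order_trans)
  have est: "cmod (mazur r a - mazur r b) powr s \<le> \<eta> * cmod a powr p + C * cmod (a - b) powr p" for a b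
  \<comment> \<open>Near case: \<open>b / a\<close> lies within \<open>t\<close> of 1, and
    \<open>mazur r a\<close> factors out of the difference. Far case: nothing cancels, and both
    terms are controlled by \<open>cmod (a - b)\<close> alone.\<close>
  proof (cases "cmod (b - a) < t * cmod a")
    case True
    then have a: "a \<noteq> 0"
      by auto
    have "cmod (b / a - 1) = cmod (b - a) / cmod a"
      using a by (metis diff_divide_distrib divide_self norm_divide)
    then have "dist (b / a) 1 < t"
      using True a by (simp add: dist_norm pos_divide_less_eq)
    then have d: "cmod (1 - mazur r (b / a)) \<le> \<eta> powr (1 / s)"
      using t(2)[of "b / a"] mazur_unimodular[of 1 r] by (simp add: dist_norm norm_minus_commute)
    have "mazur r a - mazur r b = mazur r a * (1 - mazur r (b / a))"
      using mazur_mult[of r a "b / a"] a by (simp add: algebra_simps)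
    then have "cmod (mazur r a - mazur r b) powr s = (cmod a powr r) powr s * cmod (1 - mazur r (b / a)) powr s"
      by (simp add: norm_mult cmod_mazur powr_mult)
    also have "\<dots> \<le> (cmod a powr r) powr s * (\<eta> powr (1 / s)) powr s"
      using d assms by (intro mult_left_mono powr_mono2) auto
    also have "\<dots> = \<eta> * cmod a powr p"
      using r assms by (simp add: powr_powr)
    finally show ?thesis
      using C1 by (smt (verit) powr_ge_zero mult_nonneg_nonneg)
  next
    case False
    then have a: "cmod a \<le> cmod (a - b) / t"
      using t by (simp add: field_simps norm_minus_commute)
    then have a': "cmod a \<le> D * cmod (a - b)"
      by (simp add: D_def algebra_simps) (smt (verit) norm_ge_zero)
    have "cmod b \<le> cmod a + cmod (a - b)"
      by (metis norm_minus_commute norm_triangle_sub)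
    with a have b': "cmod b \<le> D * cmod (a - b)"
      by (simp add: D_def algebra_simps)
    have "cmod (mazur r a - mazur r b) \<le> cmod a powr r + cmod b powr r"
      using norm_triangle_ineq4[of "mazur r a" "mazur r b"] by (simp add: cmod_mazur)
    also have "\<dots> \<le> 2 * (D * cmod (a - b)) powr r"
      using powr_mono2[OF _ norm_ge_zero a', of r] powr_mono2[OF _ norm_ge_zero b', of r] r by simp
    finally have "cmod (mazur r a - mazur r b) powr s \<le> (2 * (D * cmod (a - b)) powr r) powr s"
      using assms by (intro powr_mono2) auto
    also have "\<dots> = C * cmod (a - b) powr p"
      using D r by (simp add: powr_mult powr_powr C_def)
    finally show ?thesis
      using assms by (smt (verit) powr_ge_zero mult_nonneg_nonneg)
  qed
  show thesis
    by (rule that[of C]) (use C1 est in \<open>auto simp: r_def\<close>)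
qed

lemma psum_mazur: "psum s X (\<lambda>x. mazur (p / s) (v x)) = psum p X v"
  "psummable s X (\<lambda>x. mazur (p / s) (v x)) \<longleftrightarrow> psummable p X v" if "0 < s"
  using that by (simp_all add: psum_def psummable_def cmod_mazur powr_powr)

text \<open>The constant depends on \<open>p\<close>, \<open>s\<close> and \<open>\<eta>\<close> but
  not on the index set, so one constant serves all induced representations at once.\<close>

lemma psum_mazur_estimate:
  fixes p s \<eta> :: real
  assumes "0 < p" "0 < s" "0 < \<eta>"
  obtains C where "0 < C"
    "\<And>(X::'x set) v w. psummable p X v \<Longrightarrow> psummable p X w \<Longrightarrow>
       psum s X (\<lambda>x. mazur (p / s) (v x) - mazur (p / s) (w x))
            \<le> \<eta> * psum p X v + C * psum p X (\<lambda>x. v x - w x)"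
proof -
  obtain C where C: "0 < C"
    "\<And>a b. cmod (mazur (p / s) a - mazur (p / s) b) powr s
            \<le> \<eta> * cmod a powr p + C * cmod (a - b) powr p"
    using mazur_estimate[OF assms] by metis
  have "psum s X (\<lambda>x. mazur (p / s) (v x) - mazur (p / s) (w x))
            \<le> \<eta> * psum p X v + C * psum p X (\<lambda>x. v x - w x)"
    if v: "psummable p X v" and w: "psummable p X w" for X :: "'x set" and v w
  proof -
    note d = psum_diff(1)[OF assms(1) v w]
    have "psummable s X (\<lambda>x. mazur (p / s) (v x) - mazur (p / s) (w x))"
      by (intro psum_diff) (use assms v w in \<open>auto simp: psum_mazur\<close>)
    moreover have s: "(\<lambda>x. \<eta> * cmod (v x) powr p) summable_on X" "(\<lambda>x. C * cmod (v x - w x) powr p) summable_on X"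
      using v d unfolding psummable_def by (auto intro: summable_on_cmult_right)
    ultimately have "psum s X (\<lambda>x. mazur (p / s) (v x) - mazur (p / s) (w x))
        \<le> (\<Sum>\<^sub>\<infinity>x\<in>X. \<eta> * cmod (v x) powr p + C * cmod (v x - w x) powr p)"
      unfolding psum_def using C by (intro infsum_mono summable_on_add) (auto simp: psummable_def)
    also have "\<dots> = \<eta> * psum p X v + C * psum p X (\<lambda>x. v x - w x)"
      by (subst infsum_add[OF s]) (simp add: psum_def infsum_cmult_right')
    finally show ?thesis .
  qed
  with C(1) show thesis
    by (rule that)
qed

text \<open>Jensen's inequality for \<open>t powr p\<close>: the values \<open>f x - w\<close> have
  mean \<open>- w\<close>, so their moduli have mean at least \<open>cmod w\<close>.\<close>

lemma sum_powr_centred: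
  fixes f :: "'x \<Rightarrow> complex"
  assumes "finite X" "1 < p" "sum f X = 0"
  shows "card X * cmod w powr p \<le> (\<Sum>x\<in>X. cmod (f x - w) powr p)"
proof (cases "w = 0")
  case False
  let ?t = "\<lambda>x. cmod (f x - w) / cmod w"
  \<comment> \<open>Tangent line of \<open>t powr p\<close> at 1, read off from Young's inequality
    with second factor 1.\<close>
  have tangent: "t powr p \<ge> 1 + p * (t - 1)" if "0 \<le> t" for t :: real
  proof -
    define q where "q = p / (p - 1)"
    have q: "1 < q" "1 / p + 1 / q = 1" "p / q = p - 1"
      using assms by (auto simp: q_def field_simps)
    have "t * 1 \<le> t powr p / p + 1 powr q / q"
      using Youngs_inequality[of p q t 1] assms q that by simp
    then have "p * t \<le> p * (t powr p / p + 1 / q)"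
      using assms by (intro mult_left_mono) auto
    then show ?thesis
      using assms q by (simp add: algebra_simps)
  qed
  have "card X * cmod w = cmod (\<Sum>x\<in>X. f x - w)"
    using assms by (simp add: sum_subtractf norm_mult)
  also have "\<dots> \<le> (\<Sum>x\<in>X. cmod (f x - w))"
    by (rule norm_sum)
  finally have avg: "card X \<le> (\<Sum>x\<in>X. ?t x)"
    using False by (simp add: sum_divide_distrib[symmetric] pos_le_divide_eq)
  have "real (card X) \<le> (\<Sum>x\<in>X. 1 + p * (?t x - 1))"
    using avg assms by (simp add: sum.distrib sum_distrib_left[symmetric] sum_subtractf)
  also have "\<dots> \<le> (\<Sum>x\<in>X. ?t x powr p)"
    by (intro sum_mono tangent) auto
  also have "\<dots> = (\<Sum>x\<in>X. cmod (f x - w) powr p) / cmod w powr p"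
    by (simp add: powr_divide sum_divide_distrib)
  finally show ?thesis
    using False by (simp add: pos_le_divide_eq)
qed (simp add: sum_nonneg)

text \<open>Mean-zero functions stay away from constants, up to a factor; this keeps the recentring
  in \<open>almost_invariant_exponent\<close> from destroying the vector.\<close>

lemma psum_centred:
  fixes f :: "'x \<Rightarrow> complex"
  assumes "finite X" "1 < p" "sum f X = 0"
  shows "psum p X f \<le> 2 powr (p + 1) * psum p X (\<lambda>x. f x - w)"
proof -
  have "psum p X f \<le> 2 powr p * (psum p X (\<lambda>x. f x - w) + psum p X (\<lambda>x. w))"
    using psum_add(2)[of p X "\<lambda>x. f x - w" "\<lambda>x. w"] assms by simp
  also have "psum p X (\<lambda>x. w) \<le> psum p X (\<lambda>x. f x - w)"
    using sum_powr_centred[OF assms] assms by simp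
  finally show ?thesis
    by (simp add: powr_add)
qed

section \<open>Selecting a component of a direct sum\<close>

locale lcsc = group G for G (structure) +
  fixes T :: "'a topology"
  assumes lcsc: "lcsc_group G T"
begin

section \<open>Topology of the group and covers by left translates\<close>

lemma topspace_T [simp]: "topspace T = carrier G"
  and continuous_mult: "continuous_map (prod_topology T T) T (\<lambda>(x, y). x \<otimes> y)"
  and continuous_inv: "continuous_map T T (\<lambda>x. inv x)"
  and locally_compact_T: "locally_compact_space T"
  and second_countable_T: "second_countable T"
  using lcsc by (auto simp: lcsc_group_def topological_group_def)

lemma openin_carrier: "openin T U \<Longrightarrow> x \<in> U \<Longrightarrow> x \<in> carrier G"
  using openin_subset by fastforce

lemma compactin_carrier: "compactin T K \<Longrightarrow> x \<in> K \<Longrightarrow> x \<in> carrier G"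
  using compactin_subset_topspace by fastforce

lemma continuous_map_mult:
  assumes "continuous_map X T f" "continuous_map X T g"
  shows "continuous_map X T (\<lambda>x. f x \<otimes> g x)"
  using continuous_map_compose[OF continuous_map_pairedI[OF assms] continuous_mult]
  by (simp add: o_def)

lemma continuous_map_inv: "continuous_map X T f \<Longrightarrow> continuous_map X T (\<lambda>x. inv f x)"
  using continuous_map_compose[OF _ continuous_inv] by (simp add: o_def)

lemma openin_preimage:
  "continuous_map T T f \<Longrightarrow> openin T U \<Longrightarrow> openin T {x \<in> carrier G. f x \<in> U}"
  using openin_continuous_map_preimage[of T T f U] by simp

lemma l_coset_iff:
  assumes "a \<in> carrier G" "U \<subseteq> carrier G"
  shows "x \<in> a <# U \<longleftrightarrow> x \<in> carrier G \<and> inv a \<otimes> x \<in> U"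
proof
  assume "x \<in> a <# U"
  then show "x \<in> carrier G \<and> inv a \<otimes> x \<in> U"
    using assms by (auto simp: l_coset_def m_assoc[symmetric] subsetD)
next
  assume x: "x \<in> carrier G \<and> inv a \<otimes> x \<in> U"
  then have "x = a \<otimes> (inv a \<otimes> x)"
    using assms by (simp add: m_assoc[symmetric])
  with x show "x \<in> a <# U"
    unfolding l_coset_def by blast
qed

lemma openin_l_coset:
  assumes "a \<in> carrier G" "openin T U"
  shows "openin T (a <# U)"
proof -
  have "a <# U = {x \<in> carrier G. inv a \<otimes> x \<in> U}"
    using assms l_coset_iff[OF assms(1), of U] openin_subset[of T U] by auto
  moreover have "continuous_map T T (\<lambda>x. inv a \<otimes> x)"
    using assms by (intro continuous_map_mult continuous_map_id[unfolded id_def]) auto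
  ultimately show ?thesis
    using openin_preimage assms by simp
qed

lemma compactin_finite_translates:
  assumes "compactin T C" "openin T U" "\<one> \<in> U"
  obtains F where "finite F" "F \<subseteq> C" "C \<subseteq> (\<Union>x\<in>F. x <# U)"
proof -
  have "\<forall>V \<in> (\<lambda>x. x <# U) ` C. openin T V"
    using assms openin_l_coset compactin_carrier by auto
  moreover have "C \<subseteq> \<Union> ((\<lambda>x. x <# U) ` C)"
    using assms compactin_carrier by (force simp: l_coset_def)
  ultimately have "\<exists>\<F>. finite \<F> \<and> \<F> \<subseteq> (\<lambda>x. x <# U) ` C \<and> C \<subseteq> \<Union>\<F>"
    using assms(1) unfolding compactin_def by meson
  then show thesis
    using that by (metis finite_subset_image)
qed

lemma common_neighbourhood:
  assumes "finite J" "\<And>i. i \<in> J \<Longrightarrow> \<exists>U. openin T U \<and> \<one> \<in> U \<and> (\<forall>g\<in>U. P i g)"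
  shows "\<exists>U. openin T U \<and> \<one> \<in> U \<and> (\<forall>g\<in>U. \<forall>i\<in>J. P i g)"
  using assms
proof (induction J rule: finite_induct)
  case empty
  show ?case
    using openin_topspace[of T] by auto
next
  case (insert j J)
  obtain U where "openin T U" "\<one> \<in> U" "\<forall>g\<in>U. \<forall>i\<in>J. P i g"
    using insert.IH[OF insert.prems] by auto
  moreover obtain V where "openin T V" "\<one> \<in> V" "\<forall>g\<in>V. P j g"
    using insert.prems[of j] by auto
  ultimately show ?case
    by (intro exI[of _ "U \<inter> V"]) auto
qed

text \<open>\<open>card A\<close> is the covering number of \<open>S\<close> by left translates of
  \<open>U\<close>, as in the classical construction of Haar measure.\<close>

lemma minimal_cover:
  assumes "compactin T S" "openin T U" "\<one> \<in> U"
  obtains A where "finite A" "A \<subseteq> carrier G" "S \<subseteq> (\<Union>a\<in>A. a <# U)"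
    "\<And>A'. finite A' \<Longrightarrow> A' \<subseteq> carrier G \<Longrightarrow> S \<subseteq> (\<Union>a\<in>A'. a <# U) \<Longrightarrow> card A \<le> card A'"
proof -
  let ?P = "\<lambda>A. finite A \<and> A \<subseteq> carrier G \<and> S \<subseteq> (\<Union>a\<in>A. a <# U)"
  have "\<exists>A. ?P A"
  proof -
    obtain F where "finite F" "F \<subseteq> S" "S \<subseteq> (\<Union>x\<in>F. x <# U)"
      using compactin_finite_translates[OF assms] .
    moreover have "S \<subseteq> carrier G"
      using compactin_carrier[OF assms(1)] by (rule subsetI)
    ultimately show ?thesis
      by (intro exI[of _ F]) simp
  qed
  then obtain A0 where "?P A0" ..
  from ex_has_least_nat[of ?P, OF this, of card]
  obtain A where "?P A \<and> (\<forall>A'. ?P A' \<longrightarrow> card A \<le> card A')" ..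
  then have A: "?P A" and least: "\<forall>A'. ?P A' \<longrightarrow> card A \<le> card A'"
    by simp_all
  show thesis
  proof (rule that)
    show "finite A" "A \<subseteq> carrier G" "S \<subseteq> (\<Union>a\<in>A. a <# U)"
      using A by simp_all
    show "card A \<le> card A'"
      if "finite A'" "A' \<subseteq> carrier G" "S \<subseteq> (\<Union>a\<in>A'. a <# U)" for A'
      using least that by simp
  qed
qed

text \<open>A substitute for Haar measure: minimal covers by left translates of a small neighbourhood
  \<open>U\<close> give a left-invariant subadditive size, and its comparison constants between fixed compact
  sets do not depend on \<open>U\<close>.\<close>
lemma select_component:
  fixes Q :: real
  assumes K: "compactin T K" and Q: "0 < Q"
  obtains L c where "compactin T L" "0 < c"
    "\<And>(J :: 'i set) d w \<delta>. \<lbrakk>finite J;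
       \<And>i g. i \<in> J \<Longrightarrow> g \<in> carrier G \<Longrightarrow> (0::real) \<le> d i g;
       \<And>i g h. i \<in> J \<Longrightarrow> g \<in> carrier G \<Longrightarrow> h \<in> carrier G \<Longrightarrow> d i (g \<otimes> h) \<le> Q * (d i g + d i h);
       \<And>i g. i \<in> J \<Longrightarrow> g \<in> carrier G \<Longrightarrow> d i (inv g) = d i g;
       \<And>i e. i \<in> J \<Longrightarrow> 0 < e \<Longrightarrow> \<exists>U. openin T U \<and> \<one> \<in> U \<and> (\<forall>g\<in>U. d i g < e);
       \<And>i. i \<in> J \<Longrightarrow> 0 \<le> w i; 0 < sum w J; 0 < \<delta>;
       \<And>g. g \<in> L \<Longrightarrow> (\<Sum>i\<in>J. d i g) \<le> c * \<delta> * sum w J\<rbrakk>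
      \<Longrightarrow> \<exists>i\<in>J. 0 < w i \<and> (\<forall>g\<in>K. d i g \<le> 4 * Q\<^sup>2 * \<delta> * w i)"
proof -
  obtain W B where W: "openin T W" "compactin T B" "\<one> \<in> W" "W \<subseteq> B"
    using locally_compact_T unfolding locally_compact_space_def by (metis one_closed topspace_T)
  \<comment> \<open>\<open>C\<close> has to contain \<open>b\<close> and
    \<open>k \<otimes> b\<close> for all \<open>b\<close> in \<open>B\<close> and \<open>k\<close>
    in \<open>K\<close>, because \<open>k\<close> will be written as a quotient of these
    two.\<close>
  define C where "C = B \<union> (\<lambda>(x, y). x \<otimes> y) ` (K \<times> B)"
  have C: "compactin T C"
    unfolding C_def
    by (intro compactin_Un W image_compactin[OF _ continuous_mult]) (simp add: compactin_Times K W)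
  obtain F where F: "finite F" "F \<subseteq> C" "C \<subseteq> (\<Union>x\<in>F. x <# W)"
    using compactin_finite_translates[OF C W(1,3)] .
  \<comment> \<open>\<open>m\<close> is fixed before \<open>U\<close> is chosen and compares
    covering numbers for every small \<open>U\<close>.\<close>
  define m where "m = card F"
  have "\<one> \<in> C"
    using W by (auto simp: C_def)
  then have m: "0 < m"
    using F by (auto simp: m_def card_gt_0_iff)
  \<comment> \<open>\<open>L\<close> catches the centre of every translate of a subset of
    \<open>W\<close> that meets \<open>C\<close>.\<close>
  define L where "L = (\<lambda>(x, y). x \<otimes> inv y) ` (C \<times> B)"
  have "continuous_map (prod_topology T T) T (\<lambda>z. fst z \<otimes> inv (snd z))"
    by (intro continuous_map_mult continuous_map_inv continuous_map_fst continuous_map_snd)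
  then have L: "compactin T L"
    unfolding L_def using C W
    by (intro image_compactin[of "prod_topology T T"]) (auto simp: compactin_Times case_prod_unfold)
  \<comment> \<open>Makes the bad centres below at most a quarter of \<open>card A0\<close> in
    number, so that two copies of them cannot cover \<open>B\<close>.\<close>
  define c :: real where "c = 1 / (4 * m)"
  have c: "0 < c"
    using m by (simp add: c_def)
  show thesis
  proof (rule that[OF L c])
    fix J :: "'i set" and d :: "'i \<Rightarrow> 'a \<Rightarrow> real" and w :: "'i \<Rightarrow> real" and \<delta> :: real
    assume J: "finite J"
      and d0: "\<And>i g. i \<in> J \<Longrightarrow> g \<in> carrier G \<Longrightarrow> 0 \<le> d i g"
      and dm: "\<And>i g h. i \<in> J \<Longrightarrow> g \<in> carrier G \<Longrightarrow> h \<in> carrier G \<Longrightarrow> d i (g \<otimes> h) \<le> Q * (d i g + d i h)"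
      and di: "\<And>i g. i \<in> J \<Longrightarrow> g \<in> carrier G \<Longrightarrow> d i (inv g) = d i g"
      and dc: "\<And>i e. i \<in> J \<Longrightarrow> 0 < e \<Longrightarrow> \<exists>U. openin T U \<and> \<one> \<in> U \<and> (\<forall>g\<in>U. d i g < e)"
      and w0: "\<And>i. i \<in> J \<Longrightarrow> 0 \<le> w i" and w: "0 < sum w J" and \<delta>: "0 < \<delta>"
      and le: "\<And>g. g \<in> L \<Longrightarrow> (\<Sum>i\<in>J. d i g) \<le> c * \<delta> * sum w J"
    \<comment> \<open>This neighbourhood depends on the family \<open>d\<close>. Within a translate
      \<open>a <# U\<close>, the value at the centre \<open>a\<close> then controls
      \<open>d i\<close>, up to \<open>Q\<close> and an error \<open>\<delta> * w i\<close>.\<close>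
    have "\<exists>U. openin T U \<and> \<one> \<in> U \<and> (\<forall>g\<in>U. \<forall>i\<in>J. 0 < w i \<longrightarrow> d i g < \<delta> * w i)"
    proof (intro common_neighbourhood[OF J])
      fix i assume "i \<in> J"
      then show "\<exists>U. openin T U \<and> \<one> \<in> U \<and> (\<forall>g\<in>U. 0 < w i \<longrightarrow> d i g < \<delta> * w i)"
        using dc[of i "\<delta> * w i"] dc[of i 1] \<delta> by (cases "0 < w i") auto
    qed
    then obtain U0 where U0: "openin T U0" "\<one> \<in> U0" "\<And>g i. g \<in> U0 \<Longrightarrow> i \<in> J \<Longrightarrow> 0 < w i \<Longrightarrow> d i g < \<delta> * w i"
      by blast
    define U where "U = U0 \<inter> W"
    have U: "openin T U" "\<one> \<in> U" "U \<subseteq> W" "U \<subseteq> carrier G"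
      using U0 W openin_subset[of T W] by (auto simp: U_def)
    have dU: "d i g \<le> \<delta> * w i" if "g \<in> U" "i \<in> J" "0 < w i" for i g
      using U0(3)[of g i] that by (simp add: U_def)
    obtain A where A: "finite A" "A \<subseteq> carrier G" "C \<subseteq> (\<Union>a\<in>A. a <# U)"
      and Amin: "\<And>A'. finite A' \<Longrightarrow> A' \<subseteq> carrier G \<Longrightarrow> C \<subseteq> (\<Union>a\<in>A'. a <# U) \<Longrightarrow> card A \<le> card A'"
      using minimal_cover[OF C U(1,2)] by metis
    obtain A0 where A0: "finite A0" "A0 \<subseteq> carrier G" "B \<subseteq> (\<Union>a\<in>A0. a <# U)"
      and A0min: "\<And>A'. finite A' \<Longrightarrow> A' \<subseteq> carrier G \<Longrightarrow> B \<subseteq> (\<Union>a\<in>A'. a <# U) \<Longrightarrow> card A0 \<le> card A'"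
      using minimal_cover[OF W(2) U(1,2)] by metis
    have FG: "F \<subseteq> carrier G"
      using F(2) compactin_carrier[OF C] by blast
    have "A0 \<noteq> {}"
      using A0 W by auto
    then have N: "0 < card A0"
      using A0 by (simp add: card_gt_0_iff)
    \<comment> \<open>Submultiplicativity of covering numbers: \<open>m\<close> translates of
      \<open>W\<close> cover \<open>C\<close>, and \<open>card A0\<close> translates of
      \<open>U\<close> cover \<open>B\<close>, hence \<open>W\<close>.\<close>
    have card_A: "card A \<le> m * card A0"
    proof -
      let ?A' = "(\<lambda>(x, a). x \<otimes> a) ` (F \<times> A0)"
      have "C \<subseteq> (\<Union>a\<in>?A'. a <# U)"
      proof
        fix y assume "y \<in> C"
        then obtain x where x: "x \<in> F" "y \<in> x <# W"
          using F by auto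
        then obtain b where b: "b \<in> B" "y = x \<otimes> b"
          using W by (auto simp: l_coset_def)
        then obtain a u where a: "a \<in> A0" "u \<in> U" "b = a \<otimes> u"
          using A0 by (force simp: l_coset_def)
        have "y = (x \<otimes> a) \<otimes> u"
          using b a x FG A0 U by (simp add: m_assoc subsetD)
        then show "y \<in> (\<Union>a\<in>?A'. a <# U)"
          using a x by (force simp: l_coset_def)
      qed
      moreover have "?A' \<subseteq> carrier G"
        using FG A0 by auto
      ultimately have "card A \<le> card ?A'"
        using F A0 by (intro Amin) auto
      also have "\<dots> \<le> card (F \<times> A0)"
        using F A0 by (intro card_image_le) auto
      finally show ?thesis
        by (simp add: m_def card_cartesian_product)
    qed
    \<comment> \<open>By minimality each translate in the cover meets \<open>C\<close>; otherwise it
      could be dropped.\<close>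
    have AL: "a \<in> L" if a: "a \<in> A" for a
    proof -
      have "(a <# U) \<inter> C \<noteq> {}"
      proof
        assume "(a <# U) \<inter> C = {}"
        then have "C \<subseteq> (\<Union>a\<in>A - {a}. a <# U)"
        proof (intro subsetI)
          fix x assume "x \<in> C"
          then show "x \<in> (\<Union>a\<in>A - {a}. a <# U)"
            using A(3) \<open>(a <# U) \<inter> C = {}\<close> by (cases "x \<in> a <# U") auto
        qed
        then have "card A \<le> card (A - {a})"
          using A by (intro Amin) auto
        then show False
          using a A(1) by (metis card_Diff1_less not_less)
      qed
      then obtain u where u: "u \<in> U" "a \<otimes> u \<in> C"
        by (auto simp: l_coset_def)
      have "a = (a \<otimes> u) \<otimes> inv u"
        using a A U u by (simp add: m_assoc subsetD)
      then show ?thesis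
        unfolding L_def using u U W by (intro image_eqI[of _ _ "(a \<otimes> u, u)"]) auto
    qed
    \<comment> \<open>Weighted pigeonhole: otherwise summing the reversed inequalities over
      \<open>J\<close> contradicts the hypothesis at the points of \<open>A\<close>, all of which
      lie in \<open>L\<close>.\<close>
    have "\<exists>i\<in>J. 0 < w i \<and> (\<Sum>a\<in>A. d i a) \<le> c * \<delta> * w i * card A"
    proof (rule ccontr)
      assume neg: "\<not> ?thesis"
      have "(\<Sum>i\<in>J. c * \<delta> * w i * card A) < (\<Sum>i\<in>J. \<Sum>a\<in>A. d i a)"
      proof (rule sum_strict_mono_ex1[OF J])
        show "\<forall>i\<in>J. c * \<delta> * w i * card A \<le> (\<Sum>a\<in>A. d i a)"
        proof
          fix i assume i: "i \<in> J"
          show "c * \<delta> * w i * card A \<le> (\<Sum>a\<in>A. d i a)"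
          proof (cases "0 < w i")
            case True
            then show ?thesis
              using neg i by force
          next
            case False
            then have "w i = 0"
              using w0[OF i] by simp
            then show ?thesis
              using i d0 A by (simp add: sum_nonneg subsetD)
          qed
        qed
        obtain i where "i \<in> J" "0 < w i"
          using w sum_nonpos[of J w] by force
        then show "\<exists>i\<in>J. c * \<delta> * w i * card A < (\<Sum>a\<in>A. d i a)"
          using neg by force
      qed
      also have "\<dots> = (\<Sum>a\<in>A. \<Sum>i\<in>J. d i a)"
        by (rule sum.swap)
      also have "\<dots> \<le> (\<Sum>a\<in>A. c * \<delta> * sum w J)"
        by (intro sum_mono le AL)
      finally show False
        by (simp add: sum_distrib_left sum_distrib_right mult_ac)
    qed
    then obtain i where i: "i \<in> J" "0 < w i" "(\<Sum>a\<in>A. d i a) \<le> c * \<delta> * w i * card A"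
      by blast
    \<comment> \<open>The bad centres; Chebyshev's inequality bounds their number by
      \<open>c * card A\<close>.\<close>
    define D where "D = {a \<in> A. \<delta> * w i < d i a}"
    have D: "finite D" "D \<subseteq> A"
      using A by (auto simp: D_def)
    have "card D * (\<delta> * w i) \<le> (\<Sum>a\<in>D. d i a)"
      using sum_mono[of D "\<lambda>_. \<delta> * w i" "d i"] by (simp add: D_def)
    also have "\<dots> \<le> (\<Sum>a\<in>A. d i a)"
      using D A i d0 by (intro sum_mono2) auto
    also note i(3)
    finally have "card D * (\<delta> * w i) \<le> (c * card A) * (\<delta> * w i)"
      by (simp add: mult_ac)
    then have "card D \<le> c * card A"
      using \<delta> i by (simp add: mult_le_cancel_right)
    also have "\<dots> \<le> c * (m * card A0)"
      using c card_A by (intro mult_left_mono) (auto simp flip: of_nat_mult)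
    also have "\<dots> = card A0 / 4"
      using m by (simp add: c_def)
    finally have cardD: "2 * card D < card A0"
      using N by linarith
    have "d i k \<le> 4 * Q\<^sup>2 * \<delta> * w i" if k: "k \<in> K" for k
    proof -
      have kG: "k \<in> carrier G"
        using compactin_carrier[OF K k] .
      \<comment> \<open>If every \<open>b\<close> failed, the translates with centres in
        \<open>D\<close> and in its shift by \<open>inv k\<close> would cover \<open>B\<close> with
        fewer than \<open>card A0\<close> sets.\<close>
      have "\<exists>b\<in>B. b \<notin> (\<Union>a\<in>D. a <# U) \<and> k \<otimes> b \<notin> (\<Union>a\<in>D. a <# U)"
      proof (rule ccontr)
        assume neg: "\<not> ?thesis"
        let ?D' = "D \<union> (\<lambda>a. inv k \<otimes> a) ` D"
        have "B \<subseteq> (\<Union>a\<in>?D'. a <# U)"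
        proof
          fix b assume b: "b \<in> B"
          then have bG: "b \<in> carrier G"
            using compactin_carrier[OF W(2)] by blast
          show "b \<in> (\<Union>a\<in>?D'. a <# U)"
          proof (cases "b \<in> (\<Union>a\<in>D. a <# U)")
            case False
            then have "k \<otimes> b \<in> (\<Union>a\<in>D. a <# U)"
              using neg b by blast
            then obtain a u where a: "a \<in> D" "u \<in> U" "k \<otimes> b = a \<otimes> u"
              by (auto simp: l_coset_def)
            then have aG: "a \<in> carrier G" "u \<in> carrier G"
              using D A U by auto
            have "b = (inv k \<otimes> a) \<otimes> u"
              using kG bG a aG by (metis inv_closed m_assoc inv_solve_left m_closed)
            then show ?thesis
              using a by (force simp: l_coset_def)
          qed auto
        qed
        moreover have "?D' \<subseteq> carrier G"
          using D A kG by auto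
        ultimately have "card A0 \<le> card ?D'"
          using D by (intro A0min) auto
        also have "\<dots> \<le> card D + card D"
          using card_Un_le[of D "(\<lambda>a. inv k \<otimes> a) ` D"] card_image_le[OF D(1), of "\<lambda>a. inv k \<otimes> a"]
          by linarith
        finally show False
          using cardD by simp
      qed
      then obtain b where b: "b \<in> B" "b \<notin> (\<Union>a\<in>D. a <# U)" "k \<otimes> b \<notin> (\<Union>a\<in>D. a <# U)"
        by blast
      have good: "d i y \<le> 2 * Q * (\<delta> * w i)" if "y \<in> C" and y: "y \<notin> (\<Union>a\<in>D. a <# U)" for y
      proof -
        obtain a where a: "a \<in> A" "y \<in> a <# U"
          using A(3) \<open>y \<in> C\<close> by auto
        then obtain u where u: "u \<in> U" "y = a \<otimes> u"
          by (auto simp: l_coset_def)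
        have "a \<notin> D"
          using a y by blast
        then have "d i a \<le> \<delta> * w i"
          using a by (auto simp: D_def)
        moreover have "d i u \<le> \<delta> * w i"
          using dU u i by blast
        moreover have "d i y \<le> Q * (d i a + d i u)"
          using dm i a u A U by (metis subsetD)
        moreover have "Q * (d i a + d i u) \<le> Q * (\<delta> * w i + \<delta> * w i)"
          using calculation Q by (intro mult_left_mono add_mono) auto
        ultimately show ?thesis
          by simp
      qed
      have bC: "b \<in> C" "k \<otimes> b \<in> C"
        using b k by (auto simp: C_def)
      then have bG: "b \<in> carrier G"
        using compactin_carrier[OF C] by blast
      \<comment> \<open>\<open>k\<close> is a quotient of two good points, which yields the factor
        \<open>4 * Q\<^sup>2\<close>.\<close>
      have "d i k = d i ((k \<otimes> b) \<otimes> inv b)"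
        using kG bG by (simp add: m_assoc)
      also have "\<dots> \<le> Q * (d i (k \<otimes> b) + d i b)"
        using dm[of i "k \<otimes> b" "inv b"] di[of i b] i kG bG by simp
      also have "\<dots> \<le> Q * (2 * Q * (\<delta> * w i) + 2 * Q * (\<delta> * w i))"
        using good[OF bC(1) b(2)] good[OF bC(2) b(3)] Q by (intro mult_left_mono add_mono) auto
      finally show ?thesis
        by (simp add: power2_eq_square mult_ac)
    qed
    then show "\<exists>i\<in>J. 0 < w i \<and> (\<forall>g\<in>K. d i g \<le> 4 * Q\<^sup>2 * \<delta> * w i)"
      using i by blast
  qed
qed

text \<open>Open sets inside the compact pieces already cover the group, so a compact set lies in
  finitely many of them and eventually in \<open>K n\<close>. The Lindelof property makes countably
  many pieces suffice.\<close>

lemma compact_exhaustion: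
  obtains K :: "nat \<Rightarrow> 'a set" where "\<And>n. compactin T (K n)"
    "\<And>S. compactin T S \<Longrightarrow> \<forall>\<^sub>F n in sequentially. S \<subseteq> K n"
proof -
  have "\<forall>x\<in>carrier G. \<exists>U C. openin T U \<and> compactin T C \<and> x \<in> U \<and> U \<subseteq> C"
    using locally_compact_T unfolding locally_compact_space_def by simp
  then obtain U C where UC: "\<And>x. x \<in> carrier G \<Longrightarrow> openin T (U x) \<and> compactin T (C x) \<and> x \<in> U x \<and> U x \<subseteq> C x"
    by metis
  have "Lindelof_space T"
    by (rule second_countable_imp_Lindelof_space[OF second_countable_T])
  moreover have "\<forall>V\<in>U ` carrier G. openin T V"
    using UC by auto
  moreover have "\<Union> (U ` carrier G) = topspace T"
    using UC openin_carrier[of "U _"] by fastforce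
  ultimately obtain \<V> where \<V>: "countable \<V>" "\<V> \<subseteq> U ` carrier G" "\<Union>\<V> = carrier G"
    unfolding Lindelof_space_def by (metis topspace_T)
  then obtain X where X: "countable X" "X \<subseteq> carrier G" "\<V> = U ` X"
    by (metis countable_subset_image)
  then have "X \<noteq> {}"
    using \<V> one_closed by auto
  with X obtain x where x: "X = range (x :: nat \<Rightarrow> 'a)"
    by (metis uncountable_def)
  define K where "K n = (\<Union>i\<le>n. C (x i))" for n
  have xG: "x i \<in> carrier G" for i
    using X x by blast
  show thesis
  proof (rule that[of K])
    show "compactin T (K n)" for n
      unfolding K_def using UC xG by (intro compactin_Union) auto
  next
    fix S assume S: "compactin T S"
    have "\<forall>V\<in>range (\<lambda>i. U (x i)). openin T V"
      using UC xG by auto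
    moreover have "\<Union> (range (\<lambda>i. U (x i))) = carrier G"
      using \<V>(3) X(3) x by (simp add: image_image)
    then have "S \<subseteq> \<Union> (range (\<lambda>i. U (x i)))"
      using compactin_carrier[OF S] by (simp add: subsetI)
    ultimately obtain \<F> where \<F>: "finite \<F>" "\<F> \<subseteq> range (\<lambda>i. U (x i))" "S \<subseteq> \<Union>\<F>"
      using S unfolding compactin_def by metis
    obtain I where I: "finite I" "\<F> = (\<lambda>i. U (x i)) ` I"
      using finite_subset_image[OF \<F>(1,2)] by blast
    obtain N where N: "\<And>i. i \<in> I \<Longrightarrow> i \<le> N"
      using I(1) unfolding finite_nat_set_iff_bounded_le by auto
    show "\<forall>\<^sub>F n in sequentially. S \<subseteq> K n"
    proof (rule eventually_sequentiallyI[of N])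
      fix n assume "N \<le> n"
      show "S \<subseteq> K n"
      proof
        fix y assume "y \<in> S"
        then obtain i where "i \<in> I" "y \<in> U (x i)"
          using \<F> I by auto
        moreover have "U (x i) \<subseteq> C (x i)" "i \<le> n"
          using UC xG N[OF \<open>i \<in> I\<close>] \<open>N \<le> n\<close> by auto
        ultimately show "y \<in> K n"
          by (auto simp: K_def)
      qed
    qed
  qed
qed

end

section \<open>Monomial representations on p-summable functions\<close>

lemma psum_split:
  assumes "psummable p X v" "finite F" "F \<subseteq> X"
  shows "psum p X v = (\<Sum>x\<in>F. cmod (v x) powr p) + psum p (X - F) v"
    and "psummable p (X - F) v"
proof -
  show s: "psummable p (X - F) v"
    using assms unfolding psummable_def by (auto intro: summable_on_subset_banach)
  have "X = F \<union> (X - F)"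
    using assms by auto
  then have "psum p X v = psum p (F \<union> (X - F)) v"
    by simp
  also have "\<dots> = psum p F v + psum p (X - F) v"
    unfolding psum_def using assms s
    by (intro infsum_Un_disjoint) (auto simp: psummable_def)
  finally show "psum p X v = (\<Sum>x\<in>F. cmod (v x) powr p) + psum p (X - F) v"
    using assms by simp
qed

lemma psum_monomial:
  assumes "bij_betw \<tau> X X" "\<And>x. x \<in> X \<Longrightarrow> cmod (c x) = 1"
  shows "psum p X (\<lambda>x. c x * v (\<tau> x)) = psum p X v"
    and "psummable p X (\<lambda>x. c x * v (\<tau> x)) \<longleftrightarrow> psummable p X v"
proof -
  have "cmod (c x * v (\<tau> x)) = cmod (v (\<tau> x))" if "x \<in> X" for x
    using assms that by (simp add: norm_mult)
  then show "psum p X (\<lambda>x. c x * v (\<tau> x)) = psum p X v"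
    and "psummable p X (\<lambda>x. c x * v (\<tau> x)) \<longleftrightarrow> psummable p X v"
    using psum_cong[of X "\<lambda>x. c x * v (\<tau> x)" "\<lambda>x. v (\<tau> x)"]
      psummable_cong[of X "\<lambda>x. c x * v (\<tau> x)" "\<lambda>x. v (\<tau> x)"]
      psum_reindex[OF assms(1)] by auto
qed

text \<open>Invariant vectors have constant modulus along the cosets; this is how their summability
  forces finite index.\<close>

lemma psummable_const_finite:
  assumes "psummable p X (\<lambda>_. z)" "z \<noteq> 0"
  shows "finite X"
proof (rule ccontr)
  assume inf: "infinite X"
  let ?a = "cmod z powr p"
  have a: "0 < ?a"
    using assms by simp
  obtain n :: nat where n: "psum p X (\<lambda>_. z) < n * ?a"
    using reals_Archimedean3[OF a] by blast
  obtain F where F: "F \<subseteq> X" "finite F" "card F = n"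
    using infinite_arbitrarily_large[OF inf] by blast
  have "n * ?a \<le> psum p X (\<lambda>_. z)"
    using psum_split(1)[OF assms(1) F(2,1)] psum_nonneg[of p "X - F" "\<lambda>_. z"] F by simp
  with n show False
    by simp
qed

context lcsc
begin

text \<open>Strong continuity from local triviality at each point. A finite set \<open>F\<close>
  carries most of \<open>v\<close>; near \<open>\<one>\<close> its points are fixed and their
  multipliers are close to 1, and since the action preserves the total norm, the translate has as
  little mass off \<open>F\<close> as \<open>v\<close> itself.\<close>

lemma monomial_continuous:
  assumes p: "0 < p" and v: "psummable p X v"
    and bij: "\<And>g. g \<in> carrier G \<Longrightarrow> bij_betw (\<tau> g) X X"
    and c1: "\<And>g x. g \<in> carrier G \<Longrightarrow> x \<in> X \<Longrightarrow> cmod (c g x) = 1"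
    and loc: "\<And>x e. x \<in> X \<Longrightarrow> 0 < e \<Longrightarrow>
      \<exists>U. openin T U \<and> \<one> \<in> U \<and> (\<forall>g\<in>U. \<tau> g x = x \<and> cmod (c g x - 1) < e)"
    and e: "0 < e"
  shows "\<exists>U. openin T U \<and> \<one> \<in> U \<and> (\<forall>g\<in>U. psum p X (\<lambda>x. c g x * v (\<tau> g x) - v x) < e)"
proof -
  define S where "S = psum p X v"
  have S: "0 \<le> S"
    by (simp add: S_def psum_nonneg)
  \<comment> \<open>The tail contributes at most \<open>2 powr p * (e1 + e1)\<close>, which is
    \<open>e / 2\<close>, and \<open>e2\<close> keeps the part over \<open>F\<close> at most
    \<open>e / 4\<close>; the summand 1 in \<open>e2\<close> avoids a division by 0.\<close>
  define e1 where "e1 = e / (4 * 2 powr p)"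
  have e1: "0 < e1"
    using e by (simp add: e1_def)
  define e2 where "e2 = (e / (4 * (S + 1))) powr (1 / p)"
  have e2: "0 < e2" "e2 powr p = e / (4 * (S + 1))"
    using e S p by (simp_all add: e2_def powr_powr)
  obtain F where F: "finite F" "F \<subseteq> X" "dist (\<Sum>x\<in>F. cmod (v x) powr p) S \<le> e1"
    using infsum_finite_approximation[of "\<lambda>x. cmod (v x) powr p" X e1] v e1
    unfolding psummable_def psum_def S_def by blast
  have tail: "S - (\<Sum>x\<in>F. cmod (v x) powr p) \<le> e1"
    using F(3) by (simp add: dist_real_def)
  have "\<exists>U. openin T U \<and> \<one> \<in> U \<and> (\<forall>g\<in>U. \<forall>x\<in>F. \<tau> g x = x \<and> cmod (c g x - 1) < e2)"
    using F e2 by (intro common_neighbourhood loc) auto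
  then obtain U where U: "openin T U" "\<one> \<in> U" "\<And>g x. g \<in> U \<Longrightarrow> x \<in> F \<Longrightarrow> \<tau> g x = x \<and> cmod (c g x - 1) < e2"
    by auto
  have "psum p X (\<lambda>x. c g x * v (\<tau> g x) - v x) < e" if g: "g \<in> U" for g
  proof -
    have gG: "g \<in> carrier G"
      using openin_carrier U(1) g by blast
    define w where "w = (\<lambda>x. c g x * v (\<tau> g x))"
    have w: "psum p X w = S" "psummable p X w"
      unfolding w_def S_def using psum_monomial[OF bij[OF gG], of "c g" p v] c1[OF gG] v by auto
    have d: "psummable p X (\<lambda>x. w x - v x)"
      using psum_diff[OF p w(2) v] by simp
    have wF: "(\<Sum>x\<in>F. cmod (w x) powr p) = (\<Sum>x\<in>F. cmod (v x) powr p)"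
      using U(3)[OF g] c1[OF gG] F by (intro sum.cong) (auto simp: w_def norm_mult)
    have "psum p (X - F) (\<lambda>x. w x - v x) \<le> 2 powr p * (psum p (X - F) w + psum p (X - F) v)"
      using psum_split(2)[OF w(2) F(1,2)] psum_split(2)[OF v F(1,2)] p by (intro psum_diff) auto
    also have "psum p (X - F) w = psum p (X - F) v"
      using psum_split(1)[OF w(2) F(1,2)] psum_split(1)[OF v F(1,2)] w wF by (simp add: S_def)
    also have "psum p (X - F) v \<le> e1"
      using psum_split(1)[OF v F(1,2)] tail by (simp add: S_def)
    finally have 1: "psum p (X - F) (\<lambda>x. w x - v x) \<le> e / 2"
      by (simp add: e1_def)
    have "(\<Sum>x\<in>F. cmod (w x - v x) powr p) \<le> (\<Sum>x\<in>F. e2 powr p * cmod (v x) powr p)"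
    proof (intro sum_mono)
      fix x assume x: "x \<in> F"
      have "w x - v x = (c g x - 1) * v x"
        using U(3)[OF g x] by (simp add: w_def algebra_simps)
      then have "cmod (w x - v x) powr p = cmod (c g x - 1) powr p * cmod (v x) powr p"
        by (simp add: norm_mult powr_mult)
      also have "\<dots> \<le> e2 powr p * cmod (v x) powr p"
        using U(3)[OF g x] p by (intro mult_right_mono powr_mono2) auto
      finally show "cmod (w x - v x) powr p \<le> e2 powr p * cmod (v x) powr p" .
    qed
    also have "\<dots> = e2 powr p * (\<Sum>x\<in>F. cmod (v x) powr p)"
      by (simp add: sum_distrib_left)
    also have "\<dots> \<le> e2 powr p * S"
      using psum_split(1)[OF v F(1,2)] psum_nonneg[of p "X - F" v] by (intro mult_left_mono) (auto simp: S_def)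
    also have "\<dots> \<le> e / 4"
      using e S unfolding e2 by (simp add: field_simps)
    finally have 2: "(\<Sum>x\<in>F. cmod (w x - v x) powr p) \<le> e / 4" .
    show ?thesis
      using 1 2 psum_split(1)[OF d F(1,2)] e by (simp add: w_def)
  qed
  with U show ?thesis
    by blast
qed

text \<open>The same choice as the \<open>SOME\<close> in \<open>ind_norm2\<close> and
  \<open>ind_inner\<close>, so that those sums unfold to sums over \<open>rep C\<close>.\<close>

definition rep :: "'a set \<Rightarrow> 'a" where
  "rep C = (SOME x. x \<in> C)"

abbreviation cosets :: "'a set \<Rightarrow> 'a set set" where
  "cosets H \<equiv> lcoset_space G H"

section \<open>Left cosets and the multipliers of an induced representation\<close>

lemma l_coset_eqI:
  assumes "subgroup H G" "x \<in> carrier G" "h \<in> H"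
  shows "(x \<otimes> h) <# H = x <# H"
proof -
  interpret H: subgroup H G by fact
  show ?thesis
  proof (rule equalityI; rule subsetI)
    fix y assume "y \<in> (x \<otimes> h) <# H"
    then obtain k where "k \<in> H" "y = x \<otimes> (h \<otimes> k)"
      using assms by (auto simp: l_coset_def m_assoc)
    then show "y \<in> x <# H"
      using assms by (auto simp: l_coset_def)
  next
    fix y assume "y \<in> x <# H"
    then obtain k where k: "k \<in> H" "y = x \<otimes> k"
      by (auto simp: l_coset_def)
    then have "y = (x \<otimes> h) \<otimes> (inv h \<otimes> k)"
      using assms by (simp add: m_assoc[symmetric]) (simp add: m_assoc)
    then show "y \<in> (x \<otimes> h) <# H"
      using assms k by (auto simp: l_coset_def)
  qed
qed

lemma coset_in: "x \<in> carrier G \<Longrightarrow> x <# H \<in> cosets H"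
  by (auto simp: lcoset_space_def)

lemma rep_coset:
  assumes "subgroup H G" "x \<in> carrier G"
  obtains h where "h \<in> H" "rep (x <# H) = x \<otimes> h"
proof -
  have "x \<otimes> \<one> \<in> x <# H"
    using subgroup.one_closed[OF assms(1)] unfolding l_coset_def by blast
  then have "rep (x <# H) \<in> x <# H"
    unfolding rep_def by (rule someI)
  then show thesis
    using that by (auto simp: l_coset_def)
qed

lemma cosets_rep:
  assumes "subgroup H G" "C \<in> cosets H"
  shows "rep C \<in> carrier G" "rep C <# H = C"
proof -
  obtain x where x: "x \<in> carrier G" "C = x <# H"
    using assms unfolding lcoset_space_def by blast
  then obtain h where "h \<in> H" "rep C = x \<otimes> h"
    using rep_coset[OF assms(1)] by blast
  then show "rep C \<in> carrier G" "rep C <# H = C"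
    using x l_coset_eqI[OF assms(1)] subgroup.mem_carrier[OF assms(1)] by auto
qed

text \<open>Translation by the inverse, since \<open>ind_act\<close> pulls functions back;
  consequently products act in reversed order.\<close>

definition coset_act :: "'a set \<Rightarrow> 'a \<Rightarrow> 'a set \<Rightarrow> 'a set" where
  "coset_act H g C = (inv g \<otimes> rep C) <# H"

lemma coset_act_coset:
  assumes "subgroup H G" "g \<in> carrier G" "x \<in> carrier G"
  shows "coset_act H g (x <# H) = (inv g \<otimes> x) <# H"
proof -
  obtain h where h: "h \<in> H" "rep (x <# H) = x \<otimes> h"
    using rep_coset[OF assms(1,3)] by blast
  have "inv g \<otimes> (x \<otimes> h) = (inv g \<otimes> x) \<otimes> h"
    using assms h subgroup.mem_carrier[OF assms(1)] by (simp add: m_assoc)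
  then show ?thesis
    unfolding coset_act_def using h l_coset_eqI[OF assms(1), of "inv g \<otimes> x" h] assms by simp
qed

lemma bij_coset_act:
  assumes "subgroup H G" "g \<in> carrier G"
  shows "bij_betw (coset_act H g) (cosets H) (cosets H)"
proof (rule bij_betw_byWitness[where f' = "coset_act H (inv g)"])
  have *: "coset_act H (inv k) (coset_act H k C) = C" "coset_act H k C \<in> cosets H"
    if "k \<in> carrier G" "C \<in> cosets H" for k C
  proof -
    obtain x where "x \<in> carrier G" "C = x <# H"
      using \<open>C \<in> cosets H\<close> unfolding lcoset_space_def by blast
    then show "coset_act H (inv k) (coset_act H k C) = C" "coset_act H k C \<in> cosets H"
      using that assms by (auto simp: coset_act_coset coset_in m_assoc[symmetric])
  qed
  show "\<forall>C\<in>cosets H. coset_act H (inv g) (coset_act H g C) = C"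
    "\<forall>C\<in>cosets H. coset_act H g (coset_act H (inv g) C) = C"
    "coset_act H g ` cosets H \<subseteq> cosets H" "coset_act H (inv g) ` cosets H \<subseteq> cosets H"
    using *[of g] *[of "inv g"] assms by auto
qed

definition equivariant :: "'a set \<Rightarrow> ('a \<Rightarrow> complex) \<Rightarrow> ('a \<Rightarrow> complex) \<Rightarrow> bool" where
  "equivariant H chi \<phi> \<longleftrightarrow> (\<forall>x\<in>carrier G. \<forall>h\<in>H. \<phi> (x \<otimes> h) = cnj (chi h) * \<phi> x)"

text \<open>The argument of \<open>chi\<close> is the part in \<open>H\<close> of
  \<open>inv g \<otimes> rep C\<close> relative to the chosen representatives. With this multiplier
  the induced representation becomes a monomial action on functions on the discrete set of
  cosets.\<close>

definition cocycle :: "'a set \<Rightarrow> ('a \<Rightarrow> complex) \<Rightarrow> 'a \<Rightarrow> 'a set \<Rightarrow> complex" where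
  "cocycle H chi g C = cnj (chi (inv (rep (coset_act H g C)) \<otimes> (inv g \<otimes> rep C)))"

lemma R_mon_D:
  assumes "(H, chi) \<in> R_mon G T"
  shows "subgroup H G" "openin T H" "\<And>h. h \<in> H \<Longrightarrow> cmod (chi h) = 1"
    "\<And>h k. h \<in> H \<Longrightarrow> k \<in> H \<Longrightarrow> chi (h \<otimes> k) = chi h * chi k"
    "continuous_map (subtopology T H) euclidean chi"
    "chi \<one> = 1"
proof -
  show s: "subgroup H G" and 1: "\<And>h. h \<in> H \<Longrightarrow> cmod (chi h) = 1" "openin T H"
    "continuous_map (subtopology T H) euclidean chi"
    and m: "\<And>h k. h \<in> H \<Longrightarrow> k \<in> H \<Longrightarrow> chi (h \<otimes> k) = chi h * chi k"
    using assms by (auto simp: R_mon_def unitary_char_def)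
  have "\<one> \<in> H"
    using subgroup.one_closed[OF s] .
  then show "chi \<one> = 1"
    using m[of \<one> \<one>] 1(1)[of \<one>] by auto
qed

lemma coset_act_decomp:
  assumes "subgroup H G" "g \<in> carrier G" "C \<in> cosets H"
  defines "h \<equiv> inv (rep (coset_act H g C)) \<otimes> (inv g \<otimes> rep C)"
  shows "h \<in> H" "inv g \<otimes> rep C = rep (coset_act H g C) \<otimes> h"
proof -
  have rG: "rep C \<in> carrier G" "coset_act H g C \<in> cosets H"
    using cosets_rep[OF assms(1,3)] assms(2) by (auto simp: coset_act_def coset_in)
  have r'G: "rep (coset_act H g C) \<in> carrier G"
    using cosets_rep[OF assms(1) rG(2)] by simp
  obtain k where k: "k \<in> H" "rep (coset_act H g C) = (inv g \<otimes> rep C) \<otimes> k"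
    using rep_coset[OF assms(1), of "inv g \<otimes> rep C"] rG assms(2) unfolding coset_act_def by auto
  have kG: "k \<in> carrier G"
    using k subgroup.mem_carrier[OF assms(1)] by blast
  have "h = inv k"
    unfolding h_def k(2) using kG rG assms(2) by (subst inv_mult_group) (auto simp: m_assoc)
  then show "h \<in> H"
    using k subgroup.m_inv_closed[OF assms(1)] by simp
  show "inv g \<otimes> rep C = rep (coset_act H g C) \<otimes> h"
    unfolding h_def using r'G rG assms(2) by (simp add: m_assoc[symmetric])
qed

lemma equivariant_translate:
  assumes "(H, chi) \<in> R_mon G T" "equivariant H chi \<phi>" "g \<in> carrier G" "C \<in> cosets H"
  shows "\<phi> (inv g \<otimes> rep C) = cocycle H chi g C * \<phi> (rep (coset_act H g C))"
    and "cmod (cocycle H chi g C) = 1"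
proof -
  note R = R_mon_D[OF assms(1)]
  note D = coset_act_decomp[OF R(1) assms(3,4)]
  have "rep (coset_act H g C) \<in> carrier G"
    using cosets_rep(1)[OF R(1)] assms(4) bij_betw_apply[OF bij_coset_act[OF R(1) assms(3)]] by blast
  then show "\<phi> (inv g \<otimes> rep C) = cocycle H chi g C * \<phi> (rep (coset_act H g C))"
    using assms(2) D unfolding equivariant_def cocycle_def by metis
  show "cmod (cocycle H chi g C) = 1"
    using R D by (simp add: cocycle_def)
qed

text \<open>For \<open>x = rep C\<close>, both conditions on \<open>g\<close> follow once
  \<open>inv x \<otimes> (inv g \<otimes> x)\<close> lies in a small neighbourhood of
  \<open>\<one>\<close> inside the open subgroup \<open>H\<close>: the coset is then fixed, and the
  multiplier is the conjugate of \<open>chi\<close> at that element.\<close>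

lemma cocycle_locally_trivial:
  assumes R: "(H, chi) \<in> R_mon G T" and C: "C \<in> cosets H" and e: "0 < e"
  shows "\<exists>U. openin T U \<and> \<one> \<in> U \<and> (\<forall>g\<in>U. coset_act H g C = C \<and> cmod (cocycle H chi g C - 1) < e)"
proof -
  note R' = R_mon_D[OF R]
  define x where "x = rep C"
  have x: "x \<in> carrier G" "x <# H = C"
    using cosets_rep[OF R'(1) C] by (auto simp: x_def)
  define V where "V = {h \<in> H. chi h \<in> ball 1 e}"
  have HG: "H \<subseteq> carrier G"
    using subgroup.subset[OF R'(1)] .
  then have "openin (subtopology T H) V"
    unfolding V_def using openin_continuous_map_preimage[OF R'(5), of "ball 1 e"]
    by (simp add: topspace_subtopology Int_absorb1)
  then have V: "openin T V"
    using R'(2) openin_trans_full by blast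
  define U where "U = {g \<in> carrier G. inv x \<otimes> (inv g \<otimes> x) \<in> V}"
  have "openin T U"
    unfolding U_def using x V
    by (intro openin_preimage continuous_map_mult continuous_map_inv continuous_map_id[unfolded id_def]) auto
  moreover have "\<one> \<in> U"
    using x R' e subgroup.one_closed[OF R'(1)] by (simp add: U_def V_def)
  moreover have "coset_act H g C = C \<and> cmod (cocycle H chi g C - 1) < e" if "g \<in> U" for g
  proof -
    define h where "h = inv x \<otimes> (inv g \<otimes> x)"
    have h: "g \<in> carrier G" "h \<in> H" "dist 1 (chi h) < e"
      using that by (auto simp: U_def V_def h_def)
    have "inv g \<otimes> x = x \<otimes> h"
      using x h(1) by (simp add: h_def m_assoc[symmetric])
    then have fixed: "coset_act H g C = C"
      using l_coset_eqI[OF R'(1) x(1) h(2)] x by (simp add: coset_act_def x_def)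
    then have "cocycle H chi g C = cnj (chi h)"
      by (simp add: cocycle_def h_def x_def)
    then have "cmod (cocycle H chi g C - 1) = cmod (chi h - 1)"
      by (metis complex_cnj_diff complex_cnj_one complex_mod_cnj)
    then show ?thesis
      using fixed h by (simp add: dist_norm norm_minus_commute)
  qed
  ultimately show ?thesis
    by blast
qed

section \<open>Displacement of a vector in an induced representation\<close>

definition ind_psum :: "real \<Rightarrow> 'a set \<Rightarrow> ('a \<Rightarrow> complex) \<Rightarrow> real" where
  "ind_psum p H \<phi> = psum p (cosets H) (\<lambda>C. \<phi> (rep C))"

definition ind_psummable :: "real \<Rightarrow> 'a set \<Rightarrow> ('a \<Rightarrow> complex) \<Rightarrow> bool" where
  "ind_psummable p H \<phi> \<longleftrightarrow> psummable p (cosets H) (\<lambda>C. \<phi> (rep C))"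

text \<open>As a function of \<open>g\<close> this is a length function up to the factor
  \<open>2 powr p\<close>; the lemmas that follow verify the conditions that
  \<open>select_component\<close> puts on \<open>d i\<close>.\<close>

definition displacement :: "real \<Rightarrow> 'a set \<Rightarrow> ('a \<Rightarrow> complex) \<Rightarrow> 'a \<Rightarrow> real" where
  "displacement p H \<phi> g = ind_psum p H (\<lambda>x. \<phi> (inv g \<otimes> x) - \<phi> x)"

lemma ind_psum_translate:
  assumes "(H, chi) \<in> R_mon G T" "equivariant H chi \<phi>" "g \<in> carrier G"
  shows "ind_psum p H (\<lambda>x. \<phi> (inv g \<otimes> x)) = ind_psum p H \<phi>"
    and "ind_psummable p H (\<lambda>x. \<phi> (inv g \<otimes> x)) \<longleftrightarrow> ind_psummable p H \<phi>"
proof -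
  note tr = equivariant_translate[OF assms]
  let ?v = "\<lambda>C. cocycle H chi g C * \<phi> (rep (coset_act H g C))"
  have "psum p (cosets H) (\<lambda>C. \<phi> (inv g \<otimes> rep C)) = psum p (cosets H) ?v"
    and "psummable p (cosets H) (\<lambda>C. \<phi> (inv g \<otimes> rep C)) = psummable p (cosets H) ?v"
    using tr(1) by (auto intro!: psum_cong psummable_cong)
  then show "ind_psum p H (\<lambda>x. \<phi> (inv g \<otimes> x)) = ind_psum p H \<phi>"
    and "ind_psummable p H (\<lambda>x. \<phi> (inv g \<otimes> x)) \<longleftrightarrow> ind_psummable p H \<phi>"
    using psum_monomial[OF bij_coset_act[OF R_mon_D(1)[OF assms(1)] assms(3)],
        of "cocycle H chi g" p "\<lambda>C. \<phi> (rep C)", OF tr(2)]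
    by (auto simp: ind_psum_def ind_psummable_def)
qed

lemma equivariant_displacement:
  assumes "equivariant H chi \<phi>" "g \<in> carrier G" "subgroup H G"
  shows "equivariant H chi (\<lambda>x. \<phi> (inv g \<otimes> x) - \<phi> x)"
  unfolding equivariant_def
proof (intro ballI)
  fix x h assume x: "x \<in> carrier G" and h: "h \<in> H"
  then have "inv g \<otimes> (x \<otimes> h) = (inv g \<otimes> x) \<otimes> h"
    using assms subgroup.mem_carrier[OF assms(3)] by (simp add: m_assoc)
  then show "\<phi> (inv g \<otimes> (x \<otimes> h)) - \<phi> (x \<otimes> h) = cnj (chi h) * (\<phi> (inv g \<otimes> x) - \<phi> x)"
    using assms(1,2) x h by (simp add: equivariant_def algebra_simps)
qed

lemma displacement_summable:
  assumes "0 < p" "(H, chi) \<in> R_mon G T" "equivariant H chi \<phi>" "ind_psummable p H \<phi>" "g \<in> carrier G"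
  shows "ind_psummable p H (\<lambda>x. \<phi> (inv g \<otimes> x) - \<phi> x)"
    and "displacement p H \<phi> g \<le> 2 * 2 powr p * ind_psum p H \<phi>"
  using psum_diff[of p "cosets H" "\<lambda>C. \<phi> (inv g \<otimes> rep C)" "\<lambda>C. \<phi> (rep C)"] assms
    ind_psum_translate[OF assms(2,3,5), of p]
  by (auto simp: ind_psummable_def ind_psum_def displacement_def algebra_simps)

text \<open>Write pi for the translation action. Then pi(gh) phi - phi is the sum of pi(g) (pi(h)
  phi - phi) and pi(g) phi - phi, and pi(g) preserves the norm.\<close>

lemma displacement_mult:
  assumes p: "0 < p" and R: "(H, chi) \<in> R_mon G T" and eq: "equivariant H chi \<phi>"
    and s: "ind_psummable p H \<phi>" and g: "g \<in> carrier G" and h: "h \<in> carrier G"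
  shows "displacement p H \<phi> (g \<otimes> h) \<le> 2 powr p * (displacement p H \<phi> g + displacement p H \<phi> h)"
proof -
  define \<psi> where "\<psi> = (\<lambda>x. \<phi> (inv h \<otimes> x) - \<phi> x)"
  have H: "subgroup H G"
    using R_mon_D[OF R] by simp
  have \<psi>: "equivariant H chi \<psi>" "ind_psummable p H \<psi>" "ind_psum p H \<psi> = displacement p H \<phi> h"
    using equivariant_displacement[OF eq h H] displacement_summable(1)[OF p R eq s h]
    by (auto simp: \<psi>_def displacement_def)
  have "displacement p H \<phi> (g \<otimes> h)
      = psum p (cosets H) (\<lambda>C. \<psi> (inv g \<otimes> rep C) + (\<phi> (inv g \<otimes> rep C) - \<phi> (rep C)))"
    unfolding displacement_def ind_psum_def
    using cosets_rep(1)[OF H] g h by (intro psum_cong) (simp add: \<psi>_def inv_mult_group m_assoc)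
  also have "\<dots> \<le> 2 powr p * (psum p (cosets H) (\<lambda>C. \<psi> (inv g \<otimes> rep C))
      + psum p (cosets H) (\<lambda>C. \<phi> (inv g \<otimes> rep C) - \<phi> (rep C)))"
    using p ind_psum_translate(2)[OF R \<psi>(1) g, of p] \<psi>(2) displacement_summable(1)[OF p R eq s g]
    by (intro psum_add) (auto simp: ind_psummable_def)
  also have "psum p (cosets H) (\<lambda>C. \<psi> (inv g \<otimes> rep C)) = displacement p H \<phi> h"
    using ind_psum_translate(1)[OF R \<psi>(1) g, of p] \<psi>(3) by (simp add: ind_psum_def)
  also have "psum p (cosets H) (\<lambda>C. \<phi> (inv g \<otimes> rep C) - \<phi> (rep C)) = displacement p H \<phi> g"
    by (simp add: displacement_def ind_psum_def)
  finally show ?thesis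
    by (simp add: add.commute)
qed

text \<open>The isometric translation by \<open>inv g\<close> turns the difference for
  \<open>g\<close> into minus the difference for \<open>inv g\<close>.\<close>

lemma displacement_inv:
  assumes R: "(H, chi) \<in> R_mon G T" and eq: "equivariant H chi \<phi>" and g: "g \<in> carrier G"
  shows "displacement p H \<phi> (inv g) = displacement p H \<phi> g"
proof -
  have H: "subgroup H G"
    using R_mon_D[OF R] by simp
  have "displacement p H \<phi> g
      = ind_psum p H (\<lambda>x. \<phi> (inv g \<otimes> (inv (inv g) \<otimes> x)) - \<phi> (inv (inv g) \<otimes> x))"
    using ind_psum_translate(1)[OF R equivariant_displacement[OF eq g H], of "inv g" p] g
    by (simp add: displacement_def)
  also have "\<dots> = displacement p H \<phi> (inv g)"
    unfolding displacement_def ind_psum_def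
    using cosets_rep(1)[OF H] g
    by (intro psum_cong) (simp add: m_assoc[symmetric] norm_minus_commute)
  finally show ?thesis
    by simp
qed

lemma displacement_continuous:
  assumes p: "0 < p" and R: "(H, chi) \<in> R_mon G T" and eq: "equivariant H chi \<phi>"
    and s: "ind_psummable p H \<phi>" and e: "0 < e"
  shows "\<exists>U. openin T U \<and> \<one> \<in> U \<and> (\<forall>g\<in>U. displacement p H \<phi> g < e)"
proof -
  note H = R_mon_D(1)[OF R]
  have "\<exists>U. openin T U \<and> \<one> \<in> U \<and> (\<forall>g\<in>U. psum p (cosets H)
      (\<lambda>C. cocycle H chi g C * \<phi> (rep (coset_act H g C)) - \<phi> (rep C)) < e)"
    using s equivariant_translate(2)[OF R eq]
    by (intro monomial_continuous[of p "cosets H" "\<lambda>C. \<phi> (rep C)"] p e bij_coset_act[OF H]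
        cocycle_locally_trivial[OF R]) (auto simp: ind_psummable_def)
  then obtain U where U: "openin T U" "\<one> \<in> U" "\<And>g. g \<in> U \<Longrightarrow> psum p (cosets H)
      (\<lambda>C. cocycle H chi g C * \<phi> (rep (coset_act H g C)) - \<phi> (rep C)) < e"
    by blast
  have "displacement p H \<phi> g < e" if "g \<in> U" for g
  proof -
    have "displacement p H \<phi> g = psum p (cosets H)
        (\<lambda>C. cocycle H chi g C * \<phi> (rep (coset_act H g C)) - \<phi> (rep C))"
      unfolding displacement_def ind_psum_def
      using equivariant_translate(1)[OF R eq openin_carrier[OF U(1) that]] by (intro psum_cong) simp
    then show ?thesis
      using U(3)[OF that] by simp
  qed
  with U show ?thesis
    by blast
qed

text \<open>Invariant vectors of an induced representation are constant functions, so they exist only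
  if the character is trivial and the subgroup has finite index; the last clause therefore says
  that the vector lies in the complement of the invariant ones.\<close>
definition ind_complement :: "real \<Rightarrow> 'a set \<Rightarrow> ('a \<Rightarrow> complex) \<Rightarrow> ('a \<Rightarrow> complex) set" where
  "ind_complement p H chi = {\<phi>. equivariant H chi \<phi> \<and> (\<forall>x. x \<notin> carrier G \<longrightarrow> \<phi> x = 0) \<and>
     ind_psummable p H \<phi> \<and>
     (finite (cosets H) \<and> (\<forall>h\<in>H. chi h = 1) \<longrightarrow> (\<Sum>C\<in>cosets H. \<phi> (rep C)) = 0)}"

text \<open>The pivot of the proof: one summand, not normalised, for each compact set and each
  tolerance. Statements about sequences and direct sums are reduced to this form, and in this form
  the exponent is changed.\<close>

definition almost_invariant :: "real \<Rightarrow> bool" where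
  "almost_invariant p \<longleftrightarrow> (\<forall>K e. compactin T K \<longrightarrow> 0 < e \<longrightarrow>
     (\<exists>H chi \<phi>. (H, chi) \<in> R_mon G T \<and> \<phi> \<in> ind_complement p H chi \<and> 0 < ind_psum p H \<phi> \<and>
        (\<forall>g\<in>K. displacement p H \<phi> g \<le> e * ind_psum p H \<phi>)))"

text \<open>The family may repeat the same induced representation. Finite families suffice, since
  infinite sums are truncated to indices that carry half of the norm.\<close>

lemma almost_invariant_direct_sum:
  assumes p: "0 < p"
    and sum: "\<And>K e. compactin T K \<Longrightarrow> 0 < e \<Longrightarrow>
      \<exists>(J :: 'i set) H chi \<phi>. finite J \<and>
        (\<forall>i\<in>J. (H i, chi i) \<in> R_mon G T \<and> \<phi> i \<in> ind_complement p (H i) (chi i)) \<and>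
        0 < (\<Sum>i\<in>J. ind_psum p (H i) (\<phi> i)) \<and>
        (\<forall>g\<in>K. (\<Sum>i\<in>J. displacement p (H i) (\<phi> i) g) \<le> e * (\<Sum>i\<in>J. ind_psum p (H i) (\<phi> i)))"
  shows "almost_invariant p"
  unfolding almost_invariant_def
proof (intro allI impI)
  fix K and e :: real
  assume K: "compactin T K" and e: "0 < e"
  define Q :: real where "Q = 2 powr p"
  have Q: "0 < Q"
    by (simp add: Q_def)
  \<comment> \<open>Cancels the factor \<open>4 * Q\<^sup>2\<close> lost in
    \<open>select_component\<close>.\<close>
  define \<delta> where "\<delta> = e / (4 * Q\<^sup>2)"
  have \<delta>: "0 < \<delta>"
    using e Q by (simp add: \<delta>_def)
  show "\<exists>H chi \<phi>. (H, chi) \<in> R_mon G T \<and> \<phi> \<in> ind_complement p H chi \<and> 0 < ind_psum p H \<phi> \<and>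
        (\<forall>g\<in>K. displacement p H \<phi> g \<le> e * ind_psum p H \<phi>)"
  proof (rule select_component[OF K Q, where ?'i = 'i])
    fix L c assume L: "compactin T L" "0 < c"
      and sel: "\<And>(J :: 'i set) d w \<delta>. \<lbrakk>finite J;
         \<And>i g. i \<in> J \<Longrightarrow> g \<in> carrier G \<Longrightarrow> (0::real) \<le> d i g;
         \<And>i g h. i \<in> J \<Longrightarrow> g \<in> carrier G \<Longrightarrow> h \<in> carrier G \<Longrightarrow> d i (g \<otimes> h) \<le> Q * (d i g + d i h);
         \<And>i g. i \<in> J \<Longrightarrow> g \<in> carrier G \<Longrightarrow> d i (inv g) = d i g;
         \<And>i e. i \<in> J \<Longrightarrow> 0 < e \<Longrightarrow> \<exists>U. openin T U \<and> \<one> \<in> U \<and> (\<forall>g\<in>U. d i g < e);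
         \<And>i. i \<in> J \<Longrightarrow> 0 \<le> w i; 0 < sum w J; 0 < \<delta>;
         \<And>g. g \<in> L \<Longrightarrow> (\<Sum>i\<in>J. d i g) \<le> c * \<delta> * sum w J\<rbrakk>
        \<Longrightarrow> \<exists>i\<in>J. 0 < w i \<and> (\<forall>g\<in>K. d i g \<le> 4 * Q\<^sup>2 * \<delta> * w i)"
    \<comment> \<open>The hypothesis is invoked for the auxiliary compact set \<open>L\<close> and
      the tolerance \<open>c * \<delta>\<close>, not for \<open>K\<close> and
      \<open>e\<close>.\<close>
    have "0 < c * \<delta>"
      using L \<delta> by simp
    from sum[OF L(1) this] obtain J :: "'i set" and H chi \<phi> where J: "finite J"
      and mem: "\<And>i. i \<in> J \<Longrightarrow> (H i, chi i) \<in> R_mon G T" "\<And>i. i \<in> J \<Longrightarrow> \<phi> i \<in> ind_complement p (H i) (chi i)"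
      and pos: "0 < (\<Sum>i\<in>J. ind_psum p (H i) (\<phi> i))"
      and le: "\<And>g. g \<in> L \<Longrightarrow> (\<Sum>i\<in>J. displacement p (H i) (\<phi> i) g) \<le> c * \<delta> * (\<Sum>i\<in>J. ind_psum p (H i) (\<phi> i))"
      by blast
    have eq: "equivariant (H i) (chi i) (\<phi> i)" "ind_psummable p (H i) (\<phi> i)" if "i \<in> J" for i
      using mem(2)[OF that] by (auto simp: ind_complement_def)
    have "\<exists>i\<in>J. 0 < ind_psum p (H i) (\<phi> i) \<and>
        (\<forall>g\<in>K. displacement p (H i) (\<phi> i) g \<le> 4 * Q\<^sup>2 * \<delta> * ind_psum p (H i) (\<phi> i))"
    proof (rule sel[OF J])
      show "displacement p (H i) (\<phi> i) (g \<otimes> h) \<le> Q * (displacement p (H i) (\<phi> i) g + displacement p (H i) (\<phi> i) h)"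
        if "i \<in> J" "g \<in> carrier G" "h \<in> carrier G" for i g h
        unfolding Q_def using displacement_mult[OF p mem(1)[OF that(1)] eq[OF that(1)] that(2,3)] .
      show "displacement p (H i) (\<phi> i) (inv g) = displacement p (H i) (\<phi> i) g"
        if "i \<in> J" "g \<in> carrier G" for i g
        using displacement_inv[OF mem(1)[OF that(1)] eq(1)[OF that(1)] that(2)] .
      show "\<exists>U. openin T U \<and> \<one> \<in> U \<and> (\<forall>g\<in>U. displacement p (H i) (\<phi> i) g < e)"
        if "i \<in> J" "0 < e" for i e
        using displacement_continuous[OF p mem(1)[OF that(1)] eq[OF that(1)] that(2)] .
    qed (use pos \<delta> le in \<open>auto simp: displacement_def ind_psum_def psum_nonneg\<close>)
    moreover have "4 * Q\<^sup>2 * \<delta> = e"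
      using Q by (simp add: \<delta>_def)
    ultimately obtain i where "i \<in> J" "0 < ind_psum p (H i) (\<phi> i)"
      "\<forall>g\<in>K. displacement p (H i) (\<phi> i) g \<le> e * ind_psum p (H i) (\<phi> i)"
      by auto
    then show "\<exists>H chi \<phi>. (H, chi) \<in> R_mon G T \<and> \<phi> \<in> ind_complement p H chi \<and> 0 < ind_psum p H \<phi> \<and>
          (\<forall>g\<in>K. displacement p H \<phi> g \<le> e * ind_psum p H \<phi>)"
      using mem by blast
  qed
qed

end

section \<open>Changing the exponent\<close>

lemma cmod_powr_2: "cmod z powr 2 = (cmod z)\<^sup>2"
  by (cases "z = 0") simp_all

context lcsc
begin

lemma ind_norm2_eq: "ind_norm2 G H \<phi> = ind_psum 2 H \<phi>"
  by (simp add: ind_norm2_def ind_psum_def psum_def cmod_powr_2 rep_def)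

lemma cosets_nonempty: "cosets H \<noteq> {}"
  using one_closed by (auto simp: lcoset_space_def)

text \<open>Invariance with \<open>g = x\<close> gives the value at \<open>\<one>\<close>, so
  invariant functions are constant; equivariance of a nonzero constant makes \<open>chi\<close>
  trivial, and orthogonality to it is then the vanishing of the sum.\<close>

lemma ind_compl_eq:
  assumes R: "(H, chi) \<in> R_mon G T"
  shows "ind_compl G H chi = ind_complement 2 H chi"
proof -
  note R' = R_mon_D[OF R]
  have space: "\<phi> \<in> ind_space G H chi \<longleftrightarrow>
      equivariant H chi \<phi> \<and> (\<forall>x. x \<notin> carrier G \<longrightarrow> \<phi> x = 0) \<and> ind_psummable 2 H \<phi>" for \<phi>
    by (simp add: ind_space_def equivariant_def ind_psummable_def psummable_def cmod_powr_2 rep_def)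
  have inner: "ind_inner G H \<phi> \<psi> = (\<Sum>\<^sub>\<infinity>C\<in>cosets H. \<phi> (rep C) * cnj (\<psi> (rep C)))" for \<phi> \<psi>
    by (simp add: ind_inner_def rep_def)
  show ?thesis
  proof (intro equalityI subsetI)
    fix \<phi> assume \<phi>: "\<phi> \<in> ind_compl G H chi"
    have "(\<Sum>C\<in>cosets H. \<phi> (rep C)) = 0" if fin: "finite (cosets H)" and triv: "\<forall>h\<in>H. chi h = 1"
    proof -
      define \<psi> where "\<psi> = (\<lambda>x. if x \<in> carrier G then 1 else 0 :: complex)"
      have "\<psi> \<in> ind_invariants G H chi"
        using fin triv subgroup.mem_carrier[OF R'(1)]
        by (auto simp: ind_invariants_def space equivariant_def \<psi>_def ind_psummable_def ind_act_def)
      then have "ind_inner G H \<phi> \<psi> = 0"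
        using \<phi> by (auto simp: ind_compl_def)
      moreover have "ind_inner G H \<phi> \<psi> = (\<Sum>C\<in>cosets H. \<phi> (rep C))"
        using fin cosets_rep(1)[OF R'(1)] by (auto simp: inner \<psi>_def intro!: sum.cong)
      ultimately show ?thesis
        by simp
    qed
    then show "\<phi> \<in> ind_complement 2 H chi"
      using \<phi> by (auto simp: ind_compl_def space ind_complement_def)
  next
    fix \<phi> assume \<phi>: "\<phi> \<in> ind_complement 2 H chi"
    have "ind_inner G H \<phi> \<psi> = 0" if \<psi>: "\<psi> \<in> ind_invariants G H chi" for \<psi>
    proof -
      have eq: "equivariant H chi \<psi>" and s: "ind_psummable 2 H \<psi>"
        and inv: "\<And>g x. g \<in> carrier G \<Longrightarrow> x \<in> carrier G \<Longrightarrow> \<psi> (inv g \<otimes> x) = \<psi> x"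
        using \<psi> by (auto simp: ind_invariants_def space ind_act_def)
      define z where "z = \<psi> \<one>"
      have const: "\<psi> x = z" if "x \<in> carrier G" for x
        using inv[OF that that] that by (simp add: z_def)
      have rep_const: "\<psi> (rep C) = z" if "C \<in> cosets H" for C
        using const cosets_rep(1)[OF R'(1) that] by simp
      have ip: "ind_inner G H \<phi> \<psi> = (\<Sum>\<^sub>\<infinity>C\<in>cosets H. \<phi> (rep C) * cnj z)"
        unfolding inner by (intro infsum_cong) (simp add: rep_const)
      show ?thesis
      proof (cases "z = 0")
        case False
        have "psummable 2 (cosets H) (\<lambda>_. z)"
          using s psummable_cong[of "cosets H" "\<lambda>C. \<psi> (rep C)" "\<lambda>_. z"] rep_const
          by (simp add: ind_psummable_def)
        then have fin: "finite (cosets H)"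
          using psummable_const_finite False by blast
        have "chi h = 1" if h: "h \<in> H" for h
        proof -
          have hG: "h \<in> carrier G"
            using h subgroup.mem_carrier[OF R'(1)] by blast
          have "\<psi> (\<one> \<otimes> h) = cnj (chi h) * \<psi> \<one>"
            using eq[unfolded equivariant_def, rule_format, OF one_closed h] .
          then have "z = cnj (chi h) * z"
            using const hG by simp
          then show ?thesis
            using False by (metis complex_cnj_cnj complex_cnj_one mult_cancel_right2)
        qed
        then have "(\<Sum>C\<in>cosets H. \<phi> (rep C)) = 0"
          using \<phi> fin by (simp add: ind_complement_def)
        then show ?thesis
          using fin by (simp add: ip sum_distrib_right[symmetric])
      qed (simp add: ip)
    qed
    then show "\<phi> \<in> ind_compl G H chi"
      using \<phi> by (auto simp: ind_compl_def space ind_complement_def)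
  qed
qed

text \<open>The Mazur map acts on values and hence commutes with translation, so the displacement of
  the image is a difference of two Mazur images. The constant is uniform over all induced
  representations.\<close>

lemma displacement_mazur:
  assumes "0 < p" "0 < s" "0 < \<eta>"
  obtains C where "0 < C"
    "\<And>H chi \<phi> g. (H, chi) \<in> R_mon G T \<Longrightarrow> equivariant H chi \<phi> \<Longrightarrow> ind_psummable p H \<phi> \<Longrightarrow>
       g \<in> carrier G \<Longrightarrow>
       displacement s H (\<lambda>x. mazur (p / s) (\<phi> x)) g \<le> \<eta> * ind_psum p H \<phi> + C * displacement p H \<phi> g"
proof -
  obtain C where C: "0 < C"
    "\<And>(X :: 'a set set) v w. psummable p X v \<Longrightarrow> psummable p X w \<Longrightarrow>
       psum s X (\<lambda>x. mazur (p / s) (v x) - mazur (p / s) (w x))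
            \<le> \<eta> * psum p X v + C * psum p X (\<lambda>x. v x - w x)"
    using psum_mazur_estimate[OF assms] by metis
  show thesis
  proof (rule that[OF C(1)])
    fix H chi \<phi> g
    assume R: "(H, chi) \<in> R_mon G T" and eq: "equivariant H chi \<phi>" and s: "ind_psummable p H \<phi>"
      and g: "g \<in> carrier G"
    note tr = ind_psum_translate[OF R eq g, of p]
    show "displacement s H (\<lambda>x. mazur (p / s) (\<phi> x)) g \<le> \<eta> * ind_psum p H \<phi> + C * displacement p H \<phi> g"
      using C(2)[of "cosets H" "\<lambda>C. \<phi> (inv g \<otimes> rep C)" "\<lambda>C. \<phi> (rep C)"] tr s
      by (simp add: displacement_def ind_psum_def ind_psummable_def)
  qed
qed

lemma equivariant_mazur:
  assumes "(H, chi) \<in> R_mon G T" "equivariant H chi \<phi>"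
  shows "equivariant H chi (\<lambda>x. mazur r (\<phi> x))"
  using assms(2) R_mon_D(3)[OF assms(1)]
  by (simp add: equivariant_def mazur_mult mazur_unimodular)

text \<open>Only a finite coset space with trivial \<open>chi\<close> needs care: there the Mazur
  image of \<open>\<phi>\<close> is recentred by its mean. If the result were small, the inverse
  Mazur map would put \<open>\<phi>\<close> close to a constant, which \<open>psum_centred\<close>
  excludes.\<close>

lemma almost_invariant_exponent:
  assumes p: "1 < p" and s: "0 < s" and ai: "almost_invariant p"
  shows "almost_invariant s"
  unfolding almost_invariant_def
proof (intro allI impI)
  fix K and e :: real
  assume K: "compactin T K" and e: "0 < e"
  have p0: "0 < p"
    using p by simp
  \<comment> \<open>Multiplied by the factor \<open>2 powr (p + 1)\<close> of
    \<open>psum_centred\<close>, this costs \<open>N / 2\<close>, which is absorbed on the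
    left.\<close>
  define \<eta>' :: real where "\<eta>' = 1 / (2 * 2 powr (p + 1))"
  have "0 < \<eta>'"
    by (simp add: \<eta>'_def)
  then obtain C' where C': "0 < C'"
    "\<And>(X :: 'a set set) v w. psummable s X v \<Longrightarrow> psummable s X w \<Longrightarrow>
       psum p X (\<lambda>x. mazur (s / p) (v x) - mazur (s / p) (w x))
            \<le> \<eta>' * psum s X v + C' * psum s X (\<lambda>x. v x - w x)"
    using psum_mazur_estimate[OF s p0] by metis
  \<comment> \<open>A lower bound for the fraction of the norm that survives recentring; the bound
    by 1 also covers the case without recentring.\<close>
  define \<kappa> where "\<kappa> = min 1 (1 / (2 * 2 powr (p + 1) * C'))"
  have \<kappa>: "0 < \<kappa>" "\<kappa> \<le> 1" "2 * 2 powr (p + 1) * C' * \<kappa> \<le> 1"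
    using C'(1) by (auto simp: \<kappa>_def min_def field_simps)
  have "0 < e * \<kappa> / 2"
    using e \<kappa> by simp
  then obtain C where C: "0 < C"
    and est: "\<And>H chi \<phi> g. (H, chi) \<in> R_mon G T \<Longrightarrow> equivariant H chi \<phi> \<Longrightarrow> ind_psummable p H \<phi> \<Longrightarrow>
       g \<in> carrier G \<Longrightarrow> displacement s H (\<lambda>x. mazur (p / s) (\<phi> x)) g
          \<le> e * \<kappa> / 2 * ind_psum p H \<phi> + C * displacement p H \<phi> g"
    using displacement_mazur[OF p0 s] by metis
  have "0 < e * \<kappa> / (2 * C)"
    using e \<kappa> C by simp
  with ai K obtain H chi \<phi> where R: "(H, chi) \<in> R_mon G T" and \<phi>: "\<phi> \<in> ind_complement p H chi"
    and pos: "0 < ind_psum p H \<phi>"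
    and inv: "\<And>g. g \<in> K \<Longrightarrow> displacement p H \<phi> g \<le> e * \<kappa> / (2 * C) * ind_psum p H \<phi>"
    unfolding almost_invariant_def by meson
  define N where "N = ind_psum p H \<phi>"
  define \<psi> where "\<psi> = (\<lambda>x. mazur (p / s) (\<phi> x))"
  have \<phi>': "equivariant H chi \<phi>" "ind_psummable p H \<phi>" "\<And>x. x \<notin> carrier G \<Longrightarrow> \<phi> x = 0"
    using \<phi> by (auto simp: ind_complement_def)
  have \<psi>: "equivariant H chi \<psi>" "ind_psummable s H \<psi>" "\<And>x. x \<notin> carrier G \<Longrightarrow> \<psi> x = 0"
    "ind_psum s H \<psi> = N"
    using equivariant_mazur[OF R \<phi>'(1)] \<phi>' s
    by (auto simp: \<psi>_def N_def ind_psummable_def ind_psum_def psum_mazur)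
  have disp: "displacement s H \<psi> g \<le> e * \<kappa> * N" if g: "g \<in> K" for g
  proof -
    have "displacement s H \<psi> g \<le> e * \<kappa> / 2 * N + C * displacement p H \<phi> g"
      unfolding \<psi>_def N_def using est R \<phi>' compactin_carrier[OF K g] by blast
    also have "\<dots> \<le> e * \<kappa> / 2 * N + C * (e * \<kappa> / (2 * C) * N)"
      using inv[OF g] C by (intro add_left_mono mult_left_mono) (auto simp: N_def)
    also have "\<dots> = e * \<kappa> * N"
      using C by simp
    finally show ?thesis .
  qed
  have "\<exists>\<psi>'. \<psi>' \<in> ind_complement s H chi \<and> \<kappa> * N \<le> ind_psum s H \<psi>' \<and>
      (\<forall>g\<in>K. displacement s H \<psi>' g = displacement s H \<psi> g)"
  proof (cases "finite (cosets H) \<and> (\<forall>h\<in>H. chi h = 1)")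
    case False
    then have "\<psi> \<in> ind_complement s H chi"
      using \<psi> by (auto simp: ind_complement_def)
    moreover have "\<kappa> * N \<le> ind_psum s H \<psi>"
      using \<kappa> pos \<psi>(4) by (simp add: N_def mult_left_le_one_le)
    ultimately show ?thesis
      by blast
  next
    case True
    then have fin: "finite (cosets H)" and triv: "\<And>h. h \<in> H \<Longrightarrow> chi h = 1"
      by auto
    note H = R_mon_D(1)[OF R]
    define z where "z = (\<Sum>C\<in>cosets H. \<psi> (rep C)) / card (cosets H)"
    \<comment> \<open>Subtracting a constant does not alter displacements; the function stays zero
      off the carrier, as \<open>ind_complement\<close> demands.\<close>
    define \<psi>' where "\<psi>' = (\<lambda>x. if x \<in> carrier G then \<psi> x - z else 0)"
    have rep': "\<psi>' (rep C) = \<psi> (rep C) - z" if "C \<in> cosets H" for C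
      using cosets_rep(1)[OF H that] by (simp add: \<psi>'_def)
    have card: "card (cosets H) \<noteq> 0"
      using fin cosets_nonempty by simp
    have "(\<Sum>C\<in>cosets H. \<psi>' (rep C)) = (\<Sum>C\<in>cosets H. \<psi> (rep C)) - card (cosets H) * z"
      by (simp add: rep' sum_subtractf)
    also have "\<dots> = 0"
      using card by (simp add: z_def)
    finally have sum0: "(\<Sum>C\<in>cosets H. \<psi>' (rep C)) = 0" .
    have "equivariant H chi \<psi>'"
      using \<psi>(1) triv subgroup.mem_carrier[OF H] by (auto simp: equivariant_def \<psi>'_def)
    then have mem: "\<psi>' \<in> ind_complement s H chi"
      using sum0 fin by (auto simp: ind_complement_def ind_psummable_def \<psi>'_def)
    have disp': "displacement s H \<psi>' g = displacement s H \<psi> g" if "g \<in> K" for g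
      unfolding displacement_def ind_psum_def
      using cosets_rep(1)[OF H] compactin_carrier[OF K that] by (intro psum_cong) (simp add: \<psi>'_def)
    \<comment> \<open>The constant whose image under \<open>mazur (p / s)\<close> is
      \<open>z\<close>.\<close>
    define w where "w = mazur (s / p) z"
    have "(\<Sum>C\<in>cosets H. \<phi> (rep C)) = 0"
      using \<phi> True by (simp add: ind_complement_def)
    then have "N \<le> 2 powr (p + 1) * psum p (cosets H) (\<lambda>C. \<phi> (rep C) - w)"
      unfolding N_def ind_psum_def by (rule psum_centred[OF fin p])
    also have "psum p (cosets H) (\<lambda>C. \<phi> (rep C) - w)
        = psum p (cosets H) (\<lambda>C. mazur (s / p) (\<psi> (rep C)) - mazur (s / p) z)"
      using mazur_mazur[of "p / s"] p s by (simp add: w_def \<psi>_def)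
    also have "\<dots> \<le> \<eta>' * psum s (cosets H) (\<lambda>C. \<psi> (rep C)) + C' * psum s (cosets H) (\<lambda>C. \<psi> (rep C) - z)"
      by (rule C'(2)) (use fin in auto)
    also have "psum s (cosets H) (\<lambda>C. \<psi> (rep C)) = N"
      using \<psi>(4) by (simp add: ind_psum_def)
    also have "psum s (cosets H) (\<lambda>C. \<psi> (rep C) - z) = ind_psum s H \<psi>'"
      unfolding ind_psum_def using rep' by (intro psum_cong) simp
    finally have "N \<le> 2 powr (p + 1) * (\<eta>' * N + C' * ind_psum s H \<psi>')"
      by simp
    then have "N \<le> 2 * 2 powr (p + 1) * C' * ind_psum s H \<psi>'"
      by (simp add: \<eta>'_def algebra_simps)
    then have "\<kappa> * N \<le> (2 * 2 powr (p + 1) * C' * \<kappa>) * ind_psum s H \<psi>'"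
      using \<kappa>(1) by (metis mult.assoc mult.commute mult_le_cancel_left_pos)
    also have "\<dots> \<le> 1 * ind_psum s H \<psi>'"
      using \<kappa>(3) by (intro mult_right_mono) (auto simp: ind_psum_def psum_nonneg)
    finally show ?thesis
      using mem disp' by auto
  qed
  then obtain \<psi>' where \<psi>': "\<psi>' \<in> ind_complement s H chi" "\<kappa> * N \<le> ind_psum s H \<psi>'"
    "\<And>g. g \<in> K \<Longrightarrow> displacement s H \<psi>' g = displacement s H \<psi> g"
    by blast
  have "displacement s H \<psi>' g \<le> e * ind_psum s H \<psi>'" if g: "g \<in> K" for g
  proof -
    have "displacement s H \<psi>' g \<le> e * (\<kappa> * N)"
      using disp[OF g] \<psi>'(3)[OF g] by (simp add: mult.assoc)
    also have "\<dots> \<le> e * ind_psum s H \<psi>'"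
      using \<psi>'(2) e by (intro mult_left_mono) auto
    finally show ?thesis .
  qed
  moreover have "0 < ind_psum s H \<psi>'"
    using \<psi>'(2) \<kappa>(1) pos by (smt (verit) N_def mult_pos_pos)
  ultimately show "\<exists>H chi \<phi>. (H, chi) \<in> R_mon G T \<and> \<phi> \<in> ind_complement s H chi \<and> 0 < ind_psum s H \<phi> \<and>
        (\<forall>g\<in>K. displacement s H \<phi> g \<le> e * ind_psum s H \<phi>)"
    using R \<psi>'(1) by blast
qed

section \<open>The direct sum over all monomial representations\<close>

lemma ind_norm2_displacement:
  "ind_norm2 G H (\<lambda>x. ind_act G g \<phi> x - \<phi> x) = displacement 2 H \<phi> g"
  by (simp add: ind_norm2_eq displacement_def ind_act_def)

lemma almost_invariant_if_Rmon:
  assumes "has_almost_inv_Rmon G T"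
  shows "almost_invariant 2"
proof (rule almost_invariant_direct_sum[where ?'i = "'a set \<times> ('a \<Rightarrow> complex)"])
  fix K and e :: real
  assume K: "compactin T K" and e: "0 < e"
  from assms obtain \<Phi> where
    mem: "\<And>k H chi. (H, chi) \<in> R_mon G T \<Longrightarrow> \<Phi> k (H, chi) \<in> ind_compl G H chi"
    and summable: "\<And>k. (\<lambda>(H, chi). ind_norm2 G H (\<Phi> k (H, chi))) summable_on R_mon G T"
    and one: "\<And>k. infsum (\<lambda>(H, chi). ind_norm2 G H (\<Phi> k (H, chi))) (R_mon G T) = 1"
    and ev: "\<And>K e. compactin T K \<Longrightarrow> 0 < e \<Longrightarrow> \<forall>\<^sub>F k in sequentially. \<forall>g\<in>K.
            infsum (\<lambda>(H, chi). ind_norm2 G H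
               (\<lambda>x. ind_act G g (\<Phi> k (H, chi)) x - \<Phi> k (H, chi) x)) (R_mon G T) < e"
    unfolding has_almost_inv_Rmon_def by blast
  have "0 < e / 2"
    using e by simp
  from ev[OF K this] obtain k where k: "\<And>g. g \<in> K \<Longrightarrow>
            infsum (\<lambda>(H, chi). ind_norm2 G H
               (\<lambda>x. ind_act G g (\<Phi> k (H, chi)) x - \<Phi> k (H, chi) x)) (R_mon G T) < e / 2"
    by (auto simp: eventually_sequentially)
  define n where "n i = ind_psum 2 (fst i) (\<Phi> k i)" for i
  define d where "d g i = displacement 2 (fst i) (\<Phi> k i) g" for g i
  have n: "n summable_on R_mon G T" "infsum n (R_mon G T) = 1"
    using summable[of k] one[of k] by (auto simp: n_def[abs_def] ind_norm2_eq case_prod_unfold)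
  have d: "infsum (d g) (R_mon G T) < e / 2" if "g \<in> K" for g
    using k[OF that] by (simp add: d_def[abs_def] ind_norm2_displacement case_prod_unfold)
  have nonneg: "0 \<le> n i" "0 \<le> d g i" for i g
    by (auto simp: n_def d_def ind_psum_def displacement_def psum_nonneg)
  have mem': "(fst i, snd i) \<in> R_mon G T" "\<Phi> k i \<in> ind_complement 2 (fst i) (snd i)"
    if "i \<in> R_mon G T" for i
    using mem[of "fst i" "snd i" k] that ind_compl_eq[of "fst i" "snd i"] by auto
  \<comment> \<open>Summability of the displacements has to be secured: \<open>infsum\<close> is 0
    on a family that is not summable, and its smallness would then carry no information. The factor
    8 is \<open>2 * 2 powr 2\<close>.\<close>
  have le: "d g i \<le> 8 * n i" if "g \<in> carrier G" "i \<in> R_mon G T" for g i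
    using displacement_summable(2)[OF _ mem'(1)[OF that(2)] _ _ that(1), of 2 "\<Phi> k i"] mem'(2)[OF that(2)]
    by (auto simp: d_def n_def ind_complement_def)
  have ds: "d g summable_on R_mon G T" if "g \<in> carrier G" for g
    by (rule summable_on_comparison_test[OF summable_on_cmult_right[OF n(1), of 8]])
       (use le[OF that] nonneg in auto)
  \<comment> \<open>\<open>J\<close> carries at least half of the total norm 1, so a total
    displacement below \<open>e / 2\<close> is at most \<open>e\<close> times the norm over
    \<open>J\<close>.\<close>
  obtain J where J: "finite J" "J \<subseteq> R_mon G T" "dist (sum n J) (infsum n (R_mon G T)) \<le> 1 / 2"
    using infsum_finite_approximation[OF n(1), of "1 / 2"] by auto
  then have sum: "1 / 2 \<le> sum n J"
    using n(2) unfolding dist_real_def by linarith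
  have "(\<Sum>i\<in>J. d g i) \<le> e * sum n J" if g: "g \<in> K" for g
  proof -
    have "(\<Sum>i\<in>J. d g i) \<le> infsum (d g) (R_mon G T)"
      using J nonneg ds[OF compactin_carrier[OF K g]] by (intro finite_sum_le_infsum) auto
    also have "\<dots> \<le> e * (1 / 2)"
      using d[OF g] by simp
    also have "\<dots> \<le> e * sum n J"
      using sum e by (intro mult_left_mono) auto
    finally show ?thesis .
  qed
  then show "\<exists>(J :: ('a set \<times> ('a \<Rightarrow> complex)) set) H chi \<phi>. finite J \<and>
        (\<forall>i\<in>J. (H i, chi i) \<in> R_mon G T \<and> \<phi> i \<in> ind_complement 2 (H i) (chi i)) \<and>
        0 < (\<Sum>i\<in>J. ind_psum 2 (H i) (\<phi> i)) \<and>
        (\<forall>g\<in>K. (\<Sum>i\<in>J. displacement 2 (H i) (\<phi> i) g) \<le> e * (\<Sum>i\<in>J. ind_psum 2 (H i) (\<phi> i)))"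
    using J sum mem'
    by (intro exI[of _ J] exI[of _ fst] exI[of _ snd] exI[of _ "\<Phi> k"]) (auto simp: n_def d_def)
qed simp

lemma ind_complement_0: "(\<lambda>_. 0) \<in> ind_complement p H chi"
  by (simp add: ind_complement_def equivariant_def ind_psummable_def psummable_def)

lemma ind_complement_cmult:
  assumes "\<phi> \<in> ind_complement p H chi"
  shows "(\<lambda>x. c * \<phi> x) \<in> ind_complement p H chi"
    and "ind_psum p H (\<lambda>x. c * \<phi> x) = cmod c powr p * ind_psum p H \<phi>"
  using assms psum_cmult[of p "cosets H" "\<lambda>C. \<phi> (rep C)" c]
  by (auto simp: ind_complement_def equivariant_def ind_psummable_def ind_psum_def
      sum_distrib_left[symmetric] mult.left_commute)

lemma displacement_cmult:
  assumes "0 < p" "(H, chi) \<in> R_mon G T" "\<phi> \<in> ind_complement p H chi" "g \<in> carrier G"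
  shows "displacement p H (\<lambda>x. c * \<phi> x) g = cmod c powr p * displacement p H \<phi> g"
  using displacement_summable(1)[OF assms(1,2) _ _ assms(4), of \<phi>] assms(3)
    psum_cmult[of p "cosets H" "\<lambda>C. \<phi> (inv g \<otimes> rep C) - \<phi> (rep C)" c]
  by (simp add: ind_complement_def displacement_def ind_psum_def ind_psummable_def right_diff_distrib)

text \<open>A compact exhaustion merges all pairs of a compact set and a tolerance into one
  sequence; scaling by \<open>N powr (- (1 / p))\<close> normalises the vectors.\<close>

lemma almost_invariant_sequence:
  assumes p: "0 < p" and ai: "almost_invariant p"
  obtains H :: "nat \<Rightarrow> 'a set" and chi \<phi> where
    "\<And>n. (H n, chi n) \<in> R_mon G T" "\<And>n. \<phi> n \<in> ind_complement p (H n) (chi n)"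
    "\<And>n. ind_psum p (H n) (\<phi> n) = 1"
    "\<And>K e. compactin T K \<Longrightarrow> 0 < e \<Longrightarrow>
       \<forall>\<^sub>F n in sequentially. \<forall>g\<in>K. displacement p (H n) (\<phi> n) g < e"
proof -
  obtain K where K: "\<And>n. compactin T (K n)"
    "\<And>S. compactin T S \<Longrightarrow> \<forall>\<^sub>F n in sequentially. S \<subseteq> K n"
    using compact_exhaustion by metis
  have "\<exists>H chi \<phi>. (H, chi) \<in> R_mon G T \<and> \<phi> \<in> ind_complement p H chi \<and> ind_psum p H \<phi> = 1 \<and>
      (\<forall>g\<in>K n. displacement p H \<phi> g \<le> inverse (real (Suc n)))" for n
  proof -
    have "0 < inverse (real (Suc n))"
      by simp
    with ai K(1)[of n] obtain H chi \<phi> where R: "(H, chi) \<in> R_mon G T" and \<phi>: "\<phi> \<in> ind_complement p H chi"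
      and pos: "0 < ind_psum p H \<phi>"
      and le: "\<And>g. g \<in> K n \<Longrightarrow> displacement p H \<phi> g \<le> inverse (real (Suc n)) * ind_psum p H \<phi>"
      unfolding almost_invariant_def by meson
    define N where "N = ind_psum p H \<phi>"
    define c where "c = complex_of_real (N powr (- (1 / p)))"
    have "cmod c = N powr (- (1 / p))"
      unfolding c_def norm_of_real by (rule abs_of_nonneg) (rule powr_ge_zero)
    then have "cmod c powr p = N powr (- 1)"
      using p by (simp only: powr_powr) simp
    then have c: "cmod c powr p = inverse N"
      using pos by (simp add: N_def powr_minus)
    have "displacement p H (\<lambda>x. c * \<phi> x) g \<le> inverse (real (Suc n))" if g: "g \<in> K n" for g
    proof -
      have "displacement p H (\<lambda>x. c * \<phi> x) g = inverse N * displacement p H \<phi> g"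
        using displacement_cmult[OF p R \<phi> compactin_carrier[OF K(1) g]] c by simp
      also have "\<dots> \<le> inverse N * (inverse (real (Suc n)) * N)"
        using le[OF g] pos unfolding N_def by (intro mult_left_mono) auto
      also have "\<dots> = inverse (real (Suc n))"
        using pos by (simp add: N_def)
      finally show ?thesis .
    qed
    then show ?thesis
      using R ind_complement_cmult[OF \<phi>, of c] c pos
      by (intro exI[of _ H] exI[of _ chi] exI[of _ "\<lambda>x. c * \<phi> x"]) (auto simp: N_def)
  qed
  then obtain H chi \<phi> where *: "\<And>n. (H n, chi n) \<in> R_mon G T" "\<And>n. \<phi> n \<in> ind_complement p (H n) (chi n)"
    "\<And>n. ind_psum p (H n) (\<phi> n) = 1"
    and le: "\<And>n g. g \<in> K n \<Longrightarrow> displacement p (H n) (\<phi> n) g \<le> inverse (real (Suc n))"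
    by metis
  have "\<forall>\<^sub>F n in sequentially. \<forall>g\<in>S. displacement p (H n) (\<phi> n) g < e" if S: "compactin T S" "0 < e" for S e
  proof -
    have "\<forall>\<^sub>F n in sequentially. inverse (real (Suc n)) < e"
      using order_tendstoD(2)[OF LIMSEQ_inverse_real_of_nat S(2)] .
    with K(2)[OF S(1)] show ?thesis
      by eventually_elim (use le in force)
  qed
  with * show thesis
    by (rule that)
qed

lemma Rmon_if_almost_invariant:
  assumes "almost_invariant 2"
  shows "has_almost_inv_Rmon G T"
proof -
  obtain H :: "nat \<Rightarrow> 'a set" and chi \<phi> where R: "\<And>n. (H n, chi n) \<in> R_mon G T"
    and \<phi>: "\<And>n. \<phi> n \<in> ind_complement 2 (H n) (chi n)"
    and one: "\<And>n. ind_psum 2 (H n) (\<phi> n) = 1"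
    and ev: "\<And>K e. compactin T K \<Longrightarrow> 0 < e \<Longrightarrow>
       \<forall>\<^sub>F n in sequentially. \<forall>g\<in>K. displacement 2 (H n) (\<phi> n) g < e"
    using almost_invariant_sequence[OF _ assms] by auto
  \<comment> \<open>Each family is supported at a single index, so the sums over
    \<open>R_mon G T\<close> reduce to one term.\<close>
  define \<Phi> where "\<Phi> n i = (if i = (H n, chi n) then \<phi> n else (\<lambda>_. 0))" for n i
  have zero: "ind_psum 2 H' (\<lambda>_. 0) = 0" for H'
    by (simp add: ind_psum_def psum_def)
  have s1: "((\<lambda>(H', chi'). ind_norm2 G H' (\<Phi> n (H', chi'))) has_sum 1) (R_mon G T)" for n
    by (rule has_sum_finite_neutralI[of "{(H n, chi n)}"])
       (use R one zero in \<open>auto simp: \<Phi>_def ind_norm2_eq split: if_split_asm\<close>)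
  have s2: "((\<lambda>(H', chi'). ind_norm2 G H' (\<lambda>x. ind_act G g (\<Phi> n (H', chi')) x - \<Phi> n (H', chi') x))
      has_sum displacement 2 (H n) (\<phi> n) g) (R_mon G T)" for n g
    by (rule has_sum_finite_neutralI[of "{(H n, chi n)}"])
       (use R zero in \<open>auto simp: \<Phi>_def ind_norm2_displacement displacement_def split: if_split_asm\<close>)
  have mem: "\<Phi> n (H', chi') \<in> ind_compl G H' chi'" if "(H', chi') \<in> R_mon G T" for n H' chi'
    using ind_compl_eq[OF that] \<phi>[of n] ind_complement_0 by (auto simp: \<Phi>_def)
  show ?thesis
    unfolding has_almost_inv_Rmon_def
    by (intro exI[of _ \<Phi>]) (use mem ev in \<open>auto simp: has_sum_imp_summable[OF s1] infsumI[OF s1] infsumI[OF s2]\<close>)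
qed

end

section \<open>From induced representations to sequence spaces\<close>

lemma lp_space_iff: "f \<in> lp_space p \<longleftrightarrow> psummable p UNIV f"
  by (simp add: lp_space_def psummable_def summable_on_UNIV_nonneg_real_iff)

lemma lp_norm_eq:
  assumes "f \<in> lp_space p"
  shows "lp_norm p f = psum p UNIV f powr (1 / p)"
proof -
  have "(\<lambda>n. cmod (f n) powr p) sums psum p UNIV f"
    using assms unfolding lp_space_iff psummable_def psum_def by (intro has_sum_imp_sums has_sum_infsum)
  then show ?thesis
    by (simp add: lp_norm_def sums_iff)
qed

lemma lp_norm_less_iff:
  assumes "f \<in> lp_space p" "0 < p" "0 < e"
  shows "lp_norm p f < e \<longleftrightarrow> psum p UNIV f < e powr p"
proof -
  have "(lp_norm p f) powr p = psum p UNIV f"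
    using assms by (simp add: lp_norm_eq powr_powr psum_nonneg)
  moreover have "lp_norm p f < e \<longleftrightarrow> lp_norm p f powr p < e powr p"
  proof
    show "lp_norm p f < e \<Longrightarrow> lp_norm p f powr p < e powr p"
      using assms by (intro powr_less_mono2) (auto simp: lp_norm_eq)
    show "lp_norm p f powr p < e powr p \<Longrightarrow> lp_norm p f < e"
      using assms powr_mono2[of p e "lp_norm p f"] by linarith
  qed
  ultimately show ?thesis
    by simp
qed

lemma lp_pair_single: "lp_pair (\<lambda>n. if n = m then a else 0) h = a * h m"
proof -
  have "(\<lambda>n. (if n = m then a else 0) * h n) = (\<lambda>n. if n = m then a * h n else 0)"
    by auto
  then show ?thesis
    using sums_single[of m "\<lambda>n. a * h n"] by (simp add: lp_pair_def sums_iff)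
qed

lemma single_in_lp_space: "0 < p \<Longrightarrow> (\<lambda>n. if n = m then a else 0) \<in> lp_space p"
  unfolding lp_space_def using sums_single[of m "\<lambda>n. cmod a powr p"]
  by (auto simp: sums_iff if_distrib[of cmod] if_distrib[of "\<lambda>x. x powr p"] cong: if_cong)

lemma block_has_sum:
  "((\<lambda>i. if fst i = k then u (snd i) else 0) has_sum s) (Sigma UNIV A) \<longleftrightarrow> (u has_sum s) (A k)"
proof -
  have "((\<lambda>i. if fst i = k then u (snd i) else 0) has_sum s) (Sigma UNIV A)
      \<longleftrightarrow> ((\<lambda>i. u (snd i)) has_sum s) (Pair k ` A k)"
    by (rule has_sum_cong_neutral) auto
  also have "\<dots> \<longleftrightarrow> (u has_sum s) (A k)"
    by (subst has_sum_reindex) (auto simp: inj_on_def o_def)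
  finally show ?thesis .
qed

lemma block_psum:
  assumes "psummable p (A k) u"
  shows "psum p (Sigma UNIV A) (\<lambda>i. if fst i = k then u (snd i) else 0) = psum p (A k) u"
    and "psummable p (Sigma UNIV A) (\<lambda>i. if fst i = k then u (snd i) else 0)"
proof -
  have "((\<lambda>x. cmod (u x) powr p) has_sum psum p (A k) u) (A k)"
    using assms by (simp add: psummable_def psum_def)
  then have *: "((\<lambda>i. if fst i = k then cmod (u (snd i)) powr p else 0) has_sum psum p (A k) u) (Sigma UNIV A)"
    by (subst block_has_sum)
  have eq: "cmod (if fst i = k then u (snd i) else 0) powr p = (if fst i = k then cmod (u (snd i)) powr p else 0)"
    for i by simp
  show "psum p (Sigma UNIV A) (\<lambda>i. if fst i = k then u (snd i) else 0) = psum p (A k) u"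
    unfolding psum_def eq using infsumI[OF *] by (simp add: psum_def)
  show "psummable p (Sigma UNIV A) (\<lambda>i. if fst i = k then u (snd i) else 0)"
    unfolding psummable_def eq using * has_sum_imp_summable by blast
qed

context lcsc
begin

lemma orth_rep_monomial:
  assumes p: "0 < p"
    and bij: "\<And>g. g \<in> carrier G \<Longrightarrow> bij (\<tau> g)"
    and c1: "\<And>g n. g \<in> carrier G \<Longrightarrow> cmod (c g n) = 1"
    and one: "\<And>n. \<tau> \<one> n = n" "\<And>n. c \<one> n = 1"
    and mult: "\<And>g h n. g \<in> carrier G \<Longrightarrow> h \<in> carrier G \<Longrightarrow> \<tau> (g \<otimes> h) n = \<tau> h (\<tau> g n)"
      "\<And>g h n. g \<in> carrier G \<Longrightarrow> h \<in> carrier G \<Longrightarrow> c (g \<otimes> h) n = c g n * c h (\<tau> g n)"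
    and loc: "\<And>n e. 0 < e \<Longrightarrow>
      \<exists>U. openin T U \<and> \<one> \<in> U \<and> (\<forall>g\<in>U. \<tau> g n = n \<and> cmod (c g n - 1) < e)"
  shows "orth_rep G T p (\<lambda>g f n. c g n * f (\<tau> g n))"
proof -
  define \<pi> where "\<pi> = (\<lambda>g (f :: nat \<Rightarrow> complex) n. c g n * f (\<tau> g n))"
  have lp: "\<pi> g f \<in> lp_space p \<longleftrightarrow> f \<in> lp_space p" "psum p UNIV (\<pi> g f) = psum p UNIV f"
    if "g \<in> carrier G" for g f
    using psum_monomial[OF bij[OF that], of "c g" p f, OF c1[OF that]] by (auto simp: lp_space_iff \<pi>_def)
  have \<pi>_mult: "\<pi> (g \<otimes> h) f = \<pi> g (\<pi> h f)" if "g \<in> carrier G" "h \<in> carrier G" for g h f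
    using mult[OF that] by (simp add: \<pi>_def mult.assoc)
  have \<pi>_one: "\<pi> \<one> f = f" for f
    by (simp add: \<pi>_def one)
  have "lp_isometry p (\<pi> g)" if g: "g \<in> carrier G" for g
    unfolding lp_isometry_def
  proof (intro conjI ballI allI)
    show "bij_betw (\<pi> g) (lp_space p) (lp_space p)"
    proof (rule bij_betw_byWitness[where f' = "\<pi> (inv g)"])
      show "\<forall>f\<in>lp_space p. \<pi> (inv g) (\<pi> g f) = f" "\<forall>f\<in>lp_space p. \<pi> g (\<pi> (inv g) f) = f"
        using g by (simp_all add: \<pi>_mult[symmetric] \<pi>_one)
      show "\<pi> g ` lp_space p \<subseteq> lp_space p" "\<pi> (inv g) ` lp_space p \<subseteq> lp_space p"
        using lp g by auto
    qed
    show "\<pi> g (\<lambda>n. a * f n + b * f' n) = (\<lambda>n. a * \<pi> g f n + b * \<pi> g f' n)" for f f' a b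
      by (simp add: \<pi>_def algebra_simps)
    show "lp_norm p (\<pi> g f) = lp_norm p f" if "f \<in> lp_space p" for f
      using that lp[OF g] by (simp add: lp_norm_eq)
  qed
  moreover have "\<exists>U. openin T U \<and> g0 \<in> U \<and> (\<forall>g\<in>U. lp_norm p (\<lambda>n. \<pi> g f n - \<pi> g0 f n) < e)"
    if f: "f \<in> lp_space p" and g0: "g0 \<in> carrier G" and e: "0 < e" for f g0 and e :: real
  proof -
    obtain U where U: "openin T U" "\<one> \<in> U"
      "\<And>g. g \<in> U \<Longrightarrow> psum p UNIV (\<lambda>n. c g n * f (\<tau> g n) - f n) < e powr p"
      using monomial_continuous[of p UNIV f \<tau> c "e powr p"] p f bij c1 loc e
      by (auto simp: lp_space_iff)
    have "lp_norm p (\<lambda>n. \<pi> g f n - \<pi> g0 f n) < e" if g: "g \<in> g0 <# U" for g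
    proof -
      obtain u where u: "u \<in> U" "g = g0 \<otimes> u"
        using g by (auto simp: l_coset_def)
      have uG: "u \<in> carrier G"
        using openin_carrier[OF U(1) u(1)] .
      define v where "v = (\<lambda>n. \<pi> u f n - f n)"
      \<comment> \<open>Writing \<open>g\<close> as \<open>g0 \<otimes> u\<close> pulls the isometry
        \<open>\<pi> g0\<close> out of the difference; continuity at \<open>g0\<close> follows from
        continuity at \<open>\<one>\<close>.\<close>
      have eq: "(\<lambda>n. \<pi> g f n - \<pi> g0 f n) = \<pi> g0 v"
        unfolding u(2) \<pi>_mult[OF g0 uG] v_def by (simp add: \<pi>_def algebra_simps)
      have "v \<in> lp_space p"
        using psum_diff(1)[of p UNIV "\<pi> u f" f] p f lp[OF uG] by (simp add: lp_space_iff v_def)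
      moreover have "psum p UNIV v < e powr p"
        using U(3)[OF u(1)] by (simp add: v_def \<pi>_def)
      ultimately show ?thesis
        unfolding eq using lp[OF g0] p e by (simp add: lp_norm_less_iff)
    qed
    moreover have "openin T (g0 <# U)" "g0 \<in> g0 <# U"
      using openin_l_coset[OF g0 U(1)] U(2) g0 by (auto simp: l_coset_def intro!: bexI[of _ \<one>])
    ultimately show ?thesis
      by blast
  qed
  ultimately have "orth_rep G T p \<pi>"
    unfolding orth_rep_def using \<pi>_mult \<pi>_one by blast
  then show ?thesis
    by (simp add: \<pi>_def)
qed

text \<open>The cosets of an open subgroup partition the group into open sets. A subcover of a
  partition omits nothing, so the Lindelof property applies to the partition itself.\<close>

lemma countable_cosets:
  assumes "subgroup H G" "openin T H"
  shows "countable (cosets H)"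
proof -
  have "Lindelof_space T"
    by (rule second_countable_imp_Lindelof_space[OF second_countable_T])
  note Lindelof = this[unfolded Lindelof_space_def, THEN spec, of "cosets H", THEN mp]
  have op: "\<forall>C\<in>cosets H. openin T C"
    using openin_l_coset[OF _ assms(2)] unfolding lcoset_space_def by blast
  have union: "\<Union> (cosets H) = topspace T"
  proof (intro equalityI subsetI)
    fix x assume "x \<in> \<Union> (cosets H)"
    then show "x \<in> topspace T"
      using op openin_carrier by auto
  next
    fix x assume x: "x \<in> topspace T"
    then have "x \<otimes> \<one> \<in> x <# H"
      using subgroup.one_closed[OF assms(1)] unfolding l_coset_def by blast
    then show "x \<in> \<Union> (cosets H)"
      using x coset_in by auto
  qed
  from Lindelof[OF conjI[OF op union]]
  obtain \<V> where \<V>: "countable \<V>" "\<V> \<subseteq> cosets H" "\<Union>\<V> = topspace T"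
    by (elim exE conjE)
  have "C \<in> \<V>" if C: "C \<in> cosets H" for C
  proof -
    have "rep C \<in> \<Union>\<V>"
      using cosets_rep(1)[OF assms(1) C] \<V>(3) by simp
    then obtain D where D: "D \<in> \<V>" "rep C \<in> D"
      by blast
    then obtain y where y: "y \<in> carrier G" "D = y <# H"
      using \<V>(2) unfolding lcoset_space_def by blast
    then obtain h where "h \<in> H" "rep C = y \<otimes> h"
      using D(2) by (auto simp: l_coset_def)
    then have "D = C"
      using y l_coset_eqI[OF assms(1) y(1)] cosets_rep(2)[OF assms(1) C] by metis
    then show ?thesis
      using D by simp
  qed
  then have "cosets H \<subseteq> \<V>"
    by (rule subsetI)
  then show ?thesis
    by (rule countable_subset) (rule \<V>(1))
qed

lemma coset_act_one: "subgroup H G \<Longrightarrow> C \<in> cosets H \<Longrightarrow> coset_act H \<one> C = C"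
  using cosets_rep[of H C] by (simp add: coset_act_def)

lemma coset_act_mult:
  assumes "subgroup H G" "C \<in> cosets H" "g \<in> carrier G" "h \<in> carrier G"
  shows "coset_act H (g \<otimes> h) C = coset_act H h (coset_act H g C)"
  using cosets_rep[OF assms(1,2)] assms(3,4)
  unfolding coset_act_def[of H "g \<otimes> h" C] coset_act_def[of H g C]
  by (simp add: coset_act_coset[OF assms(1)] inv_mult_group m_assoc)

lemma coset_act_in: "subgroup H G \<Longrightarrow> C \<in> cosets H \<Longrightarrow> g \<in> carrier G \<Longrightarrow> coset_act H g C \<in> cosets H"
  using bij_betw_apply[OF bij_coset_act] .

lemma cocycle_one:
  assumes "(H, chi) \<in> R_mon G T" "C \<in> cosets H"
  shows "cocycle H chi \<one> C = 1"
  using R_mon_D[OF assms(1)] cosets_rep[of H C] coset_act_one[of H C] assms(2)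
  by (simp add: cocycle_def)

text \<open>The parts in \<open>H\<close> of two successive translations multiply as
  \<open>b \<otimes> a\<close>; the order disappears because complex values commute.\<close>

lemma cocycle_mult:
  assumes R: "(H, chi) \<in> R_mon G T" and C: "C \<in> cosets H" and g: "g \<in> carrier G" and h: "h \<in> carrier G"
  shows "cocycle H chi (g \<otimes> h) C = cocycle H chi g C * cocycle H chi h (coset_act H g C)"
proof -
  note R' = R_mon_D[OF R]
  define C' where "C' = coset_act H g C"
  define C'' where "C'' = coset_act H h C'"
  have mem: "C' \<in> cosets H" "C'' \<in> cosets H"
    using coset_act_in[OF R'(1)] C g h by (auto simp: C'_def C''_def)
  define a where "a = inv (rep C') \<otimes> (inv g \<otimes> rep C)"
  define b where "b = inv (rep C'') \<otimes> (inv h \<otimes> rep C')"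
  have ab: "a \<in> H" "b \<in> H"
    using coset_act_decomp(1)[OF R'(1) g C] coset_act_decomp(1)[OF R'(1) h mem(1)]
    by (auto simp: a_def b_def C'_def C''_def)
  have r: "rep C \<in> carrier G" "rep C' \<in> carrier G" "rep C'' \<in> carrier G"
    using cosets_rep(1)[OF R'(1)] C mem by auto
  have cancel: "rep C' \<otimes> (inv (rep C') \<otimes> y) = y" if "y \<in> carrier G" for y
    using r that by (simp add: m_assoc[symmetric])
  have "b \<otimes> a = inv (rep C'') \<otimes> (inv (g \<otimes> h) \<otimes> rep C)"
    unfolding a_def b_def using r g h by (simp add: m_assoc cancel inv_mult_group)
  then have "cocycle H chi (g \<otimes> h) C = cnj (chi (b \<otimes> a))"
    using coset_act_mult[OF R'(1) C g h] by (simp add: cocycle_def C''_def C'_def)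
  also have "\<dots> = cnj (chi a) * cnj (chi b)"
    using R'(4)[OF ab(2,1)] by simp
  finally show ?thesis
    by (simp add: cocycle_def a_def b_def C'_def C''_def)
qed

text \<open>In its use, \<open>w\<close> is one block of an invariant vector of the dual
  representation. Transitivity makes its modulus constant; if it is nonzero, summability leaves
  finitely many cosets, the stabilizer of the base coset makes \<open>chi\<close> trivial, and
  \<open>w\<close> is constant, so the mean-zero condition on \<open>\<phi>\<close> applies.\<close>

lemma invariant_functional_vanishes:
  assumes R: "(H, chi) \<in> R_mon G T" and \<phi>: "\<phi> \<in> ind_complement p H chi"
    and w: "\<And>g C. g \<in> carrier G \<Longrightarrow> C \<in> cosets H \<Longrightarrow> w (coset_act H g C) = cocycle H chi g C * w C"
    and s: "psummable q (cosets H) w"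
  shows "((\<lambda>C. \<phi> (rep C) * w C) has_sum 0) (cosets H)"
proof -
  note R' = R_mon_D[OF R]
  define C0 where "C0 = \<one> <# H"
  have C0: "C0 \<in> cosets H"
    by (simp add: C0_def coset_in)
  have trans: "coset_act H (inv (rep C)) C0 = C" if "C \<in> cosets H" for C
    using cosets_rep[OF R'(1) that] coset_act_coset[OF R'(1), of "inv (rep C)" \<one>] by (simp add: C0_def)
  have wC: "w C = cocycle H chi (inv (rep C)) C0 * w C0" if "C \<in> cosets H" for C
    using w[of "inv (rep C)" C0] trans[OF that] cosets_rep(1)[OF R'(1) that] C0 by simp
  have cocycle1: "cmod (cocycle H chi g C) = 1" if "g \<in> carrier G" "C \<in> cosets H" for g C
    using R' coset_act_decomp(1)[OF R'(1) that] by (simp add: cocycle_def)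
  have mod: "cmod (w C) = cmod (w C0)" if "C \<in> cosets H" for C
    using wC[OF that] cocycle1[of "inv (rep C)" C0] cosets_rep(1)[OF R'(1) that] C0 by (simp add: norm_mult)
  show ?thesis
  proof (cases "w C0 = 0")
    case True
    then have "w C = 0" if "C \<in> cosets H" for C
      using mod[OF that] by simp
    then show ?thesis
      by (intro has_sum_0) simp
  next
    case False
    have "psummable q (cosets H) (\<lambda>_. w C0)"
      using s psummable_cong[of "cosets H" w "\<lambda>_. w C0"] mod by blast
    then have fin: "finite (cosets H)"
      using psummable_const_finite False by blast
    have triv: "chi h = 1" if h: "h \<in> H" for h
    proof -
      define r where "r = rep C0"
      have hG: "h \<in> carrier G"
        using h subgroup.mem_carrier[OF R'(1)] by blast
      obtain k where "k \<in> H" "r = \<one> \<otimes> k"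
        using rep_coset[OF R'(1) one_closed] unfolding r_def C0_def by blast
      then have r: "r \<in> H" "r \<in> carrier G"
        using subgroup.mem_carrier[OF R'(1)] by auto
      have "coset_act H (inv h) C0 = (\<one> \<otimes> h) <# H"
        using coset_act_coset[OF R'(1), of "inv h" \<one>] hG by (simp add: C0_def)
      also have "\<dots> = C0"
        unfolding C0_def by (rule l_coset_eqI[OF R'(1) one_closed h])
      finally have fixed: "coset_act H (inv h) C0 = C0" .
      \<comment> \<open>\<open>r\<close> lies in \<open>H\<close>, so conjugation by it does not
        change the value of \<open>chi\<close>.\<close>
      have "chi (inv r) * chi r = 1"
        using R'(4)[of "inv r" r] R'(6) r subgroup.m_inv_closed[OF R'(1)] by simp
      then have "chi (inv r \<otimes> (h \<otimes> r)) = chi h"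
        using R'(4) r h subgroup.m_inv_closed[OF R'(1)] subgroup.m_closed[OF R'(1)]
        by (simp add: mult.left_commute)
      then have "cocycle H chi (inv h) C0 = cnj (chi h)"
        using fixed hG by (simp add: cocycle_def r_def)
      then have "w C0 = cnj (chi h) * w C0"
        using w[of "inv h" C0] fixed hG C0 by simp
      then show ?thesis
        using False by (metis complex_cnj_cnj complex_cnj_one mult_cancel_right2)
    qed
    have "w C = w C0" if "C \<in> cosets H" for C
    proof -
      have "inv (rep C) \<in> carrier G"
        using cosets_rep(1)[OF R'(1) that] by simp
      then show ?thesis
        using wC[OF that] triv coset_act_decomp(1)[OF R'(1) _ C0] by (simp add: cocycle_def)
    qed
    then have "(\<Sum>C\<in>cosets H. \<phi> (rep C) * w C) = (\<Sum>C\<in>cosets H. \<phi> (rep C)) * w C0"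
      by (simp add: sum_distrib_right)
    also have "\<dots> = 0"
      using \<phi> fin triv by (simp add: ind_complement_def)
    finally show ?thesis
      using fin by (intro has_sum_finiteI) auto
  qed
qed

text \<open>Each vector gets its own block, so a single representation hosts the whole sequence,
  whatever repetitions occur among the pairs \<open>(H n, chi n)\<close>.\<close>

lemma not_property_T_lp_if_almost_invariant:
  assumes p: "1 < p" and ai: "almost_invariant p"
  shows "\<not> property_T_lp G T p"
proof -
  have p0: "0 < p"
    using p by simp
  obtain H :: "nat \<Rightarrow> 'a set" and chi \<phi> where R: "\<And>n. (H n, chi n) \<in> R_mon G T"
    and \<phi>: "\<And>n. \<phi> n \<in> ind_complement p (H n) (chi n)"
    and norm1: "\<And>n. ind_psum p (H n) (\<phi> n) = 1"
    and ev: "\<And>K e. compactin T K \<Longrightarrow> 0 < e \<Longrightarrow>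
       \<forall>\<^sub>F n in sequentially. \<forall>g\<in>K. displacement p (H n) (\<phi> n) g < e"
    using almost_invariant_sequence[OF p0 ai] by auto
  have \<phi>': "equivariant (H n) (chi n) (\<phi> n)" "ind_psummable p (H n) (\<phi> n)" for n
    using \<phi>[of n] by (auto simp: ind_complement_def)
  note R' = R_mon_D[OF R]
  define I where "I = Sigma UNIV (\<lambda>n. cosets (H n))"
  have "countable I"
    unfolding I_def using countable_cosets[OF R'(1,2)] by (intro countable_SIGMA) auto
  \<comment> \<open>There are infinitely many nonempty blocks, so the index set is in bijection with
    all natural numbers.\<close>
  moreover have "infinite I"
  proof
    assume "finite I"
    then have "finite (fst ` I)"
      by simp
    moreover have "fst ` I = UNIV"
      using cosets_nonempty unfolding I_def by force
    ultimately show False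
      by simp
  qed
  ultimately obtain e :: "nat \<Rightarrow> nat \<times> 'a set" where e: "bij_betw e UNIV I"
    using bij_betw_from_nat_into by blast
  define e' where "e' = inv_into UNIV e"
  have e': "bij_betw e' I UNIV" "\<And>i. i \<in> I \<Longrightarrow> e (e' i) = i" "\<And>n. e' (e n) = n"
    unfolding e'_def using bij_betw_inv_into[OF e] bij_betw_inv_into_right[OF e] bij_betw_inv_into_left[OF e]
    by auto
  define k where "k n = fst (e n)" for n
  define C where "C n = snd (e n)" for n
  have eI: "e n \<in> I" for n
    using e by (auto simp: bij_betw_def)
  then have C: "C n \<in> cosets (H (k n))" for n
    by (simp add: I_def C_def k_def mem_Times_iff Sigma_def) (metis prod.sel)
  define \<sigma> where "\<sigma> g i = (fst i, coset_act (H (fst i)) g (snd i))" for g i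
  define \<tau> where "\<tau> g n = e' (\<sigma> g (e n))" for g n
  define c where "c g n = cocycle (H (k n)) (chi (k n)) g (C n)" for g n
  have \<sigma>I: "\<sigma> g i \<in> I" if "g \<in> carrier G" "i \<in> I" for g i
    using that coset_act_in[OF R'(1)] by (auto simp: \<sigma>_def I_def)
  have \<tau>: "k (\<tau> g n) = k n" "C (\<tau> g n) = coset_act (H (k n)) g (C n)" if "g \<in> carrier G" for g n
    using e'(2)[OF \<sigma>I[OF that eI]] by (auto simp: \<tau>_def k_def C_def \<sigma>_def)
  \<comment> \<open>An index is determined by its block and its coset; equations between indices are
    checked on these two coordinates.\<close>
  have kC_eqI: "n = m" if "k n = k m" "C n = C m" for n m
    using that e'(3) unfolding k_def C_def by (metis prod.collapse)
  have \<tau>_one: "\<tau> \<one> n = n" for n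
    using coset_act_one[OF R'(1) C] by - (rule kC_eqI, auto simp: \<tau>)
  have \<tau>_mult: "\<tau> (g \<otimes> h) n = \<tau> h (\<tau> g n)" if "g \<in> carrier G" "h \<in> carrier G" for g h n
    using coset_act_mult[OF R'(1) C that] that by - (rule kC_eqI, auto simp: \<tau>)
  have \<tau>_bij: "bij (\<tau> g)" if "g \<in> carrier G" for g
  proof (rule o_bij[of "\<tau> (inv g)"])
    show "\<tau> (inv g) \<circ> \<tau> g = id" "\<tau> g \<circ> \<tau> (inv g) = id"
      using that by (simp_all add: fun_eq_iff \<tau>_mult[symmetric] \<tau>_one)
  qed
  have c1: "cmod (c g n) = 1" if "g \<in> carrier G" for g n
    unfolding c_def using equivariant_translate(2)[OF R \<phi>'(1) that C] .
  have loc: "\<exists>U. openin T U \<and> \<one> \<in> U \<and> (\<forall>g\<in>U. \<tau> g n = n \<and> cmod (c g n - 1) < d)" if d: "0 < d" for n d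
  proof -
    obtain U where U: "openin T U" "\<one> \<in> U"
      "\<And>g. g \<in> U \<Longrightarrow> coset_act (H (k n)) g (C n) = C n \<and> cmod (c g n - 1) < d"
      using cocycle_locally_trivial[OF R[of "k n"] C[of n] d] unfolding c_def by blast
    have "\<tau> g n = n" if "g \<in> U" for g
      using U(3)[OF that] openin_carrier[OF U(1) that] by - (rule kC_eqI, auto simp: \<tau>)
    with U show ?thesis
      by blast
  qed
  define \<pi> where "\<pi> = (\<lambda>g (f :: nat \<Rightarrow> complex) n. c g n * f (\<tau> g n))"
  have "orth_rep G T p \<pi>"
    unfolding \<pi>_def
  proof (rule orth_rep_monomial[OF p0 \<tau>_bij c1 \<tau>_one _ \<tau>_mult _ loc])
    show "c \<one> n = 1" for n
      unfolding c_def by (rule cocycle_one[OF R C])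
    show "c (g \<otimes> h) n = c g n * c h (\<tau> g n)" if "g \<in> carrier G" "h \<in> carrier G" for g h n
      unfolding c_def using cocycle_mult[OF R C that] \<tau>[OF that(1)] by simp
  qed
  moreover have "has_almost_inv_lp G T p \<pi>"
  proof -
    have transfer: "psum p UNIV (\<lambda>n. if k n = j then u (C n) else 0) = psum p (cosets (H j)) u"
      "psummable p UNIV (\<lambda>n. if k n = j then u (C n) else 0)"
      if "psummable p (cosets (H j)) u" for j u
      using psum_reindex[OF e, of p "\<lambda>i. if fst i = j then u (snd i) else 0"]
        block_psum[of p "\<lambda>n. cosets (H n)" j u] that
      unfolding k_def C_def by (simp_all add: I_def)
    define F where "F j n = (if k n = j then \<phi> j (rep (C n)) else 0)" for j n
    have F: "F j \<in> lp_space p" "psum p UNIV (F j) = 1" for j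
      using transfer[of j "\<lambda>C. \<phi> j (rep C)"] \<phi>'(2)[of j] norm1[of j]
      by (auto simp: F_def[abs_def] lp_space_iff ind_psummable_def ind_psum_def)
    have disp: "(\<lambda>n. \<pi> g (F j) n - F j n) \<in> lp_space p"
      "psum p UNIV (\<lambda>n. \<pi> g (F j) n - F j n) = displacement p (H j) (\<phi> j) g"
      if g: "g \<in> carrier G" for g j
    proof -
      have "(\<lambda>n. \<pi> g (F j) n - F j n)
          = (\<lambda>n. if k n = j then \<phi> j (inv g \<otimes> rep (C n)) - \<phi> j (rep (C n)) else 0)"
      proof
        fix n
        show "\<pi> g (F j) n - F j n = (if k n = j then \<phi> j (inv g \<otimes> rep (C n)) - \<phi> j (rep (C n)) else 0)"
          using equivariant_translate(1)[OF R \<phi>'(1) g C, of n] \<tau>[OF g, of n]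
          by (auto simp: \<pi>_def F_def c_def)
      qed
      then show "(\<lambda>n. \<pi> g (F j) n - F j n) \<in> lp_space p"
        "psum p UNIV (\<lambda>n. \<pi> g (F j) n - F j n) = displacement p (H j) (\<phi> j) g"
        using transfer[of j "\<lambda>C. \<phi> j (inv g \<otimes> rep C) - \<phi> j (rep C)"]
          displacement_summable(1)[OF p0 R \<phi>' g, of j]
        by (simp_all add: lp_space_iff ind_psummable_def displacement_def ind_psum_def)
    qed
    have "F j \<in> lp_prime G p \<pi>" for j
      unfolding lp_prime_def
    proof (intro CollectI conjI ballI F(1))
      fix h assume h: "h \<in> dual_invariants G p \<pi>"
      have hq: "psummable (conj_exp p) UNIV h"
        and inv: "\<And>g f. g \<in> carrier G \<Longrightarrow> f \<in> lp_space p \<Longrightarrow> lp_pair (\<pi> g f) h = lp_pair f h"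
        using h by (auto simp: dual_invariants_def lp_space_iff)
      \<comment> \<open>Testing invariance on a unit vector turns it into a pointwise
        relation.\<close>
      have h\<tau>: "h (\<tau> g n) = c g n * h n" if g: "g \<in> carrier G" for g n
      proof -
        define \<delta> where "\<delta> = (\<lambda>m. if m = \<tau> g n then 1 else 0 :: complex)"
        have "\<pi> g \<delta> = (\<lambda>m. if m = n then c g n else 0)"
          using \<tau>_bij[OF g] by (auto simp: \<pi>_def \<delta>_def bij_def inj_eq)
        then have "c g n * h n = lp_pair (\<pi> g \<delta>) h"
          by (simp add: lp_pair_single)
        also have "\<dots> = lp_pair \<delta> h"
          unfolding \<delta>_def by (intro inv g single_in_lp_space p0)
        also have "\<dots> = h (\<tau> g n)"
          by (simp add: \<delta>_def lp_pair_single)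
        finally show ?thesis
          by simp
      qed
      \<comment> \<open>The part of \<open>h\<close> on block \<open>j\<close>, the only one that
        pairs with \<open>F j\<close>.\<close>
      define w where "w D = h (e' (j, D))" for D
      have mem: "(j, D) \<in> I" if "D \<in> cosets (H j)" for D
        using that by (simp add: I_def)
      have "((\<lambda>D. \<phi> j (rep D) * w D) has_sum 0) (cosets (H j))"
      proof (rule invariant_functional_vanishes[OF R \<phi>, where q = "conj_exp p"])
        show "w (coset_act (H j) g D) = cocycle (H j) (chi j) g D * w D"
          if "g \<in> carrier G" "D \<in> cosets (H j)" for g D
        proof -
          have "k (e' (j, D)) = j" "C (e' (j, D)) = D" "\<tau> g (e' (j, D)) = e' (j, coset_act (H j) g D)"
            using e'(2)[OF mem[OF that(2)]] by (auto simp: k_def C_def \<tau>_def \<sigma>_def)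
          then show ?thesis
            using h\<tau>[OF that(1), of "e' (j, D)"] by (simp add: w_def c_def)
        qed
        have "psummable (conj_exp p) I (\<lambda>i. h (e' i))"
          using psum_reindex(2)[OF e'(1)] hq by blast
        then have "(\<lambda>i. cmod (h (e' i)) powr conj_exp p) summable_on Pair j ` cosets (H j)"
          unfolding psummable_def by (rule summable_on_subset_banach) (auto simp: I_def)
        then show "psummable (conj_exp p) (cosets (H j)) w"
          by (subst (asm) summable_on_reindex) (auto simp: inj_on_def o_def psummable_def w_def)
      qed
      then have "((\<lambda>i. if fst i = j then \<phi> j (rep (snd i)) * w (snd i) else 0) has_sum 0) I"
        unfolding I_def by (subst block_has_sum)
      then have "((\<lambda>n. if k n = j then \<phi> j (rep (C n)) * w (C n) else 0) has_sum 0) UNIV"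
        using has_sum_reindex_bij_betw[OF e, of "\<lambda>i. if fst i = j then \<phi> j (rep (snd i)) * w (snd i) else 0" 0]
        unfolding k_def C_def by simp
      moreover have "(\<lambda>n. if k n = j then \<phi> j (rep (C n)) * w (C n) else 0) = (\<lambda>n. F j n * h n)"
      proof
        fix n
        show "(if k n = j then \<phi> j (rep (C n)) * w (C n) else 0) = F j n * h n"
          using e'(3)[of n] by (auto simp: F_def w_def k_def C_def)
      qed
      ultimately have "(\<lambda>n. F j n * h n) sums 0"
        using has_sum_imp_sums by metis
      then show "lp_pair (F j) h = 0"
        by (simp add: lp_pair_def sums_iff)
    qed
    moreover have "lp_norm p (F j) = 1" for j
      using F[of j] by (simp add: lp_norm_eq)
    moreover have "\<forall>\<^sub>F j in sequentially. \<forall>g\<in>K. lp_norm p (\<lambda>n. \<pi> g (F j) n - F j n) < d"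
      if K: "compactin T K" and d: "0 < d" for K d
    proof -
      have "\<forall>\<^sub>F j in sequentially. \<forall>g\<in>K. displacement p (H j) (\<phi> j) g < d powr p"
        using ev[OF K, of "d powr p"] d by simp
      then show ?thesis
      proof eventually_elim
        case (elim j)
        then show ?case
          using disp[OF compactin_carrier[OF K]] p0 d by (simp add: lp_norm_less_iff)
      qed
    qed
    ultimately show ?thesis
      unfolding has_almost_inv_lp_def by blast
  qed
  ultimately show ?thesis
    unfolding property_T_lp_def by blast
qed

end

section \<open>From sequence spaces to induced representations\<close>

lemma cmod_powr_4: "cmod z powr 4 = (cmod z) ^ 4"
  by (cases "z = 0") simp_all

lemma psum_isometry:
  assumes "lp_isometry p U" "0 < p" "f \<in> lp_space p"
  shows "U f \<in> lp_space p" "psum p UNIV (U f) = psum p UNIV f"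
proof -
  show U: "U f \<in> lp_space p"
    using assms by (auto simp: lp_isometry_def bij_betw_def)
  have "lp_norm p (U f) = lp_norm p f"
    using assms by (simp add: lp_isometry_def)
  then have "(psum p UNIV (U f) powr (1 / p)) powr p = (psum p UNIV f powr (1 / p)) powr p"
    using U assms by (simp add: lp_norm_eq)
  then show "psum p UNIV (U f) = psum p UNIV f"
    using assms(2) by (simp add: powr_powr psum_nonneg)
qed

lemma isometry_add:
  assumes "lp_isometry p U" "f \<in> lp_space p" "g \<in> lp_space p"
  shows "U (\<lambda>n. f n + g n) = (\<lambda>n. U f n + U g n)" "U (\<lambda>n. f n - g n) = (\<lambda>n. U f n - U g n)"
    "U (\<lambda>n. a * f n) = (\<lambda>n. a * U f n)"
proof -
  have lin: "U (\<lambda>n. a * f n + b * g n) = (\<lambda>n. a * U f n + b * U g n)" for a b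
    using assms by (simp add: lp_isometry_def)
  show "U (\<lambda>n. f n + g n) = (\<lambda>n. U f n + U g n)" "U (\<lambda>n. f n - g n) = (\<lambda>n. U f n - U g n)"
    "U (\<lambda>n. a * f n) = (\<lambda>n. a * U f n)"
    using lin[of 1 1] lin[of 1 "-1"] lin[of a 0] by simp_all
qed

lemma psum_eq_0D:
  assumes "psummable p UNIV f" "psum p UNIV f = 0"
  shows "f n = 0"
  using nonneg_infsum_le_0D[of "\<lambda>n. cmod (f n) powr p" UNIV n] assms
  by (simp add: psummable_def psum_def)

text \<open>The defect of fourth powers in the parallelogram law is non-negative and vanishes
  exactly when \<open>a * b = 0\<close>.\<close>

lemma parallelogram_4:
  "cmod (a + b) ^ 4 + cmod (a - b) ^ 4 - 2 * cmod a ^ 4 - 2 * cmod b ^ 4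
     = 4 * (cmod a)\<^sup>2 * (cmod b)\<^sup>2 + 8 * (Re (a * cnj b))\<^sup>2"
proof -
  have 4: "x ^ 4 = (x\<^sup>2)\<^sup>2" for x :: real
    by simp
  show ?thesis
    unfolding 4 cmod_power2 by (simp add: power2_eq_square algebra_simps)
qed

text \<open>Summed over all coordinates, the defect of \<open>parallelogram_4\<close> depends only
  on the norms of \<open>f + g\<close>, \<open>f - g\<close>, \<open>f\<close> and \<open>g\<close>,
  so \<open>U\<close> preserves the sum. It is 0 for disjoint supports, and its terms are
  non-negative.\<close>

lemma isometry_4_disjoint:
  assumes U: "lp_isometry 4 U" and f: "f \<in> lp_space 4" and g: "g \<in> lp_space 4"
    and disj: "\<And>n. f n * g n = 0"
  shows "U f n * U g n = 0"
proof -
  have fg: "(\<lambda>n. f n + g n) \<in> lp_space 4" "(\<lambda>n. f n - g n) \<in> lp_space 4"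
    using psum_add(1)[of 4 UNIV f g] psum_diff(1)[of 4 UNIV f g] f g by (simp_all add: lp_space_iff)
  have has_sum: "((\<lambda>n. cmod (h n) ^ 4) has_sum psum 4 UNIV h) UNIV" if "h \<in> lp_space 4" for h
    using that has_sum_infsum[of "\<lambda>n. cmod (h n) ^ 4" UNIV]
    by (simp add: lp_space_iff psummable_def psum_def cmod_powr_4)
  define S where "S = psum 4 UNIV f + psum 4 UNIV g"
  have S: "((\<lambda>n. cmod (f n) ^ 4 + cmod (g n) ^ 4) has_sum S) UNIV"
    unfolding S_def by (intro has_sum_add has_sum f g)
  have "cmod (f n + g n) ^ 4 = cmod (f n) ^ 4 + cmod (g n) ^ 4"
    "cmod (f n - g n) ^ 4 = cmod (f n) ^ 4 + cmod (g n) ^ 4" for n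
    using disj[of n] by auto
  then have "psum 4 UNIV (\<lambda>n. f n + g n) = S" "psum 4 UNIV (\<lambda>n. f n - g n) = S"
    using has_sum_unique[OF has_sum[OF fg(1)]] has_sum_unique[OF has_sum[OF fg(2)]] S by simp_all
  then have PS: "((\<lambda>n. cmod (U f n + U g n) ^ 4) has_sum S) UNIV" "((\<lambda>n. cmod (U f n - U g n) ^ 4) has_sum S) UNIV"
    using has_sum[OF psum_isometry(1)[OF U _ fg(1)]] has_sum[OF psum_isometry(1)[OF U _ fg(2)]]
      psum_isometry(2)[OF U _ fg(1)] psum_isometry(2)[OF U _ fg(2)]
    by (simp_all add: isometry_add[OF U f g])
  have UfUg: "((\<lambda>n. cmod (U f n) ^ 4 + cmod (U g n) ^ 4) has_sum S) UNIV"
    unfolding S_def using has_sum_add[OF has_sum[OF psum_isometry(1)[OF U _ f]] has_sum[OF psum_isometry(1)[OF U _ g]]]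
      psum_isometry(2)[OF U _ f] psum_isometry(2)[OF U _ g] by simp
  define D where "D n = 4 * (cmod (U f n))\<^sup>2 * (cmod (U g n))\<^sup>2 + 8 * (Re (U f n * cnj (U g n)))\<^sup>2" for n
  have "((\<lambda>n. (cmod (U f n + U g n) ^ 4 + cmod (U f n - U g n) ^ 4)
      + (- 2) * (cmod (U f n) ^ 4 + cmod (U g n) ^ 4)) has_sum (S + S + (- 2) * S)) UNIV"
    by (intro has_sum_add has_sum_cmult_right PS UfUg)
  moreover have "(\<lambda>n. (cmod (U f n + U g n) ^ 4 + cmod (U f n - U g n) ^ 4)
      + (- 2) * (cmod (U f n) ^ 4 + cmod (U g n) ^ 4)) = D"
    unfolding D_def parallelogram_4[symmetric] by (simp add: algebra_simps)
  ultimately have "(D has_sum 0) UNIV"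
    by simp
  then have "D n = 0"
    by (rule nonneg_has_sum_le_0D) (auto simp: D_def)
  then have "4 * (cmod (U f n))\<^sup>2 * (cmod (U g n))\<^sup>2 \<le> 0"
    unfolding D_def by (smt (verit) zero_le_power2)
  then have "(cmod (U f n) * cmod (U g n))\<^sup>2 \<le> 0"
    by (simp add: power_mult_distrib)
  then show ?thesis
    by simp
qed

text \<open>The preimage of a unit vector is supported at one point: splitting off one coordinate
  gives two disjoint pieces, whose images are disjoint and add up to the unit vector, so one of them
  vanishes.\<close>

lemma Banach_Lamperti_4:
  assumes U: "lp_isometry 4 U" and V: "lp_isometry 4 V"
    and UV: "\<And>f. f \<in> lp_space 4 \<Longrightarrow> U (V f) = f" and VU: "\<And>f. f \<in> lp_space 4 \<Longrightarrow> V (U f) = f"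
  shows "\<exists>c j. cmod c = 1 \<and> (\<forall>f\<in>lp_space 4. U f m = c * f j)"
proof -
  define \<delta> where "\<delta> k a = (\<lambda>n. if n = k then a else 0 :: complex)" for k :: nat and a
  have \<delta>: "\<delta> k a \<in> lp_space 4" for k a
    unfolding \<delta>_def by (rule single_in_lp_space) simp
  have psum_\<delta>: "psum 4 UNIV (\<delta> k a) = cmod a powr 4" for k a
    unfolding psum_def \<delta>_def
    by (intro infsumI has_sum_finite_neutralI[of "{k}"]) auto
  define v where "v = V (\<delta> m 1)"
  have v: "v \<in> lp_space 4" "psum 4 UNIV v = 1" "U v = \<delta> m 1"
    using psum_isometry[OF V _ \<delta>] UV[OF \<delta>] by (simp_all add: v_def psum_\<delta>)
  have "\<exists>j. v j \<noteq> 0"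
  proof (rule ccontr)
    assume "\<not> ?thesis"
    then have "psum 4 UNIV v = 0"
      by (simp add: psum_def)
    with v show False
      by simp
  qed
  then obtain j where j: "v j \<noteq> 0"
    by blast
  define v2 where "v2 = (\<lambda>n. v n - \<delta> j (v j) n)"
  have v2: "v2 \<in> lp_space 4"
    using psum_diff(1)[of 4 UNIV v "\<delta> j (v j)"] v \<delta> by (simp add: lp_space_iff v2_def)
  have sum: "U (\<delta> j (v j)) n + U v2 n = \<delta> m 1 n" for n
    using isometry_add(2)[OF U v(1) \<delta>, of j "v j"] v(3) by (simp add: v2_def)
  have disj: "U (\<delta> j (v j)) n * U v2 n = 0" for n
    by (rule isometry_4_disjoint[OF U \<delta> v2]) (simp add: v2_def \<delta>_def)
  \<comment> \<open>Away from \<open>m\<close> the two images have sum 0 and product 0.\<close>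
  have off: "U (\<delta> j (v j)) n = 0 \<and> U v2 n = 0" if "n \<noteq> m" for n
    using sum[of n] disj[of n] that by (auto simp: \<delta>_def add_eq_0_iff)
  have "psum 4 UNIV (U (\<delta> j (v j))) \<noteq> 0"
    using psum_isometry(2)[OF U _ \<delta>] j by (simp add: psum_\<delta>)
  moreover have "psum 4 UNIV (U (\<delta> j (v j))) = 0" if "U (\<delta> j (v j)) m = 0"
  proof -
    have "U (\<delta> j (v j)) n = 0" for n
      using that off by (cases "n = m") auto
    then show ?thesis
      by (simp add: psum_def)
  qed
  ultimately have "U (\<delta> j (v j)) m \<noteq> 0"
    by blast
  then have U1: "U v2 n = 0" for n
    using disj[of m] off by (cases "n = m") auto
  then have "psum 4 UNIV v2 = 0"
    using psum_isometry(2)[OF U _ v2] by (simp add: psum_def)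
  then have v2_0: "v2 n = 0" for n
    using psum_eq_0D[of 4 v2 n] v2 by (simp add: lp_space_iff)
  have v_eq: "v = \<delta> j (v j)"
  proof
    show "v n = \<delta> j (v j) n" for n
      using v2_0[of n] unfolding v2_def by simp
  qed
  have "cmod (v j) powr 4 = 1"
    using v(2) psum_\<delta>[of j "v j"] unfolding v_eq[symmetric] by simp
  then have vj: "cmod (v j) = 1"
    using power_eq_imp_eq_base[of "cmod (v j)" 4 1] by (simp add: cmod_powr_4)
  have Uj: "U (\<delta> j (v j)) = \<delta> m 1"
    using v(3) unfolding v_eq[symmetric] .
  have "U f m = inverse (v j) * f j" if f: "f \<in> lp_space 4" for f
  proof -
    \<comment> \<open>\<open>r\<close> vanishes at \<open>j\<close>, so its image is disjoint from
      that of \<open>\<delta> j (v j)\<close> and vanishes at \<open>m\<close>; hence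
      \<open>U f m\<close> sees only \<open>f j\<close>.\<close>
    define a where "a = f j / v j"
    define r where "r = (\<lambda>n. f n - a * \<delta> j (v j) n)"
    have a\<delta>: "(\<lambda>n. a * \<delta> j (v j) n) \<in> lp_space 4"
      using psum_cmult(1)[of 4 UNIV "\<delta> j (v j)" a] \<delta> by (simp add: lp_space_iff)
    have r: "r \<in> lp_space 4"
      using psum_diff(1)[of 4 UNIV f "\<lambda>n. a * \<delta> j (v j) n"] f a\<delta> by (simp add: lp_space_iff r_def)
    have "U (\<delta> j (v j)) m * U r m = 0"
      by (rule isometry_4_disjoint[OF U \<delta> r]) (use j in \<open>auto simp: r_def \<delta>_def a_def\<close>)
    moreover have "U (\<delta> j (v j)) m = 1"
      by (simp only: Uj) (simp add: \<delta>_def)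
    ultimately have "U r m = 0"
      by simp
    moreover have "U r = (\<lambda>n. U f n - a * \<delta> m 1 n)"
      unfolding r_def using isometry_add(2)[OF U f a\<delta>] isometry_add(3)[OF U \<delta> \<delta>, of a j "v j"] Uj by simp
    ultimately show ?thesis
      by (simp add: \<delta>_def a_def divide_inverse)
  qed
  then show ?thesis
    using vj by (intro exI[of _ "inverse (v j)"] exI[of _ j]) (simp add: norm_inverse)
qed

text \<open>\<open>\<tau> g\<close> is translation by the inverse of g, hence the reversed order in \<open>\<tau>_mult\<close>.\<close>
locale monomial_action = lcsc G T for G (structure) and T +
  fixes \<tau> :: "'a \<Rightarrow> nat \<Rightarrow> nat" and c :: "'a \<Rightarrow> nat \<Rightarrow> complex"
  assumes c1: "g \<in> carrier G \<Longrightarrow> cmod (c g n) = 1"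
    and \<tau>_one: "\<tau> \<one> n = n"
    and \<tau>_mult: "g \<in> carrier G \<Longrightarrow> h \<in> carrier G \<Longrightarrow> \<tau> (g \<otimes> h) n = \<tau> h (\<tau> g n)"
    and c_mult: "g \<in> carrier G \<Longrightarrow> h \<in> carrier G \<Longrightarrow> c (g \<otimes> h) n = c g n * c h (\<tau> g n)"
    and locally_trivial: "0 < e \<Longrightarrow>
      \<exists>U. openin T U \<and> \<one> \<in> U \<and> (\<forall>g\<in>U. \<tau> g n = n \<and> cmod (c g n - 1) < e)"
begin

section \<open>Orbits and stabilizers of a monomial action\<close>

lemma c_one: "c \<one> n = 1"
  using c_mult[of \<one> \<one> n] c1[of \<one> n] by (auto simp: \<tau>_one)

lemma \<tau>_inv: "g \<in> carrier G \<Longrightarrow> \<tau> (inv g) (\<tau> g n) = n" "g \<in> carrier G \<Longrightarrow> \<tau> g (\<tau> (inv g) n) = n"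
  using \<tau>_mult[of g "inv g" n] \<tau>_mult[of "inv g" g n] by (simp_all add: \<tau>_one)

definition orbit :: "nat \<Rightarrow> nat set" where
  "orbit x = (\<lambda>g. \<tau> g x) ` carrier G"

definition stabilizer :: "nat \<Rightarrow> 'a set" where
  "stabilizer x = {g \<in> carrier G. \<tau> g x = x}"

definition stab_char :: "nat \<Rightarrow> 'a \<Rightarrow> complex" where
  "stab_char x h = (if h \<in> stabilizer x then c h x else 0)"

text \<open>Intertwines the action over the orbit of \<open>x\<close> with the representation
  induced from the stabilizer: \<open>y\<close> parametrises the orbit through
  \<open>\<tau> (inv y) x\<close>, and the multiplier makes the pullback equivariant.\<close>

definition orbit_fun :: "nat \<Rightarrow> (nat \<Rightarrow> complex) \<Rightarrow> 'a \<Rightarrow> complex" where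
  "orbit_fun x v y = (if y \<in> carrier G then c (inv y) x * v (\<tau> (inv y) x) else 0)"

lemma orbit_self: "x \<in> orbit x"
  unfolding orbit_def using \<tau>_one[of x] by (metis image_eqI one_closed)

lemma orbit_eq: "y \<in> orbit x \<Longrightarrow> orbit y = orbit x"
proof -
  have sub: "orbit (\<tau> g x) \<subseteq> orbit x" if "g \<in> carrier G" for g x
    using that by (auto simp: orbit_def \<tau>_mult[symmetric])
  assume "y \<in> orbit x"
  then obtain g where g: "g \<in> carrier G" "y = \<tau> g x"
    by (auto simp: orbit_def)
  then show ?thesis
    using sub[of g x] sub[of "inv g" y] by (simp add: \<tau>_inv)
qed

lemma stabilizer_subgroup: "subgroup (stabilizer x) G"
proof (rule subgroupI)
  show "stabilizer x \<noteq> {}"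
    using \<tau>_one[of x] by (auto simp: stabilizer_def)
  show "inv g \<in> stabilizer x" if "g \<in> stabilizer x" for g
    using that \<tau>_inv(1)[of g x] by (auto simp: stabilizer_def)
  show "g \<otimes> h \<in> stabilizer x" if "g \<in> stabilizer x" "h \<in> stabilizer x" for g h
    using that by (auto simp: stabilizer_def \<tau>_mult)
qed (auto simp: stabilizer_def)

text \<open>\<open>V = UNIV\<close> gives openness of the stabilizer, general \<open>V\<close>
  continuity of the character: passing from \<open>h\<close> to \<open>h \<otimes> u\<close>
  multiplies the value by \<open>c u x\<close>, which is close to 1 for \<open>u\<close> near
  \<open>\<one>\<close>.\<close>

lemma stab_char_open:
  assumes "open V"
  shows "openin T {h \<in> stabilizer x. stab_char x h \<in> V}"
proof (subst openin_subopen, intro ballI)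
  fix h assume h: "h \<in> {h \<in> stabilizer x. stab_char x h \<in> V}"
  then have hG: "h \<in> carrier G" "\<tau> h x = x" "c h x \<in> V"
    by (auto simp: stabilizer_def stab_char_def)
  obtain e where e: "0 < e" "ball (c h x) e \<subseteq> V"
    using assms hG(3) open_contains_ball by blast
  obtain U where U: "openin T U" "\<one> \<in> U" "\<And>g. g \<in> U \<Longrightarrow> \<tau> g x = x \<and> cmod (c g x - 1) < e"
    using locally_trivial[OF e(1), of x] by blast
  have "h <# U \<subseteq> {h \<in> stabilizer x. stab_char x h \<in> V}"
  proof
    fix y assume "y \<in> h <# U"
    then obtain u where u: "u \<in> U" "y = h \<otimes> u"
      by (auto simp: l_coset_def)
    have uG: "u \<in> carrier G"
      using openin_carrier[OF U(1) u(1)] .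
    have y: "\<tau> y x = x" "c y x = c h x * c u x"
      using U(3)[OF u(1)] hG uG by (simp_all add: u(2) \<tau>_mult c_mult)
    have "c y x - c h x = c h x * (c u x - 1)"
      by (simp add: y algebra_simps)
    then have "dist (c h x) (c y x) < e"
      using U(3)[OF u(1)] c1[OF hG(1), of x] by (simp add: dist_norm norm_mult norm_minus_commute[of "c h x"])
    then have "c y x \<in> V"
      using e(2) by (auto simp: subset_iff)
    then show "y \<in> {h \<in> stabilizer x. stab_char x h \<in> V}"
      using y(1) hG(1) uG by (simp add: stabilizer_def stab_char_def u(2))
  qed
  moreover have "h \<in> h <# U"
    unfolding l_coset_def using U(2) hG(1) by (auto intro!: bexI[of _ \<one>])
  ultimately show "\<exists>W. openin T W \<and> h \<in> W \<and> W \<subseteq> {h \<in> stabilizer x. stab_char x h \<in> V}"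
    using openin_l_coset[OF hG(1) U(1)] by blast
qed

lemma stab_R_mon: "(stabilizer x, stab_char x) \<in> R_mon G T"
proof -
  have "stabilizer x \<subseteq> carrier G"
    by (auto simp: stabilizer_def)
  then have "continuous_map (subtopology T (stabilizer x)) euclidean (stab_char x)"
    unfolding continuous_map_def
  proof (intro conjI allI impI)
    fix V :: "complex set" assume "openin euclidean V"
    then have "openin T {h \<in> stabilizer x. stab_char x h \<in> V}"
      using stab_char_open by simp
    then show "openin (subtopology T (stabilizer x))
        {h \<in> topspace (subtopology T (stabilizer x)). stab_char x h \<in> V}"
      using \<open>stabilizer x \<subseteq> carrier G\<close>
      by (auto simp: openin_subtopology topspace_subtopology Int_absorb1
          intro!: exI[of _ "{h \<in> stabilizer x. stab_char x h \<in> V}"])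
  qed auto
  moreover have "openin T (stabilizer x)"
    using stab_char_open[of UNIV x] by simp
  moreover have "g \<otimes> h \<in> stabilizer x" if "g \<in> stabilizer x" "h \<in> stabilizer x" for g h
    using that stabilizer_subgroup subgroup.m_closed by metis
  ultimately show ?thesis
    using stabilizer_subgroup[of x]
    by (auto simp: R_mon_def unitary_char_def stab_char_def stabilizer_def c1 c_mult)
qed

lemma orbit_fun_equivariant: "equivariant (stabilizer x) (stab_char x) (orbit_fun x v)"
  unfolding equivariant_def
proof (intro ballI)
  fix y h assume y: "y \<in> carrier G" and h: "h \<in> stabilizer x"
  have hG: "h \<in> carrier G" "\<tau> h x = x" "\<tau> (inv h) x = x"
    using h \<tau>_inv(1)[of h x] by (auto simp: stabilizer_def)
  have "c h x * c (inv h) x = 1"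
    using c_mult[of h "inv h" x] hG c_one by simp
  moreover have "c h x * cnj (c h x) = 1"
    using c1[OF hG(1), of x] by (simp add: complex_norm_square[symmetric])
  ultimately have "c (inv h) x = cnj (c h x)"
    by (metis mult_cancel_left mult_zero_left zero_neq_one)
  then show "orbit_fun x v (y \<otimes> h) = cnj (stab_char x h) * orbit_fun x v y"
    using y h hG by (simp add: orbit_fun_def stab_char_def inv_mult_group c_mult \<tau>_mult)
qed

text \<open>Orbit-stabilizer correspondence. The inverse makes the point independent of the
  representative of a left coset, as \<open>\<tau>\<close> reverses products.\<close>

lemma orbit_bij: "bij_betw (\<lambda>C. \<tau> (inv (rep C)) x) (cosets (stabilizer x)) (orbit x)"
  unfolding bij_betw_def
proof
  let ?H = "stabilizer x"
  note H = stabilizer_subgroup[of x]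
  note rep = cosets_rep[OF H]
  show "inj_on (\<lambda>C. \<tau> (inv (rep C)) x) (cosets ?H)"
  proof (rule inj_onI)
    fix C D assume C: "C \<in> cosets ?H" and D: "D \<in> cosets ?H"
      and eq: "\<tau> (inv (rep C)) x = \<tau> (inv (rep D)) x"
    define k where "k = inv (rep C) \<otimes> rep D"
    have "\<tau> k x = x"
      using rep(1)[OF C] rep(1)[OF D] eq by (simp add: k_def \<tau>_mult \<tau>_inv)
    then have k: "k \<in> ?H"
      using rep(1)[OF C] rep(1)[OF D] by (simp add: stabilizer_def k_def)
    have "rep D = rep C \<otimes> k"
      using rep(1)[OF C] rep(1)[OF D] by (simp add: k_def m_assoc[symmetric])
    then have "rep D <# ?H = rep C <# ?H"
      using l_coset_eqI[OF H rep(1)[OF C] k] by simp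
    then show "C = D"
      using rep(2)[OF C] rep(2)[OF D] by simp
  qed
  show "(\<lambda>C. \<tau> (inv (rep C)) x) ` cosets ?H = orbit x"
  proof (intro equalityI subsetI)
    fix y assume "y \<in> (\<lambda>C. \<tau> (inv (rep C)) x) ` cosets ?H"
    then show "y \<in> orbit x"
      using rep(1) by (auto simp: orbit_def)
  next
    fix y assume "y \<in> orbit x"
    then obtain g where g: "g \<in> carrier G" "y = \<tau> g x"
      by (auto simp: orbit_def)
    obtain h where h: "h \<in> ?H" "rep (inv g <# ?H) = inv g \<otimes> h"
      using rep_coset[OF H, of "inv g"] g by auto
    have hG: "h \<in> carrier G" "\<tau> (inv h) x = x"
      using h \<tau>_inv(1)[of h x] by (auto simp: stabilizer_def)
    have "\<tau> (inv (rep (inv g <# ?H))) x = y"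
      using g hG by (simp add: h inv_mult_group \<tau>_mult)
    then show "y \<in> (\<lambda>C. \<tau> (inv (rep C)) x) ` cosets ?H"
      using coset_in[of "inv g" ?H] g by (intro image_eqI[of _ _ "inv g <# ?H"]) auto
  qed
qed

lemma orbit_fun_psum:
  "ind_psum p (stabilizer x) (orbit_fun x v) = psum p (orbit x) v"
  "ind_psummable p (stabilizer x) (orbit_fun x v) \<longleftrightarrow> psummable p (orbit x) v"
proof -
  have eq: "cmod (orbit_fun x v (rep C)) = cmod (v (\<tau> (inv (rep C)) x))" if "C \<in> cosets (stabilizer x)" for C
    using cosets_rep(1)[OF stabilizer_subgroup that] by (simp add: orbit_fun_def norm_mult c1)
  show "ind_psum p (stabilizer x) (orbit_fun x v) = psum p (orbit x) v"
    unfolding ind_psum_def psum_reindex(1)[OF orbit_bij, symmetric] by (rule psum_cong) (rule eq)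
  show "ind_psummable p (stabilizer x) (orbit_fun x v) \<longleftrightarrow> psummable p (orbit x) v"
    unfolding ind_psummable_def psum_reindex(2)[OF orbit_bij, symmetric] by (rule psummable_cong) (rule eq)
qed

lemma orbit_fun_displacement:
  assumes g: "g \<in> carrier G"
  shows "displacement p (stabilizer x) (orbit_fun x v) g = psum p (orbit x) (\<lambda>n. c g n * v (\<tau> g n) - v n)"
proof -
  have "displacement p (stabilizer x) (orbit_fun x v) g
      = ind_psum p (stabilizer x) (orbit_fun x (\<lambda>n. c g n * v (\<tau> g n) - v n))"
    unfolding displacement_def ind_psum_def
    using cosets_rep(1)[OF stabilizer_subgroup] g
    by (intro psum_cong) (simp add: orbit_fun_def inv_mult_group c_mult \<tau>_mult algebra_simps)
  then show ?thesis
    by (simp add: orbit_fun_psum)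
qed

text \<open>When the orbit is finite and the character trivial, \<open>c g x\<close> depends only on
  the point \<open>\<tau> g x\<close>. The resulting function \<open>h\<close> on the orbit is
  invariant under the dual representation, and its pairing with \<open>f\<close> is the sum that has
  to vanish.\<close>

lemma orbit_fun_complement:
  assumes p: "1 < p" and rep: "\<And>g f. g \<in> carrier G \<Longrightarrow> f \<in> lp_space p \<Longrightarrow> \<pi> g f = (\<lambda>n. c g n * f (\<tau> g n))"
    and f: "f \<in> lp_prime G p \<pi>"
  shows "orbit_fun x f \<in> ind_complement p (stabilizer x) (stab_char x)"
proof -
  let ?H = "stabilizer x"
  have flp: "f \<in> lp_space p"
    using f by (simp add: lp_prime_def)
  then have "psummable p (orbit x) f"
    unfolding lp_space_iff psummable_def by (rule summable_on_subset_banach) simp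
  moreover have "(\<Sum>C\<in>cosets ?H. orbit_fun x f (rep C)) = 0"
    if fin: "finite (cosets ?H)" and triv: "\<forall>h\<in>?H. stab_char x h = 1"
  proof -
    have fin': "finite (orbit x)"
      using bij_betw_finite[OF orbit_bij] fin by blast
    have c_triv: "c g x = c g' x" if g: "g \<in> carrier G" "g' \<in> carrier G" and eq: "\<tau> g x = \<tau> g' x" for g g'
    proof -
      define k where "k = g \<otimes> inv g'"
      have k: "k \<in> carrier G" "\<tau> k x = x"
        using g eq by (simp_all add: k_def \<tau>_mult \<tau>_inv)
      then have "k \<in> ?H"
        by (simp add: stabilizer_def)
      then have "c k x = 1"
        using triv by (auto simp: stab_char_def)
      moreover have "g = k \<otimes> g'"
        using g by (simp add: k_def m_assoc)
      ultimately show ?thesis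
        using c_mult[OF k(1) g(2), of x] k(2) by simp
    qed
    \<comment> \<open>The choice is harmless by \<open>c_triv\<close>; the value 0 off the finite
      orbit puts \<open>h\<close> into the dual sequence space.\<close>
    define h where "h y = (if y \<in> orbit x then c (SOME g. g \<in> carrier G \<and> \<tau> g x = y) x else 0)" for y
    have h: "h (\<tau> g x) = c g x" if g: "g \<in> carrier G" for g
    proof -
      let ?g = "SOME g'. g' \<in> carrier G \<and> \<tau> g' x = \<tau> g x"
      have "?g \<in> carrier G \<and> \<tau> ?g x = \<tau> g x"
        by (rule someI[of _ g]) (use g in simp)
      moreover have "\<tau> g x \<in> orbit x"
        using g by (simp add: orbit_def)
      ultimately show ?thesis
        using c_triv[of ?g g] g by (simp add: h_def)
    qed
    have h\<tau>: "c a y * h y = h (\<tau> a y)" if a: "a \<in> carrier G" and y: "y \<in> orbit x" for a y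
    proof -
      obtain g where g: "g \<in> carrier G" "y = \<tau> g x"
        using y by (auto simp: orbit_def)
      then have "h (\<tau> a y) = c (g \<otimes> a) x"
        using h[of "g \<otimes> a"] a by (simp add: \<tau>_mult)
      then show ?thesis
        using g a h by (simp add: c_mult)
    qed
    have pair: "lp_pair v h = (\<Sum>y\<in>orbit x. v y * h y)" for v
      unfolding lp_pair_def by (rule suminf_finite[OF fin']) (simp add: h_def)
    have \<tau>_orbit: "bij_betw (\<tau> a) (orbit x) (orbit x)" if a: "a \<in> carrier G" for a
    proof (rule bij_betw_byWitness[where f' = "\<tau> (inv a)"])
      show "\<tau> a ` orbit x \<subseteq> orbit x" "\<tau> (inv a) ` orbit x \<subseteq> orbit x"
        using a by (auto simp: orbit_def \<tau>_mult[symmetric])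
    qed (use a in \<open>simp_all add: \<tau>_inv\<close>)
    have "h \<in> dual_invariants G p \<pi>"
      unfolding dual_invariants_def
    proof (intro CollectI conjI ballI)
      show "h \<in> lp_space (conj_exp p)"
        unfolding lp_space_def by (rule CollectI, rule summable_finite[OF fin']) (simp add: h_def)
      fix a v assume a: "a \<in> carrier G" and v: "v \<in> lp_space p"
      have "lp_pair (\<pi> a v) h = (\<Sum>y\<in>orbit x. v (\<tau> a y) * h (\<tau> a y))"
        unfolding pair using h\<tau>[OF a] by (intro sum.cong) (auto simp: rep[OF a v] mult_ac)
      also have "\<dots> = lp_pair v h"
        unfolding pair by (rule sum.reindex_bij_betw[OF \<tau>_orbit[OF a]])
      finally show "lp_pair (\<pi> a v) h = lp_pair v h" .
    qed
    then have "0 = (\<Sum>y\<in>orbit x. f y * h y)"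
      using f pair[of f] by (simp add: lp_prime_def)
    also have "\<dots> = (\<Sum>C\<in>cosets ?H. f (\<tau> (inv (rep C)) x) * h (\<tau> (inv (rep C)) x))"
      by (rule sum.reindex_bij_betw[OF orbit_bij, symmetric])
    also have "\<dots> = (\<Sum>C\<in>cosets ?H. orbit_fun x f (rep C))"
      using cosets_rep(1)[OF stabilizer_subgroup] h by (intro sum.cong) (auto simp: orbit_fun_def)
    finally show ?thesis
      by simp
  qed
  ultimately show ?thesis
    using orbit_fun_equivariant[of x f]
    by (auto simp: ind_complement_def orbit_fun_psum) (simp add: orbit_fun_def)
qed

lemma almost_invariant_if_lp:
  assumes p: "1 < p" and rep: "\<And>g f. g \<in> carrier G \<Longrightarrow> f \<in> lp_space p \<Longrightarrow> \<pi> g f = (\<lambda>n. c g n * f (\<tau> g n))"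
    and ai: "has_almost_inv_lp G T p \<pi>"
  shows "almost_invariant p"
proof (rule almost_invariant_direct_sum[where ?'i = "nat set"])
  show p0: "0 < p"
    using p by simp
  fix K and e :: real
  assume K: "compactin T K" and e: "0 < e"
  obtain F where F: "\<And>k. F k \<in> lp_prime G p \<pi>" "\<And>k. lp_norm p (F k) = 1"
    and ev: "\<And>K e. compactin T K \<Longrightarrow> 0 < e \<Longrightarrow>
      \<forall>\<^sub>F k in sequentially. \<forall>g\<in>K. lp_norm p (\<lambda>n. \<pi> g (F k) n - F k n) < e"
    using ai unfolding has_almost_inv_lp_def by auto
  \<comment> \<open>Half of the tolerance, because the orbits kept below carry at least half of the
    norm.\<close>
  define \<epsilon> where "\<epsilon> = (e / 2) powr (1 / p)"
  have \<epsilon>: "0 < \<epsilon>" "\<epsilon> powr p = e / 2"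
    using e p by (simp_all add: \<epsilon>_def powr_powr)
  obtain k where k: "\<And>g. g \<in> K \<Longrightarrow> lp_norm p (\<lambda>n. \<pi> g (F k) n - F k n) < \<epsilon>"
    using ev[OF K \<epsilon>(1)] by (auto simp: eventually_sequentially)
  define f where "f = F k"
  have f: "f \<in> lp_prime G p \<pi>" "f \<in> lp_space p"
    using F(1)[of k] by (auto simp: f_def lp_prime_def)
  have "(psum p UNIV f powr (1 / p)) powr p = 1"
    using F(2)[of k] f(2) by (simp add: lp_norm_eq f_def)
  then have f1: "psum p UNIV f = 1"
    using p0 by (simp add: powr_powr psum_nonneg)
  define d where "d g = (\<lambda>n. c g n * f (\<tau> g n) - f n)" for g
  have bij: "bij (\<tau> g)" if "g \<in> carrier G" for g
    by (rule o_bij[of "\<tau> (inv g)"]) (use that in \<open>simp_all add: fun_eq_iff \<tau>_inv\<close>)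
  have d: "psummable p UNIV (d g)" if g: "g \<in> carrier G" for g
    unfolding d_def
    using psum_diff(1)[OF p0, of UNIV "\<lambda>n. c g n * f (\<tau> g n)" f] f(2)
      psum_monomial(2)[OF bij[OF g], of "c g" p f, OF c1[OF g]]
    by (simp add: lp_space_iff)
  have d_small: "psum p UNIV (d g) < e / 2" if g: "g \<in> K" for g
  proof -
    have gG: "g \<in> carrier G"
      using compactin_carrier[OF K g] .
    have "lp_norm p (d g) < \<epsilon>"
      using k[OF g] rep[OF gG f(2)] by (simp add: d_def f_def)
    then show ?thesis
      using lp_norm_less_iff[of "d g" p \<epsilon>] d[OF gG] p0 \<epsilon> by (simp add: lp_space_iff)
  qed
  obtain N where N: "finite N" "dist (\<Sum>n\<in>N. cmod (f n) powr p) (psum p UNIV f) \<le> 1 / 2"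
    using infsum_finite_approximation[of "\<lambda>n. cmod (f n) powr p" UNIV "1 / 2"] f(2)
    by (auto simp: lp_space_iff psummable_def psum_def)
  \<comment> \<open>Indexed by orbits and not by points, so that no orbit is counted twice; together
    they contain \<open>N\<close> and hence half of the norm.\<close>
  define J where "J = orbit ` N"
  have J: "finite J"
    using N by (simp add: J_def)
  define b where "b X = (SOME x. x \<in> X)" for X :: "nat set"
  have b: "orbit (b X) = X" if "X \<in> J" for X
  proof -
    obtain n where n: "X = orbit n"
      using \<open>X \<in> J\<close> unfolding J_def by blast
    have "b X \<in> X"
      unfolding b_def n by (rule someI[of _ n]) (rule orbit_self)
    then show ?thesis
      using orbit_eq n by blast
  qed
  have disj: "X \<inter> Y = {}" if X: "X \<in> J" and Y: "Y \<in> J" and ne: "X \<noteq> Y" for X Y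
  proof (rule ccontr)
    assume "X \<inter> Y \<noteq> {}"
    then obtain z where z: "z \<in> X" "z \<in> Y"
      by blast
    have "orbit z = orbit (b X)" "orbit z = orbit (b Y)"
      using orbit_eq[of z "b X"] orbit_eq[of z "b Y"] z b[OF X] b[OF Y] by simp_all
    then show False
      using b[OF X] b[OF Y] ne by simp
  qed
  have psum_J: "(\<Sum>X\<in>J. psum p X v) = psum p (\<Union>J) v" "psum p (\<Union>J) v \<le> psum p UNIV v"
    if v: "psummable p UNIV v" for v
  proof -
    have sub: "(\<lambda>n. cmod (v n) powr p) summable_on X" for X
      using v unfolding psummable_def by (rule summable_on_subset_banach) simp
    show "(\<Sum>X\<in>J. psum p X v) = psum p (\<Union>J) v"
      unfolding psum_def using sum_infsum[OF J, of "\<lambda>n. cmod (v n) powr p" "\<lambda>X. X"] sub disj by simp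
    show "psum p (\<Union>J) v \<le> psum p UNIV v"
      unfolding psum_def by (rule infsum_mono_neutral) (use sub in auto)
  qed
  have fJ: "1 / 2 \<le> (\<Sum>X\<in>J. psum p X f)"
  proof -
    have "1 / 2 \<le> (\<Sum>n\<in>N. cmod (f n) powr p)"
      using N(2) unfolding f1 dist_real_def by linarith
    also have "\<dots> \<le> psum p (\<Union>J) f"
      unfolding psum_def
    proof (rule finite_sum_le_infsum)
      show "(\<lambda>n. cmod (f n) powr p) summable_on \<Union>J"
        using f(2) unfolding lp_space_iff psummable_def by (rule summable_on_subset_banach) simp
      show "N \<subseteq> \<Union>J"
        using orbit_self by (auto simp: J_def)
    qed (use N in auto)
    finally show ?thesis
      using psum_J(1) f(2) by (simp add: lp_space_iff)
  qed
  have dJ: "(\<Sum>X\<in>J. psum p X (d g)) \<le> e * (\<Sum>X\<in>J. psum p X f)" if g: "g \<in> K" for g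
  proof -
    have "(\<Sum>X\<in>J. psum p X (d g)) \<le> e * (1 / 2)"
      using psum_J[OF d[OF compactin_carrier[OF K g]]] d_small[OF g] by simp
    also have "\<dots> \<le> e * (\<Sum>X\<in>J. psum p X f)"
      using fJ e by (intro mult_left_mono) auto
    finally show ?thesis .
  qed
  show "\<exists>(J :: nat set set) H chi \<phi>. finite J \<and>
        (\<forall>i\<in>J. (H i, chi i) \<in> R_mon G T \<and> \<phi> i \<in> ind_complement p (H i) (chi i)) \<and>
        0 < (\<Sum>i\<in>J. ind_psum p (H i) (\<phi> i)) \<and>
        (\<forall>g\<in>K. (\<Sum>i\<in>J. displacement p (H i) (\<phi> i) g) \<le> e * (\<Sum>i\<in>J. ind_psum p (H i) (\<phi> i)))"
  proof (intro exI conjI ballI)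
    show "finite J"
      by (rule J)
    show "(stabilizer (b X), stab_char (b X)) \<in> R_mon G T" for X
      by (rule stab_R_mon)
    show "orbit_fun (b X) f \<in> ind_complement p (stabilizer (b X)) (stab_char (b X))" for X
      using orbit_fun_complement[OF p rep f(1)] .
    have eq: "(\<Sum>X\<in>J. ind_psum p (stabilizer (b X)) (orbit_fun (b X) f)) = (\<Sum>X\<in>J. psum p X f)"
      by (intro sum.cong) (simp_all add: orbit_fun_psum b)
    then show "0 < (\<Sum>X\<in>J. ind_psum p (stabilizer (b X)) (orbit_fun (b X) f))"
      using fJ by simp
    fix g assume g: "g \<in> K"
    have "(\<Sum>X\<in>J. displacement p (stabilizer (b X)) (orbit_fun (b X) f) g) = (\<Sum>X\<in>J. psum p X (d g))"
      using compactin_carrier[OF K g] by (intro sum.cong) (simp_all add: orbit_fun_displacement b d_def)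
    then show "(\<Sum>X\<in>J. displacement p (stabilizer (b X)) (orbit_fun (b X) f) g)
        \<le> e * (\<Sum>X\<in>J. ind_psum p (stabilizer (b X)) (orbit_fun (b X) f))"
      using dJ[OF g] eq by simp
  qed
qed

end

context lcsc
begin

lemma almost_invariant_if_not_property_T_l4:
  assumes "\<not> property_T_lp G T 4"
  shows "almost_invariant 4"
proof -
  obtain \<pi> where orth: "orth_rep G T 4 \<pi>" and ai: "has_almost_inv_lp G T 4 \<pi>"
    using assms by (auto simp: property_T_lp_def)
  have iso: "lp_isometry 4 (\<pi> g)" if "g \<in> carrier G" for g
    using orth that by (simp add: orth_rep_def)
  have \<pi>_mult: "\<pi> (g \<otimes> h) f = \<pi> g (\<pi> h f)" if "g \<in> carrier G" "h \<in> carrier G" "f \<in> lp_space 4" for g h f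
    using orth that by (simp add: orth_rep_def)
  have \<pi>_one: "\<pi> \<one> f = f" if "f \<in> lp_space 4" for f
    using orth that by (simp add: orth_rep_def)
  have "\<exists>c j. cmod c = 1 \<and> (\<forall>f\<in>lp_space 4. \<pi> g f n = c * f j)" if g: "g \<in> carrier G" for g n
    by (rule Banach_Lamperti_4[OF iso[OF g] iso[OF inv_closed[OF g]]])
       (use g in \<open>simp_all add: \<pi>_mult[symmetric] \<pi>_one\<close>)
  \<comment> \<open>The implication under the quantifiers makes the choice of \<open>c\<close> and
    \<open>\<tau>\<close> total in \<open>g\<close>.\<close>
  then have "\<exists>c j. g \<in> carrier G \<longrightarrow> cmod c = 1 \<and> (\<forall>f\<in>lp_space 4. \<pi> g f n = c * f j)" for g n
    by blast
  then obtain c \<tau> where c1: "\<And>g n. g \<in> carrier G \<Longrightarrow> cmod (c g n) = 1"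
    and rep: "\<And>g n f. g \<in> carrier G \<Longrightarrow> f \<in> lp_space 4 \<Longrightarrow> \<pi> g f n = c g n * f (\<tau> g n)"
    by metis
  define \<delta> where "\<delta> j = (\<lambda>n. if n = j then 1 else 0 :: complex)" for j :: nat
  have \<delta>: "\<delta> j \<in> lp_space 4" for j
    unfolding \<delta>_def by (rule single_in_lp_space) simp
  \<comment> \<open>\<open>c\<close> and \<open>\<tau>\<close> come from separate choices for each
    \<open>g\<close> and \<open>n\<close>; uniqueness of the pair forces the multiplication
    laws.\<close>
  have unique: "j = j' \<and> a = a'" if "a \<noteq> 0" "\<And>f. f \<in> lp_space 4 \<Longrightarrow> a * f j = a' * f j'"
    for a a' :: complex and j j' :: nat
    using that(1) that(2)[OF \<delta>, of j] by (auto simp: \<delta>_def split: if_split_asm)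
  have 1: "\<tau> \<one> n = n \<and> c \<one> n = 1" for n
  proof -
    have "n = \<tau> \<one> n \<and> 1 = c \<one> n"
    proof (rule unique)
      show "1 * f n = c \<one> n * f (\<tau> \<one> n)" if "f \<in> lp_space 4" for f
        using rep[OF one_closed that, of n] \<pi>_one[OF that] by simp
    qed simp
    then show ?thesis
      by simp
  qed
  have mult: "\<tau> (g \<otimes> h) n = \<tau> h (\<tau> g n) \<and> c (g \<otimes> h) n = c g n * c h (\<tau> g n)"
    if g: "g \<in> carrier G" and h: "h \<in> carrier G" for g h n
  proof (rule unique)
    show "c (g \<otimes> h) n \<noteq> 0"
      using c1[of "g \<otimes> h" n] g h by auto
    fix f :: "nat \<Rightarrow> complex" assume f: "f \<in> lp_space 4"
    then have "\<pi> h f \<in> lp_space 4"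
      using psum_isometry(1)[OF iso[OF h]] by simp
    then show "c (g \<otimes> h) n * f (\<tau> (g \<otimes> h) n) = c g n * c h (\<tau> g n) * f (\<tau> h (\<tau> g n))"
      using rep[of "g \<otimes> h" f n] rep[of g "\<pi> h f" n] rep[of h f "\<tau> g n"] \<pi>_mult[OF g h f] g h f
      by (simp add: mult.assoc)
  qed
  have loc: "\<exists>U. openin T U \<and> \<one> \<in> U \<and> (\<forall>g\<in>U. \<tau> g n = n \<and> cmod (c g n - 1) < e)" if e: "0 < e" for e n
  proof -
    \<comment> \<open>The bound by 1 excludes \<open>\<tau> g n \<noteq> n\<close>, where coordinate
      \<open>n\<close> of the difference has modulus 1.\<close>
    define d where "d = min e 1"
    have d: "0 < d" "d \<le> e" "d \<le> 1"
      using e by (auto simp: d_def)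
    then obtain U where U: "openin T U" "\<one> \<in> U"
      "\<And>g. g \<in> U \<Longrightarrow> lp_norm 4 (\<lambda>m. \<pi> g (\<delta> n) m - \<pi> \<one> (\<delta> n) m) < d"
      using orth \<delta> one_closed unfolding orth_rep_def by meson
    have "\<tau> g n = n \<and> cmod (c g n - 1) < e" if g: "g \<in> U" for g
    proof -
      have gG: "g \<in> carrier G"
        using openin_carrier[OF U(1) g] .
      define v where "v = (\<lambda>m. \<pi> g (\<delta> n) m - \<delta> n m)"
      have v: "v \<in> lp_space 4"
        using psum_diff(1)[of 4 UNIV "\<pi> g (\<delta> n)" "\<delta> n"] \<delta> psum_isometry(1)[OF iso[OF gG] _ \<delta>]
        by (simp add: lp_space_iff v_def)
      have "lp_norm 4 v < d"
        using U(3)[OF g] by (simp add: v_def \<pi>_one[OF \<delta>])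
      then have "psum 4 UNIV v < d powr 4"
        using lp_norm_less_iff[OF v] d by simp
      moreover have "cmod (v n) powr 4 \<le> psum 4 UNIV v"
        using psum_split(1)[of 4 UNIV v "{n}"] v psum_nonneg[of 4 "UNIV - {n}" v] by (simp add: lp_space_iff)
      ultimately have "cmod (v n) powr 4 < d powr 4"
        by simp
      then have vn: "cmod (v n) < d"
        using powr_mono2[of 4 "d" "cmod (v n)"] d by linarith
      have v_eq: "v n = c g n * \<delta> n (\<tau> g n) - 1"
        by (simp add: v_def rep[OF gG \<delta>]) (simp add: \<delta>_def)
      have "\<tau> g n = n"
        using vn d by (rule_tac ccontr) (simp add: v_eq \<delta>_def)
      then show ?thesis
        using vn d by (simp add: v_eq \<delta>_def)
    qed
    with U show ?thesis
      by blast
  qed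
  interpret monomial_action G T \<tau> c
    by unfold_locales (use c1 1 mult loc in auto)
  show ?thesis
    by (rule almost_invariant_if_lp[where \<pi> = \<pi>]) (use rep ai in auto)
qed

end

theorem theorem1p2:
  fixes G :: "('a, 'b) monoid_scheme" and T :: "'a topology"
  assumes "lcsc_group G T"
  shows "(\<exists>p::real. 1 < p \<and> p \<noteq> 2 \<and> property_T_lp G T p) \<longleftrightarrow> property_T_Rmon G T"
proof -
  interpret lcsc G T
    using assms by (simp add: lcsc_def lcsc_axioms_def lcsc_group_def topological_group_def)
  show ?thesis
  proof
    assume "\<exists>p::real. 1 < p \<and> p \<noteq> 2 \<and> property_T_lp G T p"
    then obtain p where p: "1 < p" "property_T_lp G T p"
      by blast
    show "property_T_Rmon G T"
      unfolding property_T_Rmon_def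
    proof
      assume "has_almost_inv_Rmon G T"
      then have "almost_invariant p"
        using almost_invariant_if_Rmon almost_invariant_exponent[of 2 p] p by simp
      then show False
        using not_property_T_lp_if_almost_invariant p by blast
    qed
  next
    assume T: "property_T_Rmon G T"
    have "property_T_lp G T 4"
    proof (rule ccontr)
      assume "\<not> property_T_lp G T 4"
      then have "almost_invariant 2"
        using almost_invariant_if_not_property_T_l4 almost_invariant_exponent[of 4 2] by simp
      then show False
        using Rmon_if_almost_invariant T by (simp add: property_T_Rmon_def)
    qed
    then show "\<exists>p::real. 1 < p \<and> p \<noteq> 2 \<and> property_T_lp G T p"
      by (intro exI[of _ 4]) simp
  qed
qed

end
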